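(* Consider the FeGSAM algorithm described in the context, with synchronization period $K$ and $c_{FSAM}=1-\frac{\alpha\varphi_2}{2}\in(0,1)$, under the mixing, contraction, Lipschitz/boundedness and independence assumptions stated there. Write $\theta_t=\frac1N\sum_{i=1}^N\theta^i_t$ and let $\theta_{\hat T}$ be the output of the algorithm after $T$ iterations. Let $\tau_\alpha=\lceil 2\log_\rho\alpha\rceil$. For $T\ge\max\{K+\tau_\alpha,2\tau_\alpha\}$ and small enough step size $\alpha$ (in the sense recalled in the context), $$\mathbb E\big[\|\theta_{\hat T}-\theta^*\|_c^2\big]\le \mathcal C_1\frac1\alpha c_{FSAM}^{T-2\tau_\alpha+1}+\mathcal C_2\frac{\alpha\tau_\alpha^2}{N}+\mathcal C_3(K-1)\alpha^2\tau_\alpha+\mathcal C_4(K-1)^2\varepsilon\alpha^2\tau_\alpha+\mathcal C_5\alpha^3\tau_\alpha^2,$$ where $\mathcal C_1,\dots,\mathcal C_5$ are constants independent of $K,\alpha,N$.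
   Context: FeGSAM algorithm. There are $N$ agents, a norm $\|\cdot\|_c$ on $\mathbb R^d$, a step size $\alpha>0$ and a synchronization period $K\ge1$. Agent $i$ has functions $G^i(\theta,y)\in\mathbb R^d$, $b^i(y)\in\mathbb R^d$ and a noise process $(y^i_t)_{t\ge0}$ that is Markovian in $t$. All agents start at a common $\theta^i_0=\theta_0$. For $t=0,\dots,T-1$: $\theta^i_{t+1}=\theta^i_t+\alpha\big(G^i(\theta^i_t,y^i_t)-\theta^i_t+b^i(y^i_t)\big)$, and if $K$ divides $t+1$ every $\theta^i_{t+1}$ is then replaced by $\frac1N\sum_j\theta^j_{t+1}$. Finally $\hat T$ is sampled, independently of all other randomness, from $q(t)=c_{FSAM}^{-t}/\sum_{t'=0}^{T-1}c_{FSAM}^{-t'}$, $t=0,\dots,T-1$, and the output is $\theta_{\hat T}=\frac1N\sum_i\theta^i_{\hat T}$. $\mathcal F_t$ is the sigma-algebra generated by $\{\theta^i_r\}_{r\le t,\,i\le N}$ and $\mathbb E_t[\cdot]=\mathbb E[\cdot\mid\mathcal F_t]$. Mixing assumption. For every $i$ there is a function $\bar G^i$ with $\lim_{t\to\infty}\mathbb E[G^i(\theta,y^i_t)]=\bar G^i(\theta)$, and $\mathbb E[b^i(y^i_t)]$ converges to a vector $\bar b^i$. $\theta^{i,*}$ denotes the fixed point $\bar G^i(\theta^{i,*})+\bar b^i=\theta^{i,*}$, $\theta^*$ the fixed point of the averaged operator, $\frac1N\sum_i\bar G^i(\theta^* )=\theta^*$ (this is the vector $0$), $\eta_i=\|\theta^{i,*}-\theta^*\|_c$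 and $\varepsilon=\frac1N\sum_i\eta_i$. There exist $m_1,m_2,m_3,m_4\ge0$ and $\rho\in[0,1)$ such that for every $i$: $\|\bar G^i(\theta)-\mathbb E[G^i(\theta,y^i_t)]\|_c\le m_1\|\theta\|_c\rho^t$, $\|\mathbb E[b^i(y^i_t)]\|_c\le m_2\rho^t+m_3\eta_i$, $\|\mathbb E[\frac1N\sum_ib^i(y^i_t)]\|_c\le m_4\rho^t$. Contraction assumption. There is $\gamma_c\in(0,1)$ with $\|\bar G^i(\theta_1)-\bar G^i(\theta_2)\|_c\le\gamma_c\|\theta_1-\theta_2\|_c$ for all $i,\theta_1,\theta_2$. Lipschitz/boundedness assumption. There are constants $A_1,A_2,B$ with $\|G^i(\theta_1,y)-G^i(\theta_2,y)\|_c\le A_1\|\theta_1-\theta_2\|_c$, $\|G^i(\theta,y)\|_c\le A_2\|\theta\|_c$, $\|b^i(y)\|_c\le B$ for all $i,\theta,\theta_1,\theta_2,y$. Independence assumption. The noise is independent across agents: for all measurable $f,g$, all $r\le t$ and $i\ne j$, $\mathbb E_{t-r}[f(y^i_t)g(y^j_t)]=\mathbb E_{t-r}[f(y^i_t)]\,\mathbb E_{t-r}[g(y^j_t)]$. Definition of $\varphi_2$. $\|\cdot\|_s$ is a norm on $\mathbb R^d$ such that $\frac12\|\cdot\|_s^2$ is $L$-smooth with respect to $\|\cdot\|_s$; $l_{cs},u_{cs}>0$ satisfy $l_{cs}\|\cdot\|_s\le\|\cdot\|_c\le u_{cs}\|\cdot\|_s$; $\psi>0$. $\varphi_1=\frac{1+\psi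 u_{cs}^2}{1+\psi l_{cs}^2}$, $\varphi_2=1-\gamma_c\varphi_1^{1/2}$, with $\psi$ small enough that $\varphi_2\in(0,1)$. Small enough step size. With $\tau=\tau_\alpha$, the requirements on $\alpha$ are: (a) $\alpha\le\min\{\frac1{360\tau(A_2^2+1)},\frac{\varphi_2}{2C_{15}(\tau)}\}$; (b) $\alpha^2\le\min\{\frac1{\varphi_2^2},\frac{\ln(5/4)}{2(1+\tilde A_1)(K-1)^2}\}$, $\alpha^2(\log_\rho\alpha+1)\le\frac v{2K^2}$, $\alpha^2(\log_\rho\alpha+1)^3\exp(\alpha\varphi_2(2\log_\rho\alpha+1))\le\frac v{4K}\exp\big(-\varphi_2\sqrt{\tfrac{\ln(5/4)}{2(1+\tilde A_1)}}\big)$; (c) $\alpha\tau\le\min\{\frac1{24\sqrt{A_2^2+1}},\frac1{8(A_2+1)}\}$; (d) $\alpha\le\min\{\frac1{C_1},\frac1{8\tau C_2},\frac1{40\tau C_1^2}\}$. Here $u_{cm}=(1+\psi u_{cs}^2)^{1/2}$; $l_{c2}\|\cdot\|_2\le\|\cdot\|_c\le u_{c2}\|\cdot\|_2$; $\tilde A_1=\frac{2A_1^2u_{c2}^2}{l_{c2}^2}$, $\tilde A_2=\frac{2A_2^2u_{c2}^2}{l_{c2}^2}$; $v=\frac{\varphi_2}{80\tilde A_2C_{17}u_{cm}^2}$; $C_1=3\sqrt{A_2^2+1}$, $C_2=3C_1+8$; $\zeta_4=\sqrt{\varphi_2/10}$, $\zeta_2=\sqrt{\frac{\varphi_2}{10}\cdot\frac{\psi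 l_{cs}^2}{2LA_2}}$, $\zeta_3=\sqrt{\frac{\varphi_2}{10}\cdot\frac{\psi l_{cs}^2}{L(A_1+1)}}$; $C_3=\frac{m_4L}{\psi l_{cs}^2}$; $C_4=\frac L{\psi l_{cs}^2}\big(\frac L{2\psi l_{cs}^2}+\alpha A_2(1+\frac{u_{cm}^2}{\zeta_2^2})+\alpha(A_1+1)(\frac{3u_{cm}^2}{2\zeta_3^2}+2)+3m_1\alpha^2\big)$; $C_5=\frac L{\psi l_{cs}^2}\big((\frac{3u_{cm}^2}{2\zeta_3^2}+\frac32)(A_1+1)+A_2+\frac{Lu_{cm}^2}{2l_{cs}^2\zeta_4^2\psi}+\frac{3A_1^2\alpha^2}2\big)$; $C_6=\frac L{2l_{cs}^2\psi}\big((\frac{3u_{cm}^2}{\zeta_3^2}+3)(A_1+1)+m_1\alpha\big)$; $C_{15}(\tau)=\big(\frac{6m_1Lu_{cm}^2}{l_{cs}^2\psi}+\frac{6L(A_2+1)^2u_{cm}^2}{2\psi l_{cs}^2}+144(A_2^2+1)C_4u_{cm}^2\big)\tau^2$; $C_{17}=3A_1C_3+8A_1^2C_4+C_5+C_6$.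
   Formalization: Mixing bounds are assumed conditionally on the noise state at every time s≤t, with rate ρ^(t-s) (noise constant in time refutes the unconditional form); each agent's noise is Markov given all agents' past noise; ρ=0 and A_2=0, where log_ρ, v are undefined, are excluded. *)

theory Defs
  imports "HOL-Probability.Probability"
begin

section \<open>Norms and smoothness\<close>

definition is_norm :: "('a::real_vector \<Rightarrow> real) \<Rightarrow> bool" where
  "is_norm n \<longleftrightarrow>
     (\<forall>x. 0 \<le> n x) \<and> (\<forall>x. n x = 0 \<longleftrightarrow> x = 0) \<and>
     (\<forall>a x. n (a *\<^sub>R x) = \<bar>a\<bar> * n x) \<and>
     (\<forall>x y. n (x + y) \<le> n x + n y)"

definition smooth_wrt :: "real \<Rightarrow> ('a::real_inner \<Rightarrow> real) \<Rightarrow> ('a \<Rightarrow> real) \<Rightarrow> bool" where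
  "smooth_wrt L n f \<longleftrightarrow>
     convex_on UNIV f \<and>
     (\<exists>g. \<forall>x. GDERIV f x :> g x \<and>
        (\<forall>y. f y \<le> f x + g x \<bullet> (y - x) + L / 2 * (n (y - x))\<^sup>2))"


section \<open>The numerical constants and the step size condition\<close>

record fegsam_par =
  pA1 :: real  pA2 :: real  pB :: real
  pm1 :: real  pm2 :: real  pm3 :: real  pm4 :: real
  prho :: real  pgamma :: real
  pL :: real  ppsi :: real
  plcs :: real  pucs :: real
  plc2 :: real  puc2 :: real

definition phi1 :: "fegsam_par \<Rightarrow> real" where
  "phi1 p = (1 + ppsi p * (pucs p)\<^sup>2) / (1 + ppsi p * (plcs p)\<^sup>2)"

definition phi2 :: "fegsam_par \<Rightarrow> real" where
  "phi2 p = 1 - pgamma p * sqrt (phi1 p)"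

definition ucm :: "fegsam_par \<Rightarrow> real" where
  "ucm p = sqrt (1 + ppsi p * (pucs p)\<^sup>2)"

definition A1t :: "fegsam_par \<Rightarrow> real" where
  "A1t p = 2 * (pA1 p)\<^sup>2 * (puc2 p)\<^sup>2 / (plc2 p)\<^sup>2"

definition A2t :: "fegsam_par \<Rightarrow> real" where
  "A2t p = 2 * (pA2 p)\<^sup>2 * (puc2 p)\<^sup>2 / (plc2 p)\<^sup>2"

text \<open>
  If \<open>pA2 p = 0\<close>, then \<open>zeta2 p = 0\<close> and the term \<open>pA2 p * (1 + (ucm p)\<^sup>2 / (zeta2 p)\<^sup>2)\<close>
  occurring in \<open>C_4\<close> below is \<open>0\<close>.
\<close>

definition zeta2 :: "fegsam_par \<Rightarrow> real" where
  "zeta2 p = sqrt (phi2 p / 10 * (ppsi p * (plcs p)\<^sup>2 / (2 * pL p * pA2 p)))"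

definition zeta3 :: "fegsam_par \<Rightarrow> real" where
  "zeta3 p = sqrt (phi2 p / 10 * (ppsi p * (plcs p)\<^sup>2 / (pL p * (pA1 p + 1))))"

definition zeta4 :: "fegsam_par \<Rightarrow> real" where
  "zeta4 p = sqrt (phi2 p / 10)"

definition C_1 :: "fegsam_par \<Rightarrow> real" where
  "C_1 p = 3 * sqrt ((pA2 p)\<^sup>2 + 1)"

definition C_2 :: "fegsam_par \<Rightarrow> real" where
  "C_2 p = 3 * C_1 p + 8"

definition C_3 :: "fegsam_par \<Rightarrow> real" where
  "C_3 p = pm4 p * pL p / (ppsi p * (plcs p)\<^sup>2)"

definition C_4 :: "fegsam_par \<Rightarrow> real \<Rightarrow> real" where
  "C_4 p \<alpha> =
     pL p / (ppsi p * (plcs p)\<^sup>2) *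
     (pL p / (2 * ppsi p * (plcs p)\<^sup>2)
      + \<alpha> * pA2 p * (1 + (ucm p)\<^sup>2 / (zeta2 p)\<^sup>2)
      + \<alpha> * (pA1 p + 1) * (3 * (ucm p)\<^sup>2 / (2 * (zeta3 p)\<^sup>2) + 2)
      + 3 * pm1 p * \<alpha>\<^sup>2)"

definition C_5 :: "fegsam_par \<Rightarrow> real \<Rightarrow> real" where
  "C_5 p \<alpha> =
     pL p / (ppsi p * (plcs p)\<^sup>2) *
     ((3 * (ucm p)\<^sup>2 / (2 * (zeta3 p)\<^sup>2) + 3 / 2) * (pA1 p + 1)
      + pA2 p
      + pL p * (ucm p)\<^sup>2 / (2 * (plcs p)\<^sup>2 * (zeta4 p)\<^sup>2 * ppsi p)
      + 3 * (pA1 p)\<^sup>2 * \<alpha>\<^sup>2 / 2)"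

definition C_6 :: "fegsam_par \<Rightarrow> real \<Rightarrow> real" where
  "C_6 p \<alpha> =
     pL p / (2 * (plcs p)\<^sup>2 * ppsi p) *
     ((3 * (ucm p)\<^sup>2 / (zeta3 p)\<^sup>2 + 3) * (pA1 p + 1) + pm1 p * \<alpha>)"

definition C_15 :: "fegsam_par \<Rightarrow> real \<Rightarrow> nat \<Rightarrow> real" where
  "C_15 p \<alpha> \<tau> =
     (6 * pm1 p * pL p * (ucm p)\<^sup>2 / ((plcs p)\<^sup>2 * ppsi p)
      + 6 * pL p * (pA2 p + 1)\<^sup>2 * (ucm p)\<^sup>2 / (2 * ppsi p * (plcs p)\<^sup>2)
      + 144 * ((pA2 p)\<^sup>2 + 1) * C_4 p \<alpha> * (ucm p)\<^sup>2) * (real \<tau>)\<^sup>2"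

definition C_17 :: "fegsam_par \<Rightarrow> real \<Rightarrow> real" where
  "C_17 p \<alpha> =
     3 * pA1 p * C_3 p + 8 * (pA1 p)\<^sup>2 * C_4 p \<alpha> + C_5 p \<alpha> + C_6 p \<alpha>"

definition vconst :: "fegsam_par \<Rightarrow> real \<Rightarrow> real" where
  "vconst p \<alpha> = phi2 p / (80 * A2t p * C_17 p \<alpha> * (ucm p)\<^sup>2)"

text \<open>The step size condition forces \<open>0 < \<alpha> < 1\<close>, so \<open>nat\<close> does not truncate here.\<close>

definition tau :: "fegsam_par \<Rightarrow> real \<Rightarrow> nat" where
  "tau p \<alpha> = nat \<lceil>2 * log (prho p) \<alpha>\<rceil>"

definition c_fsam :: "fegsam_par \<Rightarrow> real \<Rightarrow> real" where
  "c_fsam p \<alpha> = 1 - \<alpha> * phi2 p / 2"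

text \<open>
  The bound \<open>\<alpha>\<^sup>2 \<le> ln (5/4) / (2 (1 + A1t) (K - 1)\<^sup>2)\<close> is void for \<open>K = 1\<close>; it is multiplied by
  \<open>(K - 1)\<^sup>2\<close> so that division by zero does not turn it into \<open>\<alpha>\<^sup>2 \<le> 0\<close>.
  The expressions \<open>log (prho p)\<close> and \<open>vconst\<close> presuppose \<open>prho p \<noteq> 0\<close> and \<open>pA2 p \<noteq> 0\<close>: otherwise
  \<open>tau p \<alpha> = 0\<close>, respectively \<open>vconst p \<alpha> = 0\<close>, and no step size is small. This is no loss, as
  \<open>prho p\<close> and \<open>pA2 p\<close> may be enlarged in all assumptions.
\<close>

definition small_step :: "fegsam_par \<Rightarrow> nat \<Rightarrow> real \<Rightarrow> bool" where
  "small_step p K \<alpha> \<longleftrightarrow>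
     \<alpha> \<le> min (1 / (360 * real (tau p \<alpha>) * ((pA2 p)\<^sup>2 + 1)))
             (phi2 p / (2 * C_15 p \<alpha> (tau p \<alpha>))) \<and>
     \<alpha>\<^sup>2 \<le> 1 / (phi2 p)\<^sup>2 \<and>
     \<alpha>\<^sup>2 * (real K - 1)\<^sup>2 \<le> ln (5 / 4) / (2 * (1 + A1t p)) \<and>
     \<alpha>\<^sup>2 * (log (prho p) \<alpha> + 1) \<le> vconst p \<alpha> / (2 * (real K)\<^sup>2) \<and>
     \<alpha>\<^sup>2 * (log (prho p) \<alpha> + 1) ^ 3 * exp (\<alpha> * phi2 p * (2 * log (prho p) \<alpha> + 1))
       \<le> vconst p \<alpha> / (4 * real K) * exp (- (phi2 p * sqrt (ln (5 / 4) / (2 * (1 + A1t p))))) \<and>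
     \<alpha> * real (tau p \<alpha>) \<le> min (1 / (24 * sqrt ((pA2 p)\<^sup>2 + 1))) (1 / (8 * (pA2 p + 1))) \<and>
     \<alpha> \<le> min (1 / C_1 p)
          (min (1 / (8 * real (tau p \<alpha>) * C_2 p)) (1 / (40 * real (tau p \<alpha>) * (C_1 p)\<^sup>2)))"


section \<open>The algorithm\<close>

text \<open>The agents are \<open>0, \<dots>, N - 1\<close>.\<close>

definition agent_mean :: "nat \<Rightarrow> (nat \<Rightarrow> 'a::real_vector) \<Rightarrow> 'a" where
  "agent_mean N x = (1 / real N) *\<^sub>R (\<Sum>i<N. x i)"

text \<open>\<open>fegsam N K \<alpha> G b \<theta>0 y t i\<close> is the iterate of agent \<open>i\<close> at time \<open>t\<close> along the noise path
  \<open>y\<close>, where \<open>y i t\<close> is the noise of agent \<open>i\<close> at time \<open>t\<close>.\<close>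

primrec fegsam ::
  "nat \<Rightarrow> nat \<Rightarrow> real \<Rightarrow> (nat \<Rightarrow> 'a::real_vector \<Rightarrow> 'y \<Rightarrow> 'a) \<Rightarrow> (nat \<Rightarrow> 'y \<Rightarrow> 'a) \<Rightarrow> 'a \<Rightarrow>
   (nat \<Rightarrow> nat \<Rightarrow> 'y) \<Rightarrow> nat \<Rightarrow> nat \<Rightarrow> 'a" where
  "fegsam N K \<alpha> G b \<theta>0 y 0 = (\<lambda>i. \<theta>0)"
| "fegsam N K \<alpha> G b \<theta>0 y (Suc t) =
     (let \<theta> = fegsam N K \<alpha> G b \<theta>0 y t;
          \<theta>' = (\<lambda>i. \<theta> i + \<alpha> *\<^sub>R (G i (\<theta> i) (y i t) - \<theta> i + b i (y i t)))
      in if K dvd Suc t then (\<lambda>i. agent_mean N \<theta>') else \<theta>')"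

definition sample_weight :: "real \<Rightarrow> nat \<Rightarrow> nat \<Rightarrow> real" where
  "sample_weight c T t = c powi (- int t) / (\<Sum>t'<T. c powi (- int t'))"


section \<open>Sigma-algebras and conditional expectations\<close>

definition generated_by ::
  "'w measure \<Rightarrow> 'j set \<Rightarrow> ('j \<Rightarrow> 'w \<Rightarrow> 'e) \<Rightarrow> ('j \<Rightarrow> 'e measure) \<Rightarrow> 'w measure" where
  "generated_by M J X S =
     sigma (space M) (\<Union>j\<in>J. {X j -` A \<inter> space M | A. A \<in> sets (S j)})"

definition vec_cond_exp ::
  "'w measure \<Rightarrow> 'w measure \<Rightarrow> ('w \<Rightarrow> real ^ 'd) \<Rightarrow> 'w \<Rightarrow> real ^ 'd" where
  "vec_cond_exp M F f \<omega> = (\<chi> k. real_cond_exp M F (\<lambda>\<omega>'. f \<omega>' $ k) \<omega>)"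

text \<open>In the following, \<open>Y i t\<close> is the noise of agent \<open>i\<close> at time \<open>t\<close>, with values in the measurable
  space \<open>S i\<close>.\<close>

definition noise_history ::
  "'w measure \<Rightarrow> nat \<Rightarrow> (nat \<Rightarrow> 'y measure) \<Rightarrow> (nat \<Rightarrow> nat \<Rightarrow> 'w \<Rightarrow> 'y) \<Rightarrow> nat \<Rightarrow> 'w measure" where
  "noise_history M N S Y s =
     generated_by M ({..<N} \<times> {..s}) (\<lambda>(i, r). Y i r) (\<lambda>(i, r). S i)"

definition iterate_history ::
  "'w measure \<Rightarrow> nat \<Rightarrow> (nat \<Rightarrow> nat \<Rightarrow> 'w \<Rightarrow> 'a::topological_space) \<Rightarrow> nat \<Rightarrow> 'w measure" where
  "iterate_history M N X t =
     generated_by M ({..<N} \<times> {..t}) (\<lambda>(i, r). X i r) (\<lambda>_. borel)"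


section \<open>The assumptions\<close>

text \<open>Every agent's noise is a (possibly time-inhomogeneous) Markov process with respect to the
  history of the whole noise; for independent agents this is the Markov property of each process
  in its own history.\<close>

definition markov_noise ::
  "'w measure \<Rightarrow> nat \<Rightarrow> (nat \<Rightarrow> 'y measure) \<Rightarrow> (nat \<Rightarrow> nat \<Rightarrow> 'w \<Rightarrow> 'y) \<Rightarrow> bool" where
  "markov_noise M N S Y \<longleftrightarrow>
     (\<forall>i<N. \<forall>t. Y i t \<in> measurable M (S i)) \<and>
     (\<forall>i<N. \<forall>s t. s \<le> t \<longrightarrow>
        (\<forall>f \<in> borel_measurable (S i). bounded (f ` space (S i)) \<longrightarrow>
          (AE \<omega> in M.
             real_cond_exp M (noise_history M N S Y s) (\<lambda>\<omega>'. f (Y i t \<omega>')) \<omega> =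
             real_cond_exp M (vimage_algebra (space M) (Y i s) (S i)) (\<lambda>\<omega>'. f (Y i t \<omega>')) \<omega>)))"

text \<open>
  The expectations in the three mixing bounds are those of the Markov process started at an
  arbitrary time \<open>s\<close> in its state at that time; accordingly the rate is \<open>\<rho> ^ (t - s)\<close>.
  For \<open>s = 0\<close>, averaging over the state at time \<open>0\<close> yields the bounds for the plain expectations at
  time \<open>t\<close>. Those alone would be satisfied by a noise process that is constant in time, along
  which the algorithm does not converge to \<open>\<theta>star\<close>.
\<close>

definition mixing ::
  "fegsam_par \<Rightarrow> (real ^ 'd \<Rightarrow> real) \<Rightarrow> 'w measure \<Rightarrow> nat \<Rightarrow> (nat \<Rightarrow> 'y measure) \<Rightarrow>
   (nat \<Rightarrow> nat \<Rightarrow> 'w \<Rightarrow> 'y) \<Rightarrow> (nat \<Rightarrow> real ^ 'd \<Rightarrow> 'y \<Rightarrow> real ^ 'd) \<Rightarrow> (nat \<Rightarrow> 'y \<Rightarrow> real ^ 'd) \<Rightarrow>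
   (nat \<Rightarrow> real ^ 'd \<Rightarrow> real ^ 'd) \<Rightarrow> (nat \<Rightarrow> real ^ 'd) \<Rightarrow> (nat \<Rightarrow> real) \<Rightarrow> bool" where
  "mixing p cn M N S Y G b Gbar bbar \<eta> \<longleftrightarrow>
     (\<forall>i<N. \<forall>\<theta>. (\<lambda>t. \<integral>\<omega>. G i \<theta> (Y i t \<omega>) \<partial>M) \<longlonglongrightarrow> Gbar i \<theta>) \<and>
     (\<forall>i<N. (\<lambda>t. \<integral>\<omega>. b i (Y i t \<omega>) \<partial>M) \<longlonglongrightarrow> bbar i) \<and>
     (\<forall>i<N. \<forall>\<theta> s t. s \<le> t \<longrightarrow>
        (AE \<omega> in M.
           cn (Gbar i \<theta> - vec_cond_exp M (vimage_algebra (space M) (Y i s) (S i))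
                            (\<lambda>\<omega>'. G i \<theta> (Y i t \<omega>')) \<omega>)
           \<le> pm1 p * cn \<theta> * prho p ^ (t - s))) \<and>
     (\<forall>i<N. \<forall>s t. s \<le> t \<longrightarrow>
        (AE \<omega> in M.
           cn (vec_cond_exp M (vimage_algebra (space M) (Y i s) (S i)) (\<lambda>\<omega>'. b i (Y i t \<omega>')) \<omega>)
           \<le> pm2 p * prho p ^ (t - s) + pm3 p * \<eta> i)) \<and>
     (\<forall>s t. s \<le> t \<longrightarrow>
        (AE \<omega> in M.
           cn (vec_cond_exp M (generated_by M {..<N} (\<lambda>i. Y i s) S)
                 (\<lambda>\<omega>'. agent_mean N (\<lambda>i. b i (Y i t \<omega>'))) \<omega>)
           \<le> pm4 p * prho p ^ (t - s)))"

definition contraction ::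
  "fegsam_par \<Rightarrow> ('a::real_vector \<Rightarrow> real) \<Rightarrow> nat \<Rightarrow> (nat \<Rightarrow> 'a \<Rightarrow> 'a) \<Rightarrow> bool" where
  "contraction p cn N Gbar \<longleftrightarrow>
     (\<forall>i<N. \<forall>\<theta>1 \<theta>2. cn (Gbar i \<theta>1 - Gbar i \<theta>2) \<le> pgamma p * cn (\<theta>1 - \<theta>2))"

definition lipschitz_bounded ::
  "fegsam_par \<Rightarrow> ('a::euclidean_space \<Rightarrow> real) \<Rightarrow> nat \<Rightarrow> (nat \<Rightarrow> 'y measure) \<Rightarrow>
   (nat \<Rightarrow> 'a \<Rightarrow> 'y \<Rightarrow> 'a) \<Rightarrow> (nat \<Rightarrow> 'y \<Rightarrow> 'a) \<Rightarrow> bool" where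
  "lipschitz_bounded p cn N S G b \<longleftrightarrow>
     (\<forall>i<N. \<forall>\<theta>. G i \<theta> \<in> borel_measurable (S i)) \<and>
     (\<forall>i<N. b i \<in> borel_measurable (S i)) \<and>
     (\<forall>i<N. \<forall>y \<in> space (S i). \<forall>\<theta>1 \<theta>2. cn (G i \<theta>1 y - G i \<theta>2 y) \<le> pA1 p * cn (\<theta>1 - \<theta>2)) \<and>
     (\<forall>i<N. \<forall>y \<in> space (S i). \<forall>\<theta>. cn (G i \<theta> y) \<le> pA2 p * cn \<theta>) \<and>
     (\<forall>i<N. \<forall>y \<in> space (S i). cn (b i y) \<le> pB p)"

definition independent_noise ::
  "'w measure \<Rightarrow> nat \<Rightarrow> (nat \<Rightarrow> 'y measure) \<Rightarrow> (nat \<Rightarrow> nat \<Rightarrow> 'w \<Rightarrow> 'y) \<Rightarrow>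
   (nat \<Rightarrow> nat \<Rightarrow> 'w \<Rightarrow> 'a::topological_space) \<Rightarrow> bool" where
  "independent_noise M N S Y X \<longleftrightarrow>
     (\<forall>i<N. \<forall>j<N. i \<noteq> j \<longrightarrow> (\<forall>t. \<forall>r\<le>t.
        (\<forall>f \<in> borel_measurable (S i). \<forall>g \<in> borel_measurable (S j).
          bounded (f ` space (S i)) \<longrightarrow> bounded (g ` space (S j)) \<longrightarrow>
          (AE \<omega> in M.
             real_cond_exp M (iterate_history M N X (t - r)) (\<lambda>\<omega>'. f (Y i t \<omega>') * g (Y j t \<omega>')) \<omega> =
             real_cond_exp M (iterate_history M N X (t - r)) (\<lambda>\<omega>'. f (Y i t \<omega>')) \<omega> *
             real_cond_exp M (iterate_history M N X (t - r)) (\<lambda>\<omega>'. g (Y j t \<omega>')) \<omega>))))"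

text \<open>\<open>That\<close> is the sampled time; all other randomness is in the noise.\<close>

definition sampled_time ::
  "fegsam_par \<Rightarrow> 'w measure \<Rightarrow> nat \<Rightarrow> (nat \<Rightarrow> 'y measure) \<Rightarrow> (nat \<Rightarrow> nat \<Rightarrow> 'w \<Rightarrow> 'y) \<Rightarrow>
   real \<Rightarrow> nat \<Rightarrow> ('w \<Rightarrow> nat) \<Rightarrow> bool" where
  "sampled_time p M N S Y \<alpha> T That \<longleftrightarrow>
     That \<in> measurable M (count_space UNIV) \<and>
     (\<forall>t<T. measure M {\<omega> \<in> space M. That \<omega> = t} = sample_weight (c_fsam p \<alpha>) T t) \<and>
     prob_space.indep_set M
       (sets (vimage_algebra (space M) That (count_space UNIV)))
       (sets (generated_by M ({..<N} \<times> UNIV) (\<lambda>(i, t). Y i t) (\<lambda>(i, t). S i)))"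

end

(*
  The Lyapunov function is half the square of a smooth norm m, the Moreau envelope of cn with respect
  to sn. Each operator Gbar i contracts m with factor 1 - phi2. The gradient of m^2 / 2 at the mean
  iterate is compared with the gradient tau steps earlier, where the Markovian noise has mixed up to
  alpha^2; the displacement over tau steps is of order alpha tau.

  Three sources of error remain. The mean of the b's has variance of order 1 / N, which follows from
  unconditional independence across agents (the history at time 0 is trivial) and gives the linear
  speedup. The client drift splits into a part driven by G, which is pathwise of order alpha (K - 1)
  times the iterates and is absorbed by the contraction, and a part driven by the b's, whose second
  moment is controlled by the decay of correlations. The displacement over tau steps is absorbed
  likewise, once all inequalities are summed against the output weights c_fsam^(-t).
*)
theory Submission
  imports Defs
begin

section \<open>Norms, smoothness and the Moreau envelope\<close>

text \<open>\<open>cn\<close> may be non-smooth, as a sup norm is, so its square admits no descent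
  inequality; the envelope restores one at the price of \<open>phi1\<close>. The mixing hypotheses
  concern deterministic arguments of \<open>G\<close>, while the algorithm inserts an iterate
  correlated with the noise. An iterate \<open>tau\<close> steps back is a function of the past, and
  the 2 in \<open>tau\<close> is there to make rho^tau at most alpha^2.

  For the part of the client drift driven by b, a pathwise estimate would give alpha^2 (K - 1)^2
  without the factor epsilon. Its square is therefore expanded: correlations decay geometrically
  down to a floor proportional to eta_i, which yields K - 1 from the decaying part and (K - 1)^2
  epsilon from the floor.

  The final obstacle is circularity. Lyapunov drift, client deviation and displacement are bounded
  by one another over windows in the past, and no bound on the iterates uniform in time is known
  beforehand. Against the weights c_fsam^(-t) a window costs only a constant factor, because the
  weights change by a bounded factor over tau or K - 1 steps, and the resulting scalar inequalities
  can be solved.\<close>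

lemma is_norm_uminus: "is_norm n \<Longrightarrow> n (- x) = n (x::'a::real_vector)"
  unfolding is_norm_def by (metis abs_minus_cancel abs_one mult_1 scaleR_minus1_left)

lemma is_norm_minus_commute: "is_norm n \<Longrightarrow> n (x - y) = n (y - x :: 'a::real_vector)"
  using is_norm_uminus[of n "x - y"] by simp

lemma is_norm_ge0: "is_norm n \<Longrightarrow> 0 \<le> n x"
  by (simp add: is_norm_def)

lemma is_norm_triangle: "is_norm n \<Longrightarrow> n (x + y) \<le> n x + n y"
  by (simp add: is_norm_def)

lemma is_norm_scale: "is_norm n \<Longrightarrow> n (a *\<^sub>R x) = \<bar>a\<bar> * n x"
  by (simp add: is_norm_def)

lemma is_norm_zero: "is_norm n \<Longrightarrow> n 0 = 0"
  by (simp add: is_norm_def)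

lemma is_norm_diff: "is_norm n \<Longrightarrow> n (x - y) \<le> n x + n (y::'a::real_vector)"
  using is_norm_triangle[of n x "- y"] is_norm_uminus[of n y] by simp

lemma is_norm_sum:
  assumes "is_norm n" shows "n (\<Sum>i\<in>I. f i) \<le> (\<Sum>i\<in>I. n (f i))"
proof (induction I rule: infinite_finite_induct)
  case (insert x F)
  then show ?case using is_norm_triangle[OF assms, of "f x" "sum f F"] by simp
qed (use is_norm_zero[OF assms] in auto)

lemma is_norm_le_norm:
  fixes n :: "'a::euclidean_space \<Rightarrow> real"
  assumes "is_norm n"
  obtains C where "0 < C" "\<And>x. n x \<le> C * norm x"
proof
  let ?C = "1 + (\<Sum>b\<in>Basis. n b)"
  have s0: "0 \<le> (\<Sum>b\<in>Basis. n b)" by (intro sum_nonneg is_norm_ge0[OF assms])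
  then show "0 < ?C" by simp
  fix x
  have "n x = n (\<Sum>b\<in>Basis. (x \<bullet> b) *\<^sub>R b)" by (simp add: euclidean_representation)
  also have "\<dots> \<le> (\<Sum>b\<in>Basis. n ((x \<bullet> b) *\<^sub>R b))" by (rule is_norm_sum[OF assms])
  also have "\<dots> = (\<Sum>b\<in>Basis. \<bar>x \<bullet> b\<bar> * n b)" by (simp add: is_norm_scale[OF assms])
  also have "\<dots> \<le> (\<Sum>b\<in>Basis. norm x * n b)"
    by (intro sum_mono mult_right_mono Basis_le_norm is_norm_ge0[OF assms])
  also have "\<dots> \<le> ?C * norm x" by (simp add: sum_distrib_left[symmetric] algebra_simps)
  finally show "n x \<le> ?C * norm x" .
qed

lemma is_norm_continuous:
  fixes n :: "'a::euclidean_space \<Rightarrow> real"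
  assumes "is_norm n"
  shows "continuous_on UNIV n"
proof -
  obtain C where C: "0 < C" "\<And>x. n x \<le> C * norm x" using is_norm_le_norm[OF assms] by blast
  have "C-lipschitz_on UNIV n"
  proof (rule lipschitz_onI)
    fix x y
    have "n x \<le> n (x - y) + n y" "n y \<le> n (y - x) + n x"
      using is_norm_triangle[OF assms, of "x - y" y] is_norm_triangle[OF assms, of "y - x" x] by auto
    then show "dist (n x) (n y) \<le> C * dist x y"
      using C(2)[of "x - y"] is_norm_minus_commute[OF assms, of x y] by (simp add: dist_norm)
  qed (use C in auto)
  then show ?thesis by (rule lipschitz_on_continuous_on)
qed

lemma sqrt_sum_sq_mono:
  fixes a b c d :: real
  assumes "0 \<le> a" "a \<le> c" "0 \<le> b" "b \<le> d"
  shows "sqrt (a\<^sup>2 + b\<^sup>2) \<le> sqrt (c\<^sup>2 + d\<^sup>2)"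
  using assms by (intro real_sqrt_le_mono add_mono power_mono)

text \<open>The norm is \<open>sqrt (2 M)\<close> for the Moreau envelope \<open>M\<close> of \<open>cn\<^sup>2 / 2\<close> with respect to \<open>sn\<^sup>2 / 2\<close>.
  It inherits smoothness from \<open>sn\<close>, since moving \<open>x\<close> while keeping the minimiser \<open>w x\<close> fixed only
  changes the \<open>sn\<close> part.\<close>

lemma envelope_norm:
  fixes cn sn :: "'a::euclidean_space \<Rightarrow> real"
  assumes cn: "is_norm cn" and sn: "is_norm sn"
    and sm: "smooth_wrt L sn (\<lambda>x. (sn x)\<^sup>2 / 2)"
    and l: "0 < l" and u: "0 < u" and lo: "\<And>x. l * sn x \<le> cn x" and up: "\<And>x. cn x \<le> u * sn x"
    and e: "0 < e" "\<And>x. e * norm x \<le> cn x" and \<psi>: "0 < \<psi>"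
  obtains m g where "is_norm m"
    "\<And>x. (1 + \<psi> * l\<^sup>2) * (m x)\<^sup>2 \<le> (cn x)\<^sup>2"
    "\<And>x. (cn x)\<^sup>2 \<le> (1 + \<psi> * u\<^sup>2) * (m x)\<^sup>2"
    "\<And>x y. (m y)\<^sup>2 / 2 \<le> (m x)\<^sup>2 / 2 + g x \<bullet> (y - x) + L / (2 * \<psi>) * (sn (y - x))\<^sup>2"
proof -
  define q where "q x w = (cn w)\<^sup>2 + (sn (x - w) / sqrt \<psi>)\<^sup>2" for x w
  have q0: "0 \<le> q x w" for x w by (simp add: q_def)
  have "\<exists>w. \<forall>v. q x w \<le> q x v" for x
  proof -
    \<comment> \<open>The competitor \<open>x\<close> itself has the value \<open>(cn x)^2\<close>.
      Outside this sublevel set the \<open>cn\<close> part alone exceeds that value, so the search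
      for a minimiser is confined to a compact set.\<close>
    define S where "S = {v. cn v \<le> cn x}"
    have "closed S" unfolding S_def
      by (intro closed_Collect_le is_norm_continuous[OF cn] continuous_on_const)
    moreover have "bounded S" unfolding bounded_iff S_def
    proof (intro exI ballI)
      fix v assume "v \<in> {v. cn v \<le> cn x}"
      then show "norm v \<le> cn x / e" using e(2)[of v] e(1) by (simp add: field_simps)
    qed
    ultimately have "compact S" by (simp add: compact_eq_bounded_closed)
    moreover have "x \<in> S" by (simp add: S_def)
    moreover have "continuous_on S (q x)"
      unfolding q_def using \<psi>
      by (intro continuous_intros continuous_on_subset[OF is_norm_continuous[OF cn]]
          continuous_on_compose2[OF is_norm_continuous[OF sn]]) auto
    ultimately obtain w where w: "w \<in> S" "\<And>v. v \<in> S \<Longrightarrow> q x w \<le> q x v"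
      using continuous_attains_inf[of S "q x"] by blast
    have "q x w \<le> q x v" for v
    proof (cases "v \<in> S")
      case False
      then have "(cn x)\<^sup>2 \<le> (cn v)\<^sup>2" using is_norm_ge0[OF cn] by (intro power_mono) (auto simp: S_def)
      moreover have "q x w \<le> (cn x)\<^sup>2"
        using w(2)[OF \<open>x \<in> S\<close>] by (simp add: q_def is_norm_zero[OF sn])
      moreover have "(cn v)\<^sup>2 \<le> q x v" by (simp add: q_def)
      ultimately show ?thesis by linarith
    qed (use w in auto)
    then show ?thesis by blast
  qed
  then obtain w where w: "\<And>x v. q x (w x) \<le> q x v" by metis
  define m where "m x = sqrt (q x (w x))" for x
  have m2: "(m x)\<^sup>2 = q x (w x)" for x by (simp add: m_def q0)
  have mle: "m x \<le> sqrt (q x v)" for x v unfolding m_def by (intro real_sqrt_le_mono w)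
  have m0: "0 \<le> m x" for x by (simp add: m_def q0)
  have ms: "m (a *\<^sub>R x) \<le> \<bar>a\<bar> * m x" for a x
  proof -
    have "q (a *\<^sub>R x) (a *\<^sub>R w x) = a\<^sup>2 * q x (w x)"
      by (simp add: q_def is_norm_scale[OF cn] is_norm_scale[OF sn] power_mult_distrib power_divide
          distrib_left scaleR_diff_right[symmetric])
    then show ?thesis using mle[of "a *\<^sub>R x" "a *\<^sub>R w x"] by (simp add: m_def real_sqrt_mult)
  qed
  have mz: "m x = 0 \<longleftrightarrow> x = 0" for x
  proof
    assume "m x = 0"
    then have "q x (w x) = 0" by (simp add: m_def)
    then have "cn (w x) = 0" "sn (x - w x) = 0" using \<psi> by (auto simp: q_def sum_power2_eq_zero_iff)
    then show "x = 0" using cn sn by (auto simp: is_norm_def)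
  next
    assume "x = 0"
    then show "m x = 0" using ms[of 0 x] m0[of x] by simp
  qed
  have mt: "m (x + y) \<le> m x + m y" for x y
  proof -
    have "sn ((x - w x) + (y - w y)) \<le> sn (x - w x) + sn (y - w y)" by (rule is_norm_triangle[OF sn])
    then have sn': "sn (x + y - (w x + w y)) \<le> sn (x - w x) + sn (y - w y)"
      by (simp add: algebra_simps)
    \<comment> \<open>The sum of the two minimisers is a competitor for \<open>x + y\<close>;
      Minkowski's inequality in the plane, for the pairs of \<open>cn\<close> part and
      \<open>sn\<close> part, does the rest.\<close>
    have "m (x + y) \<le> sqrt (q (x + y) (w x + w y))" by (rule mle)
    also have "\<dots> \<le> sqrt ((cn (w x) + cn (w y))\<^sup>2 + (sn (x - w x) / sqrt \<psi> + sn (y - w y) / sqrt \<psi>)\<^sup>2)"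
      unfolding q_def using sn' \<psi>
      by (intro sqrt_sum_sq_mono is_norm_triangle[OF cn] is_norm_ge0[OF cn] divide_nonneg_nonneg
          is_norm_ge0[OF sn]) (auto simp: add_divide_distrib[symmetric] divide_right_mono)
    also have "\<dots> \<le> sqrt ((cn (w x))\<^sup>2 + (sn (x - w x) / sqrt \<psi>)\<^sup>2) + sqrt ((cn (w y))\<^sup>2 + (sn (y - w y) / sqrt \<psi>)\<^sup>2)"
      by (rule real_sqrt_sum_squares_triangle_ineq)
    finally show ?thesis by (simp add: m_def q_def)
  qed
  have "m (a *\<^sub>R x) = \<bar>a\<bar> * m x" for a x
  proof (cases "a = 0")
    case True
    then show ?thesis using mz by simp
  next
    case False
    have "m x \<le> \<bar>inverse a\<bar> * m (a *\<^sub>R x)" using ms[of "inverse a" "a *\<^sub>R x"] False by simp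
    then have "\<bar>a\<bar> * m x \<le> m (a *\<^sub>R x)" using False by (simp add: field_simps)
    with ms[of a x] show ?thesis by simp
  qed
  then have nm: "is_norm m" unfolding is_norm_def using m0 mz mt by blast
  have upper: "(1 + \<psi> * l\<^sup>2) * (m x)\<^sup>2 \<le> (cn x)\<^sup>2" for x
  proof -
    \<comment> \<open>The competitor will be \<open>x / (1 + s)\<close>, the multiple c x for which
      c^2 + (1 - c)^2 / s is smallest.\<close>
    define s where "s = \<psi> * l\<^sup>2"
    have s: "0 < s" using \<psi> l by (simp add: s_def)
    have "(l * sn x)\<^sup>2 \<le> (cn x)\<^sup>2" using lo l is_norm_ge0[OF sn] by (intro power_mono) auto
    then have sl: "(sn x)\<^sup>2 / \<psi> \<le> (cn x)\<^sup>2 / s"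
      using l \<psi> by (simp add: s_def field_simps power_mult_distrib)
    have "1 - 1 / (1 + s) = s / (1 + s)" using s by (simp add: field_simps)
    then have "x - (1 / (1 + s)) *\<^sub>R x = (s / (1 + s)) *\<^sub>R x"
      by (metis scaleR_left_diff_distrib scaleR_one)
    then have "q x ((1 / (1 + s)) *\<^sub>R x) = (1 / (1 + s))\<^sup>2 * (cn x)\<^sup>2 + (s / (1 + s))\<^sup>2 * ((sn x)\<^sup>2 / \<psi>)"
      using s \<psi> by (simp add: q_def is_norm_scale[OF cn] is_norm_scale[OF sn] power_mult_distrib power_divide)
    also have "\<dots> \<le> (1 / (1 + s))\<^sup>2 * (cn x)\<^sup>2 + (s / (1 + s))\<^sup>2 * ((cn x)\<^sup>2 / s)"
      by (intro add_left_mono mult_left_mono sl) auto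
    also have "\<dots> = ((1 / (1 + s))\<^sup>2 + (s / (1 + s))\<^sup>2 * (1 / s)) * (cn x)\<^sup>2"
      by (simp only: distrib_right times_divide_eq_right mult_1_right mult_1 times_divide_eq_left mult.assoc)
    also have "(1 / (1 + s))\<^sup>2 + (s / (1 + s))\<^sup>2 * (1 / s) = 1 / (1 + s)"
      using s by (simp add: divide_simps power2_eq_square)
    finally have "(m x)\<^sup>2 \<le> (cn x)\<^sup>2 / (1 + s)" using w[of x "(1 / (1 + s)) *\<^sub>R x"] m2[of x] by simp
    then show ?thesis using s by (simp add: field_simps flip: s_def)
  qed
  have lower: "(cn x)\<^sup>2 \<le> (1 + \<psi> * u\<^sup>2) * (m x)\<^sup>2" for x
  proof -
    define a d where "a = cn (w x)" and "d = sn (x - w x) / sqrt \<psi>"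
    have "cn x \<le> cn (w x) + cn (x - w x)" using is_norm_triangle[OF cn, of "w x" "x - w x"] by simp
    also have "\<dots> \<le> a + (sqrt \<psi> * u) * d" using up[of "x - w x"] \<psi> by (simp add: a_def d_def)
    finally have "(cn x)\<^sup>2 \<le> (a + (sqrt \<psi> * u) * d)\<^sup>2" using is_norm_ge0[OF cn] by (intro power_mono)
    \<comment> \<open>Cauchy-Schwarz for the plane vectors (1, sqrt psi u) and (a, d).\<close>
    also have "\<dots> \<le> (1 + (sqrt \<psi> * u)\<^sup>2) * (a\<^sup>2 + d\<^sup>2)"
      using zero_le_power2[of "(sqrt \<psi> * u) * a - d"] by (simp add: power2_eq_square algebra_simps)
    finally show ?thesis using \<psi> by (simp add: m2 q_def a_def d_def power_mult_distrib)
  qed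
  obtain gs where gs: "\<And>x y. (sn y)\<^sup>2 / 2 \<le> (sn x)\<^sup>2 / 2 + gs x \<bullet> (y - x) + L / 2 * (sn (y - x))\<^sup>2"
    using sm unfolding smooth_wrt_def by blast
  have "(m y)\<^sup>2 / 2 \<le> (m x)\<^sup>2 / 2 + ((1 / \<psi>) *\<^sub>R gs (x - w x)) \<bullet> (y - x) + L / (2 * \<psi>) * (sn (y - x))\<^sup>2" for x y
  proof -
    have "(m y)\<^sup>2 / 2 \<le> q y (w x) / 2" using w[of y "w x"] m2 by simp
    also have "\<dots> = (cn (w x))\<^sup>2 / 2 + ((sn (y - w x))\<^sup>2 / 2) / \<psi>"
      using \<psi> by (simp add: q_def power_divide field_simps)
    also have "\<dots> \<le> (cn (w x))\<^sup>2 / 2 + ((sn (x - w x))\<^sup>2 / 2 + gs (x - w x) \<bullet> (y - x) + L / 2 * (sn (y - x))\<^sup>2) / \<psi>"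
      using gs[of "y - w x" "x - w x"] \<psi> by (intro add_left_mono divide_right_mono) auto
    also have "\<dots> = (m x)\<^sup>2 / 2 + ((1 / \<psi>) *\<^sub>R gs (x - w x)) \<bullet> (y - x) + L / (2 * \<psi>) * (sn (y - x))\<^sup>2"
      using \<psi> by (simp add: m2 q_def power_divide field_simps)
    finally show ?thesis .
  qed
  from that[OF nm upper lower this] show ?thesis .
qed

text \<open>Moving from 0 to v and to -v makes the gradient terms cancel. This supplies the
  positivity of \<open>pL p\<close> and, with \<open>plcs p <= pucs p\<close>, the normalisation
  \<open>1 <= \<Lambda> * U\<close>.\<close>

lemma smooth_wrt_sq_ge1:
  fixes sn :: "'a::euclidean_space \<Rightarrow> real"
  assumes sn: "is_norm sn" and sm: "smooth_wrt L sn (\<lambda>x. (sn x)\<^sup>2 / 2)"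
  shows "1 \<le> L"
proof -
  obtain g where g: "\<And>x y. (sn y)\<^sup>2 / 2 \<le> (sn x)\<^sup>2 / 2 + g x \<bullet> (y - x) + L / 2 * (sn (y - x))\<^sup>2"
    using sm unfolding smooth_wrt_def by blast
  obtain v :: 'a where v: "v \<in> Basis" using nonempty_Basis by blast
  then have "sn v \<noteq> 0" using sn by (auto simp: is_norm_def)
  then have p: "0 < (sn v)\<^sup>2" by simp
  have "(sn v)\<^sup>2 \<le> L * (sn v)\<^sup>2"
    using g[of v 0] g[of "-v" 0] is_norm_zero[OF sn] is_norm_uminus[OF sn, of v] by simp
  then show ?thesis using p by simp
qed

section \<open>Gradient calculus for smooth norms\<close>

lemma le_of_le_linear:
  fixes a b c :: real
  assumes "\<And>t. 0 < t \<Longrightarrow> t < 1 \<Longrightarrow> t * a \<le> t * b + t\<^sup>2 * c"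
  shows "a \<le> b"
proof (rule field_le_epsilon)
  fix \<epsilon> :: real assume \<epsilon>: "0 < \<epsilon>"
  \<comment> \<open>Small enough that after division by \<open>t\<close> the quadratic remainder is
    below epsilon; the \<open>+ 1\<close> keeps the denominator positive.\<close>
  define t where "t = min (1/2) (\<epsilon> / (\<bar>c\<bar> + 1))"
  have t: "0 < t" "t < 1" "t \<le> \<epsilon> / (\<bar>c\<bar> + 1)" using \<epsilon> by (auto simp: t_def)
  have "t * a \<le> t * (b + t * c)" using assms[OF t(1,2)] by (simp add: power2_eq_square algebra_simps)
  then have "a \<le> b + t * c" using t(1) by simp
  moreover have "t * c \<le> t * (\<bar>c\<bar> + 1)" using t(1) by (intro mult_left_mono) auto
  moreover have "t * (\<bar>c\<bar> + 1) \<le> \<epsilon>" using t(3) by (simp add: field_simps)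
  ultimately show "a \<le> b + \<epsilon>" by linarith
qed

text \<open>A quadratic upper bound on \<open>m\<^sup>2 / 2\<close> for a norm \<open>m\<close> already makes \<open>g\<close> behave like a gradient.\<close>

locale smooth_norm =
  fixes m n :: "'a::euclidean_space \<Rightarrow> real" and g :: "'a \<Rightarrow> 'a" and \<Lambda> :: real
  assumes m: "is_norm m" and n: "is_norm n" and \<Lambda>: "0 < \<Lambda>"
    and smooth: "\<And>x y. (m y)\<^sup>2 / 2 \<le> (m x)\<^sup>2 / 2 + g x \<bullet> (y - x) + \<Lambda> / 2 * (n (y - x))\<^sup>2"
begin

lemma smooth_line: "(m (x + t *\<^sub>R v))\<^sup>2 / 2 \<le> (m x)\<^sup>2 / 2 + t * (g x \<bullet> v) + \<Lambda> / 2 * t\<^sup>2 * (n v)\<^sup>2"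
  using smooth[of "x + t *\<^sub>R v" x] by (simp add: is_norm_scale[OF n] power_mult_distrib)

text \<open>Along -v the triangle inequality limits how fast m^2 / 2 can decrease, while
  \<open>smooth_line\<close> forces a decrease at rate \<open>g x \<bullet> v\<close> to first
  order. Equivalently, the dual norm of \<open>g x\<close> is at most \<open>m x\<close>.\<close>

lemma gradient_le: "g x \<bullet> v \<le> m x * m v"
proof (rule le_of_le_linear)
  fix t :: real assume t: "0 < t" "t < 1"
  have 1: "(m (x - t *\<^sub>R v))\<^sup>2 / 2 \<le> (m x)\<^sup>2 / 2 - t * (g x \<bullet> v) + \<Lambda> / 2 * t\<^sup>2 * (n v)\<^sup>2"
    using smooth_line[of x "-t" v] by simp
  have "m x \<le> m (x - t *\<^sub>R v) + t * m v"
    using is_norm_triangle[OF m, of "x - t *\<^sub>R v" "t *\<^sub>R v"] t by (simp add: is_norm_scale[OF m])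
  then have a: "m x * m x \<le> m x * (m (x - t *\<^sub>R v) + t * m v)"
    using is_norm_ge0[OF m] by (intro mult_left_mono)
  have "2 * (m x * m (x - t *\<^sub>R v)) \<le> (m x)\<^sup>2 + (m (x - t *\<^sub>R v))\<^sup>2"
    using zero_le_power2[of "m x - m (x - t *\<^sub>R v)"] by (simp add: power2_eq_square algebra_simps)
  with a have "(m x)\<^sup>2 / 2 - t * (m x * m v) \<le> (m (x - t *\<^sub>R v))\<^sup>2 / 2"
    by (simp add: power2_eq_square algebra_simps)
  with 1 show "t * (g x \<bullet> v) \<le> t * (m x * m v) + t\<^sup>2 * (\<Lambda> / 2 * (n v)\<^sup>2)"
    by (simp add: algebra_simps)
qed

text \<open>Euler's identity for a function homogeneous of degree 2; the lower bound comes from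
  moving outwards along the ray through \<open>x\<close>.\<close>

lemma gradient_self: "g x \<bullet> x = (m x)\<^sup>2"
proof (rule antisym)
  show "g x \<bullet> x \<le> (m x)\<^sup>2" using gradient_le[of x x] by (simp add: power2_eq_square)
  show "(m x)\<^sup>2 \<le> g x \<bullet> x"
  proof (rule le_of_le_linear)
    fix t :: real assume t: "0 < t" "t < 1"
    have "x + t *\<^sub>R x = (1 + t) *\<^sub>R x" by (simp add: scaleR_left_distrib)
    then have "(m (x + t *\<^sub>R x))\<^sup>2 = (1 + t)\<^sup>2 * (m x)\<^sup>2"
      using t by (simp add: is_norm_scale[OF m] power_mult_distrib)
    then have "t * (m x)\<^sup>2 + t\<^sup>2 * (m x)\<^sup>2 / 2 \<le> t * (g x \<bullet> x) + t\<^sup>2 * (\<Lambda> / 2 * (n x)\<^sup>2)"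
      using smooth_line[of x t x] by (simp add: power2_eq_square algebra_simps)
    moreover have "0 \<le> t\<^sup>2 * (m x)\<^sup>2 / 2" by simp
    ultimately show "t * (m x)\<^sup>2 \<le> t * (g x \<bullet> x) + t\<^sup>2 * (\<Lambda> / 2 * (n x)\<^sup>2)" by linarith
  qed
qed

text \<open>Convexity of m^2 / 2, obtained from the duality bound, Euler's identity and 2 (m y) (m
  z) <= (m y)^2 + (m z)^2.\<close>

lemma subgradient: "(m y)\<^sup>2 / 2 + g y \<bullet> (z - y) \<le> (m z)\<^sup>2 / 2"
proof -
  have "2 * (m y * m z) \<le> (m y)\<^sup>2 + (m z)\<^sup>2"
    using zero_le_power2[of "m y - m z"] by (simp add: power2_eq_square algebra_simps)
  then show ?thesis using gradient_le[of y z] by (simp add: inner_diff_right gradient_self)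
qed

text \<open>A three-point argument: the tangent at \<open>y\<close>, evaluated at
  \<open>x - t v\<close>, lies below the parabola at \<open>x\<close>, whose vertex value is in turn
  bounded by the parabola at \<open>y\<close>. The choice \<open>t = n (x - y) / n v\<close>
  balances the two squares, so that no factor is lost.\<close>

lemma gradient_lipschitz: "(g x - g y) \<bullet> v \<le> \<Lambda> * n (x - y) * n v"
proof -
  have *: "t * ((g x - g y) \<bullet> v) \<le> \<Lambda> / 2 * ((n (x - y))\<^sup>2 + t\<^sup>2 * (n v)\<^sup>2)" for t
    using subgradient[of y "x - t *\<^sub>R v"] smooth_line[of x "-t" v] smooth[of x y]
    by (simp add: inner_diff_right inner_diff_left algebra_simps)
  show ?thesis
  proof (cases "n v = 0")
    case True
    then have "v = 0" using n by (auto simp: is_norm_def)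
    then show ?thesis using True by simp
  next
    case False
    then have nv: "0 < n v" using is_norm_ge0[OF n, of v] by linarith
    show ?thesis
    proof (cases "n (x - y) = 0")
      case True
      then have "x = y" using n by (auto simp: is_norm_def)
      then show ?thesis using is_norm_zero[OF n] by simp
    next
      case F: False
      then have np: "0 < n (x - y)" using is_norm_ge0[OF n, of "x - y"] by linarith
      have "n (x - y) / n v * ((g x - g y) \<bullet> v) \<le> \<Lambda> * (n (x - y))\<^sup>2"
        using *[of "n (x - y) / n v"] nv by (simp add: power_divide)
      then have "n (x - y) * ((g x - g y) \<bullet> v) \<le> n (x - y) * (\<Lambda> * n (x - y) * n v)"
        using nv by (simp add: field_simps power2_eq_square)
      then show ?thesis using np by simp
    qed
  qed
qed

lemma gradient_zero: "g 0 = 0"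
  using gradient_le[of 0 "g 0"] is_norm_zero[OF m] inner_ge_zero[of "g 0"]
  by (metis inner_eq_zero_iff mult_zero_left order_antisym)

lemma gradient_bound: "g x \<bullet> v \<le> \<Lambda> * n x * n v"
  using gradient_lipschitz[of x 0 v] gradient_zero by simp

lemma gradient_continuous: "continuous_on UNIV g"
proof -
  obtain C where C: "0 < C" "\<And>x. n x \<le> C * norm x" using is_norm_le_norm[OF n] by blast
  have "(\<Lambda> * C * C)-lipschitz_on UNIV g"
  proof (rule lipschitz_onI)
    fix x y
    have "(norm (g x - g y))\<^sup>2 \<le> \<Lambda> * n (x - y) * n (g x - g y)"
      using gradient_lipschitz[of x y "g x - g y"] by (simp add: power2_norm_eq_inner)
    also have "\<dots> \<le> \<Lambda> * (C * norm (x - y)) * (C * norm (g x - g y))"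
      using C \<Lambda> is_norm_ge0[OF n] by (intro mult_mono) auto
    finally have "norm (g x - g y) * norm (g x - g y) \<le> (\<Lambda> * C * C * norm (x - y)) * norm (g x - g y)"
      by (simp add: power2_eq_square algebra_simps)
    then have "norm (g x - g y) \<le> \<Lambda> * C * C * norm (x - y) \<or> norm (g x - g y) = 0"
      using norm_ge_zero[of "g x - g y"] by (metis mult_le_cancel_right order_less_le)
    then show "dist (g x) (g y) \<le> \<Lambda> * C * C * dist x y"
      using C \<Lambda> by (auto simp: dist_norm)
  qed (use C \<Lambda> in auto)
  then show ?thesis by (rule lipschitz_on_continuous_on)
qed

end

section \<open>Bounded random variables, conditional expectations and agent averages\<close>

text \<open>Bounds are required everywhere and not just almost everywhere: \<open>G\<close> and
  \<open>b\<close> are bounded pointwise, so every iterate is bounded at each fixed time.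
  \<open>F\<close> records what the variable may depend on, and integrability of sums, products and
  inner products comes for free.\<close>

definition bounded_rv :: "'w measure \<Rightarrow> ('w \<Rightarrow> 'b::{real_normed_vector, second_countable_topology}) \<Rightarrow> bool" where
  "bounded_rv F f \<longleftrightarrow> f \<in> borel_measurable F \<and> (\<exists>c. \<forall>\<omega>\<in>space F. norm (f \<omega>) \<le> c)"

lemma bounded_rvI: "f \<in> borel_measurable F \<Longrightarrow> (\<And>\<omega>. \<omega> \<in> space F \<Longrightarrow> norm (f \<omega>) \<le> c) \<Longrightarrow> bounded_rv F f"
  by (auto simp: bounded_rv_def)

lemma bounded_rv_measurable: "bounded_rv F f \<Longrightarrow> f \<in> borel_measurable F"
  by (simp add: bounded_rv_def)

lemma bounded_rv_bound:
  assumes "bounded_rv F f"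
  shows "\<exists>c\<ge>0. \<forall>\<omega>\<in>space F. norm (f \<omega>) \<le> c"
proof -
  from assms obtain c where c: "\<And>\<omega>. \<omega> \<in> space F \<Longrightarrow> norm (f \<omega>) \<le> c" by (auto simp: bounded_rv_def)
  show ?thesis by (rule exI[of _ "max 0 c"]) (auto intro: order_trans[OF c])
qed

lemma bounded_rv_mono:
  assumes F: "subalgebra M F" and f: "bounded_rv F f" shows "bounded_rv M f"
proof -
  obtain c where c: "0 \<le> c" "\<forall>\<omega>\<in>space F. norm (f \<omega>) \<le> c"
    using bounded_rv_bound[OF f] by (elim exE conjE)
  have "space F = space M" using F unfolding subalgebra_def by (rule conjunct1)
  with c have "norm (f \<omega>) \<le> c" if "\<omega> \<in> space M" for \<omega> using that by simp
  then show ?thesis by (rule bounded_rvI[OF measurable_from_subalg[OF F bounded_rv_measurable[OF f]]])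
qed

lemma bounded_rv_const: "bounded_rv F (\<lambda>_. c)"
  by (rule bounded_rvI[where c="norm c"]) auto

lemma bounded_rv_add:
  assumes "bounded_rv F f" "bounded_rv F h"
  shows "bounded_rv F (\<lambda>\<omega>. f \<omega> + h \<omega>)"
proof -
  obtain c where c: "0 \<le> c" "\<forall>\<omega>\<in>space F. norm (f \<omega>) \<le> c"
    using bounded_rv_bound[OF assms(1)] by (elim exE conjE)
  obtain d where d: "0 \<le> d" "\<forall>\<omega>\<in>space F. norm (h \<omega>) \<le> d"
    using bounded_rv_bound[OF assms(2)] by (elim exE conjE)
  show ?thesis
    by (rule bounded_rvI[where c="c + d"])
       (auto intro!: borel_measurable_add assms[THEN bounded_rv_measurable] norm_triangle_mono c(2)[rule_format] d(2)[rule_format])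
qed

lemma bounded_rv_diff:
  assumes "bounded_rv F f" "bounded_rv F h"
  shows "bounded_rv F (\<lambda>\<omega>. f \<omega> - h \<omega>)"
proof -
  obtain c where c: "0 \<le> c" "\<forall>\<omega>\<in>space F. norm (f \<omega>) \<le> c"
    using bounded_rv_bound[OF assms(1)] by (elim exE conjE)
  obtain d where d: "0 \<le> d" "\<forall>\<omega>\<in>space F. norm (h \<omega>) \<le> d"
    using bounded_rv_bound[OF assms(2)] by (elim exE conjE)
  show ?thesis
    by (rule bounded_rvI[where c="c + d"])
       (auto intro!: borel_measurable_diff assms[THEN bounded_rv_measurable] norm_triangle_le_diff add_mono c(2)[rule_format] d(2)[rule_format])
qed

lemma bounded_rv_scaleR:
  fixes f :: "'w \<Rightarrow> real" and h :: "'w \<Rightarrow> 'b::{real_normed_vector, second_countable_topology}"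
  assumes "bounded_rv F f" "bounded_rv F h"
  shows "bounded_rv F (\<lambda>\<omega>. f \<omega> *\<^sub>R h \<omega>)"
proof -
  obtain c where c: "0 \<le> c" "\<forall>\<omega>\<in>space F. norm (f \<omega>) \<le> c"
    using bounded_rv_bound[OF assms(1)] by (elim exE conjE)
  obtain d where d: "0 \<le> d" "\<forall>\<omega>\<in>space F. norm (h \<omega>) \<le> d"
    using bounded_rv_bound[OF assms(2)] by (elim exE conjE)
  show ?thesis
    by (rule bounded_rvI[where c="c * d"])
       (auto intro!: borel_measurable_scaleR assms[THEN bounded_rv_measurable] mult_mono c(1) c(2)[simplified, rule_format] d(1) d(2)[rule_format])
qed

lemma bounded_rv_mult:
  fixes f h :: "'w \<Rightarrow> real"
  shows "bounded_rv F f \<Longrightarrow> bounded_rv F h \<Longrightarrow> bounded_rv F (\<lambda>\<omega>. f \<omega> * h \<omega>)"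
  using bounded_rv_scaleR[of F f h] by simp

lemma bounded_rv_power: "bounded_rv F f \<Longrightarrow> bounded_rv F (\<lambda>\<omega>. f \<omega> ^ k :: real)"
  by (induction k) (simp_all add: bounded_rv_const bounded_rv_mult)

lemma bounded_rv_inner:
  fixes f h :: "'w \<Rightarrow> 'b::euclidean_space"
  assumes "bounded_rv F f" "bounded_rv F h"
  shows "bounded_rv F (\<lambda>\<omega>. f \<omega> \<bullet> h \<omega>)"
proof -
  obtain c where c: "0 \<le> c" "\<forall>\<omega>\<in>space F. norm (f \<omega>) \<le> c"
    using bounded_rv_bound[OF assms(1)] by (elim exE conjE)
  obtain d where d: "0 \<le> d" "\<forall>\<omega>\<in>space F. norm (h \<omega>) \<le> d"
    using bounded_rv_bound[OF assms(2)] by (elim exE conjE)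
  show ?thesis
    by (rule bounded_rvI[where c="c * d"])
       (auto intro!: borel_measurable_inner assms[THEN bounded_rv_measurable] mult_mono c(1) c(2)[rule_format] d(1) d(2)[rule_format]
         order_trans[OF Cauchy_Schwarz_ineq2])
qed

lemma bounded_rv_sum:
  assumes "\<And>i. i \<in> I \<Longrightarrow> bounded_rv F (f i)"
  shows "bounded_rv F (\<lambda>\<omega>. \<Sum>i\<in>I. f i \<omega>)"
  using assms
  by (induction I rule: infinite_finite_induct) (simp_all add: bounded_rv_const bounded_rv_add)

lemma bounded_rv_continuous:
  fixes f :: "'w \<Rightarrow> 'b::euclidean_space" and h :: "'b \<Rightarrow> 'c::{real_normed_vector, second_countable_topology}"
  assumes h: "continuous_on UNIV h" and f: "bounded_rv F f"
  shows "bounded_rv F (\<lambda>\<omega>. h (f \<omega>))"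
proof -
  obtain c where c: "0 \<le> c" "\<forall>\<omega>\<in>space F. norm (f \<omega>) \<le> c"
    using bounded_rv_bound[OF f] by (elim exE conjE)
  have "compact (h ` cball 0 c)" by (intro compact_continuous_image continuous_on_subset[OF h]) auto
  then obtain d where d: "\<And>x. x \<in> cball 0 c \<Longrightarrow> norm (h x) \<le> d"
    using compact_imp_bounded[of "h ` cball 0 c"] unfolding bounded_iff by blast
  show ?thesis
    using c d by (intro bounded_rvI[where F=F and f="\<lambda>\<omega>. h (f \<omega>)" and c=d] borel_measurable_continuous_on[OF h] bounded_rv_measurable[OF f]) auto
qed

lemma bounded_rv_nth: "bounded_rv F f \<Longrightarrow> bounded_rv F (\<lambda>\<omega>. (f \<omega> :: real ^ 'd) $ k)"
  by (rule bounded_rv_continuous[of "\<lambda>x. x $ k"]) (auto intro: continuous_intros)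

lemma bounded_rv_is_norm:
  fixes f :: "'w \<Rightarrow> 'b::euclidean_space"
  shows "is_norm n \<Longrightarrow> bounded_rv F f \<Longrightarrow> bounded_rv F (\<lambda>\<omega>. n (f \<omega>))"
  by (rule bounded_rv_continuous[OF is_norm_continuous])

lemma bounded_rv_agent_mean:
  assumes "\<And>i. i < N \<Longrightarrow> bounded_rv F (\<lambda>\<omega>. f i \<omega>)"
  shows "bounded_rv F (\<lambda>\<omega>. agent_mean N (\<lambda>i. f i \<omega>))"
  unfolding agent_mean_def by (intro bounded_rv_scaleR bounded_rv_const bounded_rv_sum assms) auto

lemma bounded_rv_indicator: "A \<in> sets F \<Longrightarrow> bounded_rv F (\<lambda>\<omega>. indicator A \<omega> :: real)"
  by (rule bounded_rvI[where c=1]) (auto simp: indicator_def)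

lemma (in finite_measure) bounded_rv_integrable:
  fixes f :: "'a \<Rightarrow> 'b::{second_countable_topology, banach}"
  assumes "bounded_rv M f" shows "integrable M f"
proof -
  obtain c where c: "0 \<le> c" "\<forall>\<omega>\<in>space M. norm (f \<omega>) \<le> c"
    using bounded_rv_bound[OF assms] by (elim exE conjE)
  show ?thesis by (rule integrable_const_bound[of _ c]) (use c in \<open>auto intro!: bounded_rv_measurable assms\<close>)
qed

text \<open>Approximate \<open>f\<close> by simple functions, for which the composition is a
  countable case distinction, and pass to the limit by continuity in the parameter. Needed because
  \<open>G\<close> is assumed measurable in the noise for each fixed parameter only.\<close>

lemma measurable_caratheodory:
  fixes G :: "'a::{metric_space, second_countable_topology} \<Rightarrow> 'y \<Rightarrow> 'b::metric_space"
  assumes f: "f \<in> borel_measurable F" and h: "h \<in> measurable F S"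
    and G: "\<And>\<theta>. G \<theta> \<in> borel_measurable S" and c: "\<And>y. y \<in> space S \<Longrightarrow> continuous_on UNIV (\<lambda>\<theta>. G \<theta> y)"
  shows "(\<lambda>\<omega>. G (f \<omega>) (h \<omega>)) \<in> borel_measurable F"
proof -
  obtain s where s: "\<And>i. simple_function F (s i)" "\<And>x. x \<in> space F \<Longrightarrow> (\<lambda>i. s i x) \<longlonglongrightarrow> f x"
    using borel_measurable_implies_sequence_metric[OF f, of undefined] by blast
  show ?thesis
  proof (rule borel_measurable_LIMSEQ_metric)
    show "(\<lambda>\<omega>. G (s i \<omega>) (h \<omega>)) \<in> borel_measurable F" for i
    proof (rule measurable_compose_countable'[where f="\<lambda>q \<omega>. G q (h \<omega>)" and I="s i ` space F"])
      show "s i \<in> F \<rightarrow>\<^sub>M count_space (s i ` space F)"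
        using s(1)[of i] by (auto simp: measurable_count_space_eq2 simple_function_def)
      show "countable (s i ` space F)" using s(1)[of i] by (auto simp: simple_function_def intro: countable_finite)
      show "(\<lambda>\<omega>. G q (h \<omega>)) \<in> borel_measurable F" for q by (rule measurable_compose[OF h G])
    qed
    fix \<omega> assume w: "\<omega> \<in> space F"
    then have "h \<omega> \<in> space S" using h by (auto dest: measurable_space)
    from c[OF this] have "isCont (\<lambda>\<theta>. G \<theta> (h \<omega>)) (f \<omega>)" by (auto simp: continuous_on_eq_continuous_at)
    then show "(\<lambda>i. G (s i \<omega>) (h \<omega>)) \<longlonglongrightarrow> G (f \<omega>) (h \<omega>)"
      by (rule isCont_tendsto_compose) (rule s(2)[OF w])
  qed
qed

section \<open>Generated sigma-algebras and conditional expectations\<close>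

lemma space_generated_by [simp]: "space (generated_by M J X S) = space M"
  by (simp add: generated_by_def space_measure_of_conv)

lemma generated_by_measurable:
  assumes "j \<in> J" "X j \<in> space M \<rightarrow> space (S j)"
  shows "X j \<in> measurable (generated_by M J X S) (S j)"
proof (rule measurableI)
  fix A assume "A \<in> sets (S j)"
  then have "X j -` A \<inter> space M \<in> (\<Union>j\<in>J. {X j -` A \<inter> space M | A. A \<in> sets (S j)})"
    using assms(1) by blast
  then show "X j -` A \<inter> space (generated_by M J X S) \<in> sets (generated_by M J X S)"
    unfolding generated_by_def by (subst sets_measure_of) (auto simp: space_measure_of_conv intro: sigma_sets.Basic)
qed (use assms in auto)

lemma sets_generated_by:
  "sets (generated_by M J X S) =
    sigma_sets (space M) (\<Union>j\<in>J. {X j -` A \<inter> space M | A. A \<in> sets (S j)})"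
  unfolding generated_by_def by (rule sets_measure_of) blast

lemma sets_generated_by_le:
  assumes sp: "space F = space M" and X: "\<And>j. j \<in> J \<Longrightarrow> X j \<in> measurable F (S j)"
  shows "sets (generated_by M J X S) \<subseteq> sets F"
proof -
  have "(\<Union>j\<in>J. {X j -` A \<inter> space M | A. A \<in> sets (S j)}) \<subseteq> sets F"
  proof (rule UN_least, clarify)
    fix j A assume "j \<in> J" "A \<in> sets (S j)"
    then show "X j -` A \<inter> space M \<in> sets F" using measurable_sets[OF X] sp by metis
  qed
  from sets.sigma_sets_subset[OF this] show ?thesis by (simp add: sets_generated_by sp)
qed

lemma subalgebra_generated_by:
  assumes "\<And>j. j \<in> J \<Longrightarrow> X j \<in> measurable M (S j)"
  shows "subalgebra M (generated_by M J X S)"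
  using sets_generated_by_le[where F=M and M=M and J=J and X=X and S=S] assms by (simp add: subalgebra_def)

lemma sets_vimage_algebra_le:
  assumes "space F = space M" "f \<in> measurable F S"
  shows "sets (vimage_algebra (space M) f S) \<subseteq> sets F"
proof -
  have "f \<in> space M \<rightarrow> space S" using measurable_space[OF assms(2)] assms(1) by auto
  then show ?thesis
    using measurable_sets[OF assms(2)] assms(1) by (subst sets_vimage_algebra2) auto
qed

lemma (in prob_space) prob_subalgebra: "subalgebra M F \<Longrightarrow> sigma_finite_subalgebra M F"
  by (intro finite_measure_subalgebra_is_sigma_finite finite_measure_subalgebra.intro)
     (auto simp: finite_measure_subalgebra_axioms_def finite_measure_axioms)

lemma (in prob_space) vec_cond_exp_inner:
  fixes u f :: "'a \<Rightarrow> real ^ 'd"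
  assumes F: "subalgebra M F" and u: "bounded_rv F u" and f: "bounded_rv M f"
  shows "integrable M (\<lambda>\<omega>. u \<omega> \<bullet> vec_cond_exp M F f \<omega>)"
    "(\<integral>\<omega>. u \<omega> \<bullet> vec_cond_exp M F f \<omega> \<partial>M) = (\<integral>\<omega>. u \<omega> \<bullet> f \<omega> \<partial>M)"
proof -
  interpret sigma_finite_subalgebra M F by (rule prob_subalgebra[OF F])
  have i: "integrable M (\<lambda>\<omega>. u \<omega> $ k * f \<omega> $ k)" for k
    by (intro bounded_rv_integrable bounded_rv_mult bounded_rv_nth f bounded_rv_mono[OF F u])
  have m: "(\<lambda>\<omega>. u \<omega> $ k) \<in> borel_measurable F" "(\<lambda>\<omega>. f \<omega> $ k) \<in> borel_measurable M" for k
    by (intro bounded_rv_measurable bounded_rv_nth u f)+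
  note r = real_cond_exp_intg[OF i m]
  show "integrable M (\<lambda>\<omega>. u \<omega> \<bullet> vec_cond_exp M F f \<omega>)"
    unfolding vec_cond_exp_def inner_vec_def inner_real_def using r(1) by (auto intro!: Bochner_Integration.integrable_sum)
  show "(\<integral>\<omega>. u \<omega> \<bullet> vec_cond_exp M F f \<omega> \<partial>M) = (\<integral>\<omega>. u \<omega> \<bullet> f \<omega> \<partial>M)"
    unfolding vec_cond_exp_def inner_vec_def inner_real_def using r i
    by (simp add: Bochner_Integration.integral_sum)
qed

section \<open>Averages over the agents\<close>

lemma agent_mean_const: "1 \<le> N \<Longrightarrow> agent_mean N (\<lambda>_. x) = x"
  by (simp add: agent_mean_def scaleR_scaleR sum_constant_scaleR)

lemma agent_mean_add: "agent_mean N (\<lambda>i. f i + h i) = agent_mean N f + agent_mean N h"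
  by (simp add: agent_mean_def sum.distrib scaleR_right_distrib)

lemma agent_mean_diff: "agent_mean N (\<lambda>i. f i - h i) = agent_mean N f - agent_mean N h"
  by (simp add: agent_mean_def sum_subtractf scaleR_right_diff_distrib)

lemma agent_mean_scaleR: "agent_mean N (\<lambda>i. a *\<^sub>R f i) = a *\<^sub>R agent_mean N f"
  by (simp add: agent_mean_def scaleR_sum_right mult.commute)

lemma agent_mean_mult: "agent_mean N (\<lambda>i. a * f i :: real) = a * agent_mean N f"
  using agent_mean_scaleR[of N a f] by simp

lemma agent_mean_cong: "(\<And>i. i < N \<Longrightarrow> f i = h i) \<Longrightarrow> agent_mean N f = agent_mean N h"
  by (simp add: agent_mean_def)

lemma agent_mean_inner: "x \<bullet> agent_mean N f = agent_mean N (\<lambda>i. x \<bullet> f i)"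
  by (simp add: agent_mean_def inner_sum_right)

lemma agent_mean_sum: "agent_mean N (\<lambda>i. \<Sum>r\<in>I. f i r) = (\<Sum>r\<in>I. agent_mean N (\<lambda>i. f i r))"
  unfolding agent_mean_def by (subst sum.swap) (simp add: scaleR_sum_right)

lemma agent_mean_mono: "(\<And>i. i < N \<Longrightarrow> f i \<le> (h i :: real)) \<Longrightarrow> agent_mean N f \<le> agent_mean N h"
  by (auto simp: agent_mean_def intro!: divide_right_mono sum_mono)

lemma agent_mean_nonneg: "(\<And>i. i < N \<Longrightarrow> 0 \<le> (h i :: real)) \<Longrightarrow> 0 \<le> agent_mean N h"
  by (auto simp: agent_mean_def intro!: sum_nonneg divide_nonneg_nonneg)

lemma agent_mean_le: "1 \<le> N \<Longrightarrow> (\<And>i. i < N \<Longrightarrow> f i \<le> (c :: real)) \<Longrightarrow> agent_mean N f \<le> c"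
  using agent_mean_mono[of N f "\<lambda>_. c"] agent_mean_const[of N c] by simp

lemma is_norm_agent_mean: "is_norm n \<Longrightarrow> n (agent_mean N f) \<le> agent_mean N (\<lambda>i. n (f i))"
  unfolding agent_mean_def
  using is_norm_sum[of n f "{..<N}"] by (auto simp: is_norm_scale intro!: divide_right_mono)

lemma agent_mean_sq_le: "(agent_mean N f)\<^sup>2 \<le> agent_mean N (\<lambda>i. (f i :: real)\<^sup>2)"
proof (cases "N = 0")
  case False
  have "(\<Sum>i<N. f i)\<^sup>2 \<le> real N * (\<Sum>i<N. (f i)\<^sup>2)"
    using Cauchy_Schwarz_ineq_sum[of "\<lambda>_. 1" f "{..<N}"] by simp
  then show ?thesis using False by (simp add: agent_mean_def field_simps power2_eq_square)
qed (simp add: agent_mean_def)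

lemma (in finite_measure) integral_agent_mean:
  fixes f :: "nat \<Rightarrow> 'a \<Rightarrow> 'b::{second_countable_topology, banach}"
  assumes "\<And>i. i < N \<Longrightarrow> integrable M (f i)"
  shows "(\<integral>\<omega>. agent_mean N (\<lambda>i. f i \<omega>) \<partial>M) = agent_mean N (\<lambda>i. \<integral>\<omega>. f i \<omega> \<partial>M)"
  unfolding agent_mean_def using assms by (simp add: Bochner_Integration.integral_sum)

section \<open>The algorithm driven by Markovian noise\<close>

lemma continuous_of_is_norm_lipschitz:
  fixes f :: "'a::euclidean_space \<Rightarrow> 'b::euclidean_space"
  assumes n: "is_norm n" and e: "0 < e" "\<And>x. e * norm x \<le> n' x"
    and f: "\<And>x y. n' (f x - f y) \<le> A * n (x - y)"
  shows "continuous_on UNIV f"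
proof -
  obtain C where C: "0 < C" "\<And>x. n x \<le> C * norm x" using is_norm_le_norm[OF n] by blast
  have "(\<bar>A\<bar> * C / e)-lipschitz_on UNIV f"
  proof (rule lipschitz_onI)
    fix x y
    have "e * norm (f x - f y) \<le> A * n (x - y)" using e(2) f by (rule order_trans)
    also have "\<dots> \<le> \<bar>A\<bar> * (C * norm (x - y))"
      using C is_norm_ge0[OF n] by (intro mult_mono) auto
    finally show "dist (f x) (f y) \<le> \<bar>A\<bar> * C / e * dist x y"
      using e(1) by (simp add: dist_norm field_simps)
  qed (use C e in auto)
  then show ?thesis by (rule lipschitz_on_continuous_on)
qed

text \<open>\<open>\<alpha> \<le> 1\<close> makes each update a convex combination of the iterate
  and a new direction; the step size condition implies it through \<open>C_1\<close>, which is at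
  least 1.\<close>

locale fegsam_process = prob_space M for M :: "'w measure" +
  fixes p :: fegsam_par and cn :: "real ^ 'd \<Rightarrow> real" and \<theta>0 :: "real ^ 'd" and N K :: nat and \<alpha> :: real
    and S :: "nat \<Rightarrow> 'y measure" and Y :: "nat \<Rightarrow> nat \<Rightarrow> 'w \<Rightarrow> 'y"
    and G :: "nat \<Rightarrow> real ^ 'd \<Rightarrow> 'y \<Rightarrow> real ^ 'd" and b :: "nat \<Rightarrow> 'y \<Rightarrow> real ^ 'd"
    and Gbar :: "nat \<Rightarrow> real ^ 'd \<Rightarrow> real ^ 'd" and bbar :: "nat \<Rightarrow> real ^ 'd" and \<eta> :: "nat \<Rightarrow> real"
  assumes cn: "is_norm cn" and lc2: "0 < plc2 p" and norm_le_cn: "\<And>x. plc2 p * norm x \<le> cn x"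
    and N: "1 \<le> N" and K: "1 \<le> K" and \<alpha>: "0 < \<alpha>" "\<alpha> \<le> 1"
    and markov: "markov_noise M N S Y"
    and mix: "mixing p cn M N S Y G b Gbar bbar \<eta>"
    and contr: "contraction p cn N Gbar"
    and lip: "lipschitz_bounded p cn N S G b"
    and ind: "independent_noise M N S Y (\<lambda>i t \<omega>. fegsam N K \<alpha> G b \<theta>0 (\<lambda>j s. Y j s \<omega>) t i)"
    and m1: "0 \<le> pm1 p" and m2: "0 \<le> pm2 p" and m3: "0 \<le> pm3 p" and m4: "0 \<le> pm4 p"
    and rho: "0 \<le> prho p" "prho p < 1" and gamma: "0 < pgamma p" "pgamma p < 1"
    and uc2: "0 < puc2 p" and cn_le_norm: "\<And>x. cn x \<le> puc2 p * norm x"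
    and eta: "\<And>i. 0 \<le> \<eta> i"
begin

definition X :: "nat \<Rightarrow> nat \<Rightarrow> 'w \<Rightarrow> real ^ 'd" where
  "X i t \<omega> = fegsam N K \<alpha> G b \<theta>0 (\<lambda>j s. Y j s \<omega>) t i"

definition th :: "nat \<Rightarrow> 'w \<Rightarrow> real ^ 'd" where
  "th t \<omega> = agent_mean N (\<lambda>i. X i t \<omega>)"

definition bm :: "nat \<Rightarrow> 'w \<Rightarrow> real ^ 'd" where
  "bm t \<omega> = agent_mean N (\<lambda>i. b i (Y i t \<omega>))"

abbreviation "H \<equiv> noise_history M N S Y"
abbreviation "VI i s \<equiv> vimage_algebra (space M) (Y i s) (S i)"
abbreviation "GY s \<equiv> generated_by M {..<N} (\<lambda>i. Y i s) S"

lemmas cn_ge0 [simp] = is_norm_ge0[OF cn]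

lemma Y_measurable: "i < N \<Longrightarrow> Y i t \<in> measurable M (S i)"
  using markov by (simp add: markov_noise_def)

lemma Y_space: "i < N \<Longrightarrow> \<omega> \<in> space M \<Longrightarrow> Y i t \<omega> \<in> space (S i)"
  using measurable_space[OF Y_measurable] .

lemma space_H [simp]: "space (H s) = space M"
  by (simp add: noise_history_def)

lemma subalgebra_H: "subalgebra M (H s)"
  unfolding noise_history_def by (rule subalgebra_generated_by) (auto intro: Y_measurable)

lemma subalgebra_GY: "subalgebra M (GY s)"
  by (rule subalgebra_generated_by) (auto intro: Y_measurable)

lemma Y_H: "i < N \<Longrightarrow> r \<le> s \<Longrightarrow> Y i r \<in> measurable (H s) (S i)"
  using generated_by_measurable[of "(i, r)" "{..<N} \<times> {..s}" "\<lambda>(i, r). Y i r" M "\<lambda>(i, r). S i"] Y_space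
  by (auto simp: noise_history_def)

lemma Y_GY: "i < N \<Longrightarrow> Y i s \<in> measurable (GY s) (S i)"
  using generated_by_measurable[of i "{..<N}" "\<lambda>i. Y i s" M S] Y_space by auto

lemma sets_GY_H: "sets (GY s) \<subseteq> sets (H s)"
  by (rule sets_generated_by_le) (auto intro: Y_H)

lemma sets_VI_GY: "i < N \<Longrightarrow> sets (VI i s) \<subseteq> sets (GY s)"
  by (rule sets_vimage_algebra_le) (auto intro: Y_GY)

lemma G_measurable: "i < N \<Longrightarrow> G i \<theta> \<in> borel_measurable (S i)"
  and b_measurable: "i < N \<Longrightarrow> b i \<in> borel_measurable (S i)"
  and G_lip: "i < N \<Longrightarrow> y \<in> space (S i) \<Longrightarrow> cn (G i \<theta>1 y - G i \<theta>2 y) \<le> pA1 p * cn (\<theta>1 - \<theta>2)"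
  and G_bound: "i < N \<Longrightarrow> y \<in> space (S i) \<Longrightarrow> cn (G i \<theta> y) \<le> pA2 p * cn \<theta>"
  and b_bound: "i < N \<Longrightarrow> y \<in> space (S i) \<Longrightarrow> cn (b i y) \<le> pB p"
  using lip by (auto simp: lipschitz_bounded_def)

text \<open>The inequalities themselves force the signs, because a norm is non-negative and the
  sample space is not empty.\<close>

lemma constants_nonneg: "0 \<le> pA1 p" "0 \<le> pA2 p" "0 \<le> pB p"
proof -
  obtain \<omega> where w: "\<omega> \<in> space M" using not_empty by blast
  have N0: "0 < N" using N by simp
  obtain v :: "real ^ 'd" where v: "v \<in> Basis" using nonempty_Basis by blast
  then have "cn v \<noteq> 0" using cn by (auto simp: is_norm_def)
  then have p: "0 < cn v" using cn_ge0[of v] by linarith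
  note y = Y_space[OF N0 w, of 0]
  have "0 \<le> pA1 p * cn v" using G_lip[OF N0 y, of v 0] order_trans[OF cn_ge0] by force
  then show "0 \<le> pA1 p" using p by (simp add: zero_le_mult_iff)
  have "0 \<le> pA2 p * cn v" using G_bound[OF N0 y, of v] order_trans[OF cn_ge0] by force
  then show "0 \<le> pA2 p" using p by (simp add: zero_le_mult_iff)
  show "0 \<le> pB p" using b_bound[OF N0 y] order_trans[OF cn_ge0] by force
qed

lemma norm_le: "norm x \<le> cn x / plc2 p"
  using norm_le_cn[of x] lc2 by (simp add: field_simps)

lemma inner_le_cn: "x \<bullet> w \<le> norm x / plc2 p * cn w"
proof -
  have "x \<bullet> w \<le> norm x * norm w" by (rule norm_cauchy_schwarz)
  also have "\<dots> \<le> norm x * (cn w / plc2 p)" by (intro mult_left_mono norm_le) auto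
  finally show ?thesis by simp
qed

lemma bounded_rvI_cn:
  fixes f :: "'a \<Rightarrow> real ^ 'd"
  assumes "f \<in> borel_measurable F" "\<And>\<omega>. \<omega> \<in> space F \<Longrightarrow> cn (f \<omega>) \<le> c"
  shows "bounded_rv F f"
proof (rule bounded_rvI[OF assms(1)])
  fix \<omega> assume "\<omega> \<in> space F"
  then show "norm (f \<omega>) \<le> c / plc2 p"
    using norm_le[of "f \<omega>"] assms(2) lc2 by (meson divide_right_mono less_imp_le order_trans)
qed

lemma bounded_rv_cn: "bounded_rv F f \<Longrightarrow> bounded_rv F (\<lambda>\<omega>. cn (f \<omega>))"
  by (rule bounded_rv_is_norm[OF cn])

lemma bounded_rv_cn_bound:
  assumes "bounded_rv F f" shows "\<exists>c\<ge>0. \<forall>\<omega>\<in>space F. cn (f \<omega>) \<le> c"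
  using bounded_rv_bound[OF bounded_rv_cn[OF assms]] by auto

lemma G_continuous: "i < N \<Longrightarrow> y \<in> space (S i) \<Longrightarrow> continuous_on UNIV (\<lambda>\<theta>. G i \<theta> y)"
  by (rule continuous_of_is_norm_lipschitz[OF cn lc2 norm_le_cn]) (rule G_lip)

lemma Gbar_contr: "i < N \<Longrightarrow> cn (Gbar i \<theta>1 - Gbar i \<theta>2) \<le> pgamma p * cn (\<theta>1 - \<theta>2)"
  using contr by (simp add: contraction_def)

lemma Gbar_continuous: "i < N \<Longrightarrow> continuous_on UNIV (Gbar i)"
  by (rule continuous_of_is_norm_lipschitz[OF cn lc2 norm_le_cn]) (rule Gbar_contr)

lemma bounded_rv_G:
  assumes i: "i < N" and f: "bounded_rv F f" and Y: "Y i t \<in> measurable F (S i)"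
  shows "bounded_rv F (\<lambda>\<omega>. G i (f \<omega>) (Y i t \<omega>))"
proof -
  obtain c where c: "0 \<le> c" "\<forall>\<omega>\<in>space F. cn (f \<omega>) \<le> c"
    using bounded_rv_cn_bound[OF f] by blast
  show ?thesis
  proof (rule bounded_rvI_cn)
    show "(\<lambda>\<omega>. G i (f \<omega>) (Y i t \<omega>)) \<in> borel_measurable F"
      by (rule measurable_caratheodory[where S="S i", OF bounded_rv_measurable[OF f] Y G_measurable[OF i] G_continuous[OF i]])
    fix \<omega> assume w: "\<omega> \<in> space F"
    have "cn (G i (f \<omega>) (Y i t \<omega>)) \<le> pA2 p * cn (f \<omega>)" by (rule G_bound[OF i measurable_space[OF Y w]])
    also have "\<dots> \<le> pA2 p * c" using c w constants_nonneg by (intro mult_left_mono) auto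
    finally show "cn (G i (f \<omega>) (Y i t \<omega>)) \<le> pA2 p * c" .
  qed
qed

lemma bounded_rv_b:
  assumes i: "i < N" and Y: "Y i t \<in> measurable F (S i)"
  shows "bounded_rv F (\<lambda>\<omega>. b i (Y i t \<omega>))"
  by (rule bounded_rvI_cn[OF measurable_compose[OF Y b_measurable[OF i]]])
     (rule b_bound[OF i measurable_space[OF Y]])

lemma X_0: "X i 0 \<omega> = \<theta>0"
  by (simp add: X_def)

lemma X_Suc: "X i (Suc t) \<omega> =
  (let \<theta>' = (\<lambda>i. X i t \<omega> + \<alpha> *\<^sub>R (G i (X i t \<omega>) (Y i t \<omega>) - X i t \<omega> + b i (Y i t \<omega>)))
   in if K dvd Suc t then agent_mean N \<theta>' else \<theta>' i)"
  by (simp add: X_def Let_def)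

lemma bounded_rv_X: "i < N \<Longrightarrow> t \<le> s \<Longrightarrow> bounded_rv (H s) (X i t)"
proof (induction t arbitrary: i)
  case 0
  then show ?case using bounded_rv_const[of "H s" \<theta>0] by (simp add: X_0[abs_def])
next
  case (Suc t)
  have *: "bounded_rv (H s) (\<lambda>\<omega>. X j t \<omega> + \<alpha> *\<^sub>R (G j (X j t \<omega>) (Y j t \<omega>) - X j t \<omega> + b j (Y j t \<omega>)))" if "j < N" for j
    using Suc that
    by (intro bounded_rv_add bounded_rv_scaleR bounded_rv_diff bounded_rv_const bounded_rv_G bounded_rv_b Y_H) auto
  show ?case
  proof (cases "K dvd Suc t")
    case True
    then show ?thesis unfolding X_Suc[abs_def] Let_def using bounded_rv_agent_mean[of N, OF *] by simp
  next
    case False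
    then show ?thesis unfolding X_Suc[abs_def] Let_def using *[OF Suc.prems(1)] by simp
  qed
qed

lemma bounded_rv_th: "t \<le> s \<Longrightarrow> bounded_rv (H s) (th t)"
  unfolding th_def[abs_def] by (intro bounded_rv_agent_mean bounded_rv_X)

lemma bounded_rv_bm: "t \<le> s \<Longrightarrow> bounded_rv (H s) (bm t)"
  unfolding bm_def[abs_def] by (intro bounded_rv_agent_mean bounded_rv_b Y_H)

lemmas rv_X = bounded_rv_mono[OF subalgebra_H bounded_rv_X[OF _ order_refl]]
lemmas rv_th = bounded_rv_mono[OF subalgebra_H bounded_rv_th[OF order_refl]]
lemmas rv_bm = bounded_rv_mono[OF subalgebra_H bounded_rv_bm[OF order_refl]]
lemmas rv_b = bounded_rv_b[OF _ Y_measurable]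

section \<open>Conditioning on the noise history\<close>

lemma real_cond_exp_H:
  assumes i: "i < N" and st: "s \<le> t" and f: "f \<in> borel_measurable (S i)" "\<And>y. y \<in> space (S i) \<Longrightarrow> \<bar>f y\<bar> \<le> c"
  shows "AE \<omega> in M. real_cond_exp M (H s) (\<lambda>\<omega>'. f (Y i t \<omega>')) \<omega> = real_cond_exp M (VI i s) (\<lambda>\<omega>'. f (Y i t \<omega>')) \<omega>"
proof -
  have "bounded (f ` space (S i))" unfolding bounded_iff using f(2) by auto
  then show ?thesis using markov i st f(1) unfolding markov_noise_def by blast
qed

lemma vec_cond_exp_H:
  fixes f :: "'y \<Rightarrow> real ^ 'd"
  assumes i: "i < N" and st: "s \<le> t" and f: "f \<in> borel_measurable (S i)" "\<forall>y\<in>space (S i). cn (f y) \<le> c"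
  shows "AE \<omega> in M. vec_cond_exp M (H s) (\<lambda>\<omega>'. f (Y i t \<omega>')) \<omega> = vec_cond_exp M (VI i s) (\<lambda>\<omega>'. f (Y i t \<omega>')) \<omega>"
proof -
  have "AE \<omega> in M. \<forall>k\<in>UNIV. real_cond_exp M (H s) (\<lambda>\<omega>'. f (Y i t \<omega>') $ k) \<omega> = real_cond_exp M (VI i s) (\<lambda>\<omega>'. f (Y i t \<omega>') $ k) \<omega>"
  proof (rule AE_finite_allI)
    fix k
    have c: "\<bar>f y $ k\<bar> \<le> c / plc2 p" if "y \<in> space (S i)" for y
      using component_le_norm_cart[of "f y" k] norm_le[of "f y"] bspec[OF f(2) that] lc2
      by (meson divide_right_mono less_imp_le order_trans)
    show "AE \<omega> in M. real_cond_exp M (H s) (\<lambda>\<omega>'. f (Y i t \<omega>') $ k) \<omega> = real_cond_exp M (VI i s) (\<lambda>\<omega>'. f (Y i t \<omega>') $ k) \<omega>"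
      by (rule real_cond_exp_H[OF i st _ c]) (rule borel_measurable_continuous_on[OF _ f(1)], intro continuous_intros)
  qed auto
  then show ?thesis by eventually_elim (auto simp: vec_cond_exp_def)
qed

lemma vec_cond_exp_measurable: "vec_cond_exp M F f \<in> borel_measurable M"
  unfolding vec_cond_exp_def[abs_def]
  by (subst borel_measurable_euclidean_space) (auto simp: Basis_vec_def inner_axis)

text \<open>The Markov property in the form used below. The mixing bounds condition on the state of
  one agent, whereas the test vector \<open>u\<close>, typically a gradient at a past iterate,
  depends on the past of all agents.\<close>

lemma expectation_cond_VI:
  fixes f :: "'y \<Rightarrow> real ^ 'd"
  assumes i: "i < N" and st: "s \<le> t" and f: "f \<in> borel_measurable (S i)" "\<forall>y\<in>space (S i). cn (f y) \<le> c"
    and u: "bounded_rv (H s) u"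
  shows "integrable M (\<lambda>\<omega>. u \<omega> \<bullet> vec_cond_exp M (VI i s) (\<lambda>\<omega>'. f (Y i t \<omega>')) \<omega>)"
    "(\<integral>\<omega>. u \<omega> \<bullet> f (Y i t \<omega>) \<partial>M) = (\<integral>\<omega>. u \<omega> \<bullet> vec_cond_exp M (VI i s) (\<lambda>\<omega>'. f (Y i t \<omega>')) \<omega> \<partial>M)"
proof -
  have um: "u \<in> borel_measurable M" by (rule bounded_rv_measurable[OF bounded_rv_mono[OF subalgebra_H u]])
  have fm: "bounded_rv M (\<lambda>\<omega>. f (Y i t \<omega>))"
    by (rule bounded_rvI_cn[OF measurable_compose[OF Y_measurable[OF i] f(1)]]) (rule bspec[OF f(2) Y_space[OF i]])
  note v = vec_cond_exp_inner[OF subalgebra_H u fm]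
  have m: "(\<lambda>\<omega>. u \<omega> \<bullet> vec_cond_exp M F h \<omega>) \<in> borel_measurable M" for F h
    by (intro borel_measurable_inner um vec_cond_exp_measurable)
  have eq: "AE \<omega> in M. u \<omega> \<bullet> vec_cond_exp M (H s) (\<lambda>\<omega>'. f (Y i t \<omega>')) \<omega> = u \<omega> \<bullet> vec_cond_exp M (VI i s) (\<lambda>\<omega>'. f (Y i t \<omega>')) \<omega>"
    using vec_cond_exp_H[OF i st f] by eventually_elim simp
  show "integrable M (\<lambda>\<omega>. u \<omega> \<bullet> vec_cond_exp M (VI i s) (\<lambda>\<omega>'. f (Y i t \<omega>')) \<omega>)"
    by (rule integrable_cong_AE_imp[OF v(1) m]) (use eq in eventually_elim, simp)
  show "(\<integral>\<omega>. u \<omega> \<bullet> f (Y i t \<omega>) \<partial>M) = (\<integral>\<omega>. u \<omega> \<bullet> vec_cond_exp M (VI i s) (\<lambda>\<omega>'. f (Y i t \<omega>')) \<omega> \<partial>M)"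
    unfolding v(2)[symmetric] by (rule integral_cong_AE[OF m m eq])
qed

text \<open>At the origin the mixing bound has right side 0, so \<open>Gbar i 0\<close> is almost
  surely a conditional expectation of \<open>G i 0 (Y i 0)\<close>, which vanishes by the growth
  bound on \<open>G\<close>. With the contraction this gives linear growth of \<open>Gbar i\<close>
  and, later, the value 0 of the common fixed point.\<close>

lemma Gbar_0: "i < N \<Longrightarrow> Gbar i 0 = 0"
proof -
  assume i: "i < N"
  have "AE \<omega> in M. cn (Gbar i 0 - vec_cond_exp M (VI i 0) (\<lambda>\<omega>'. G i 0 (Y i 0 \<omega>')) \<omega>) \<le> pm1 p * cn 0 * prho p ^ (0 - 0)"
    using mix i unfolding mixing_def by blast
  moreover have "cn (G i 0 (Y i 0 \<omega>)) = 0" if "\<omega> \<in> space M" for \<omega>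
    using G_bound[OF i Y_space[OF i that], of 0 0] cn_ge0[of "G i 0 (Y i 0 \<omega>)"] is_norm_zero[OF cn] by simp
  then have z: "G i 0 (Y i 0 \<omega>) = 0" if "\<omega> \<in> space M" for \<omega>
    using cn that by (auto simp: is_norm_def)
  \<comment> \<open>Pairing with the constant vector \<open>Gbar i 0\<close> turns the comparison
    into the vanishing of its squared norm.\<close>
  have "(\<integral>\<omega>. Gbar i 0 \<bullet> G i 0 (Y i 0 \<omega>) \<partial>M) = (\<integral>\<omega>. Gbar i 0 \<bullet> vec_cond_exp M (VI i 0) (\<lambda>\<omega>'. G i 0 (Y i 0 \<omega>')) \<omega> \<partial>M)"
    by (rule expectation_cond_VI[OF i le_refl G_measurable[OF i] ballI[OF G_bound[OF i]] bounded_rv_const])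
  moreover have "(\<integral>\<omega>. Gbar i 0 \<bullet> vec_cond_exp M (VI i 0) (\<lambda>\<omega>'. G i 0 (Y i 0 \<omega>')) \<omega> \<partial>M) = (\<integral>\<omega>. Gbar i 0 \<bullet> Gbar i 0 \<partial>M)"
  proof (rule integral_cong_AE)
    show "AE \<omega> in M. Gbar i 0 \<bullet> vec_cond_exp M (VI i 0) (\<lambda>\<omega>'. G i 0 (Y i 0 \<omega>')) \<omega> = Gbar i 0 \<bullet> Gbar i 0"
      using calculation(1)
    proof eventually_elim
      case (elim \<omega>)
      then have "cn (Gbar i 0 - vec_cond_exp M (VI i 0) (\<lambda>\<omega>'. G i 0 (Y i 0 \<omega>')) \<omega>) = 0"
        using cn_ge0 is_norm_zero[OF cn] by (simp add: antisym)
      then show ?case using cn by (simp add: is_norm_def)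
    qed
  qed (auto intro: borel_measurable_inner vec_cond_exp_measurable)
  moreover have "(\<integral>\<omega>. Gbar i 0 \<bullet> G i 0 (Y i 0 \<omega>) \<partial>M) = (\<integral>\<omega>. 0 \<partial>M)"
    by (rule Bochner_Integration.integral_cong) (auto simp: z)
  ultimately show "Gbar i 0 = 0" by (simp add: prob_space)
qed

lemma Gbar_bound: "i < N \<Longrightarrow> cn (Gbar i \<theta>) \<le> pgamma p * cn \<theta>"
  using Gbar_contr[of i \<theta> 0] Gbar_0 by simp

text \<open>The dual norm of \<open>u \<omega>\<close> with respect to \<open>cn\<close> is bounded by \<open>d \<omega>\<close>.\<close>

lemma expectation_G_fixed:
  assumes i: "i < N" and st: "s \<le> t" and u: "bounded_rv (H s) u" and d: "bounded_rv M d"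
    and d0: "\<And>\<omega>. \<omega> \<in> space M \<Longrightarrow> 0 \<le> d \<omega>" and ud: "\<And>\<omega> w. \<omega> \<in> space M \<Longrightarrow> u \<omega> \<bullet> w \<le> d \<omega> * cn w"
  shows "(\<integral>\<omega>. u \<omega> \<bullet> (G i \<theta> (Y i t \<omega>) - Gbar i \<theta>) \<partial>M) \<le> (\<integral>\<omega>. d \<omega> * (pm1 p * cn \<theta> * prho p ^ (t - s)) \<partial>M)"
proof -
  let ?V = "vec_cond_exp M (VI i s) (\<lambda>\<omega>'. G i \<theta> (Y i t \<omega>'))"
  have uM: "bounded_rv M u" by (rule bounded_rv_mono[OF subalgebra_H u])
  have i1: "integrable M (\<lambda>\<omega>. u \<omega> \<bullet> G i \<theta> (Y i t \<omega>))"
    by (intro bounded_rv_integrable bounded_rv_inner uM bounded_rv_G i bounded_rv_const Y_measurable)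
  have i2: "integrable M (\<lambda>\<omega>. u \<omega> \<bullet> Gbar i \<theta>)"
    by (intro bounded_rv_integrable bounded_rv_inner uM bounded_rv_const)
  note v = expectation_cond_VI[OF i st G_measurable[OF i] ballI[OF G_bound[OF i]] u, of \<theta>]
  have "(\<integral>\<omega>. u \<omega> \<bullet> (G i \<theta> (Y i t \<omega>) - Gbar i \<theta>) \<partial>M) = (\<integral>\<omega>. u \<omega> \<bullet> ?V \<omega> - u \<omega> \<bullet> Gbar i \<theta> \<partial>M)"
    using i1 i2 v by (simp add: inner_diff_right)
  also have "\<dots> \<le> (\<integral>\<omega>. d \<omega> * (pm1 p * cn \<theta> * prho p ^ (t - s)) \<partial>M)"
  proof (rule integral_mono_AE)
    show "integrable M (\<lambda>\<omega>. u \<omega> \<bullet> ?V \<omega> - u \<omega> \<bullet> Gbar i \<theta>)" using v(1) i2 by simp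
    show "integrable M (\<lambda>\<omega>. d \<omega> * (pm1 p * cn \<theta> * prho p ^ (t - s)))"
      by (intro bounded_rv_integrable bounded_rv_mult d bounded_rv_const)
    have "AE \<omega> in M. cn (Gbar i \<theta> - ?V \<omega>) \<le> pm1 p * cn \<theta> * prho p ^ (t - s)"
      using mix i st unfolding mixing_def by blast
    then show "AE \<omega> in M. u \<omega> \<bullet> ?V \<omega> - u \<omega> \<bullet> Gbar i \<theta> \<le> d \<omega> * (pm1 p * cn \<theta> * prho p ^ (t - s))"
      using AE_space
    proof eventually_elim
      case (elim \<omega>)
      have "u \<omega> \<bullet> (?V \<omega> - Gbar i \<theta>) \<le> d \<omega> * cn (?V \<omega> - Gbar i \<theta>)" by (rule ud[OF elim(2)])
      also have "\<dots> \<le> d \<omega> * (pm1 p * cn \<theta> * prho p ^ (t - s))"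
        using elim d0[OF elim(2)] is_norm_minus_commute[OF cn, of "Gbar i \<theta>" "?V \<omega>"] by (intro mult_left_mono) auto
      finally show ?case by (simp add: inner_diff_right)
    qed
  qed
  finally show ?thesis .
qed

text \<open>On a level set of \<open>f\<close> the parameter is deterministic. The indicator of that
  set is measurable for the history and can be moved into the test vector and into \<open>d\<close>,
  so the bound for a fixed parameter applies on each level set.\<close>

lemma expectation_G_simple:
  assumes i: "i < N" and st: "s \<le> t" and u: "bounded_rv (H s) u" and d: "bounded_rv M d"
    and d0: "\<And>\<omega>. \<omega> \<in> space M \<Longrightarrow> 0 \<le> d \<omega>" and ud: "\<And>\<omega> w. \<omega> \<in> space M \<Longrightarrow> u \<omega> \<bullet> w \<le> d \<omega> * cn w"
    and f: "simple_function (H s) f"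
  shows "(\<integral>\<omega>. u \<omega> \<bullet> (G i (f \<omega>) (Y i t \<omega>) - Gbar i (f \<omega>)) \<partial>M)
    \<le> (\<integral>\<omega>. d \<omega> * (pm1 p * cn (f \<omega>) * prho p ^ (t - s)) \<partial>M)"
proof -
  define Q where "Q = f ` space M"
  define I where "I q = (indicator (f -` {q} \<inter> space M) :: 'w \<Rightarrow> real)" for q
  have fin: "finite Q" using f by (simp add: Q_def simple_function_def)
  have sets: "f -` {q} \<inter> space M \<in> sets (H s)" for q
    using f by (auto simp: simple_function_def intro: sets.countable_UN) (metis space_H simple_functionD(2)[OF f])
  have IH: "bounded_rv (H s) (I q)" for q unfolding I_def[abs_def] by (rule bounded_rv_indicator[OF sets])
  have IM: "bounded_rv M (I q)" for q by (rule bounded_rv_mono[OF subalgebra_H IH])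
  have split: "h (f \<omega>) \<omega> = (\<Sum>q\<in>Q. I q \<omega> * h q \<omega>)" if "\<omega> \<in> space M" for h :: "real ^ 'd \<Rightarrow> 'w \<Rightarrow> real" and \<omega>
  proof -
    have "(\<Sum>q\<in>Q. I q \<omega> * h q \<omega>) = (\<Sum>q\<in>Q. if q = f \<omega> then h q \<omega> else 0)"
      using that by (intro sum.cong) (auto simp: I_def)
    also have "\<dots> = h (f \<omega>) \<omega>" using that fin by (simp add: Q_def)
    finally show ?thesis by simp
  qed
  have "(\<integral>\<omega>. u \<omega> \<bullet> (G i (f \<omega>) (Y i t \<omega>) - Gbar i (f \<omega>)) \<partial>M)
    = (\<integral>\<omega>. (\<Sum>q\<in>Q. I q \<omega> * (u \<omega> \<bullet> (G i q (Y i t \<omega>) - Gbar i q))) \<partial>M)"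
    by (rule Bochner_Integration.integral_cong[OF refl])
       (rule split[of _ "\<lambda>q \<omega>. u \<omega> \<bullet> (G i q (Y i t \<omega>) - Gbar i q)"])
  also have "\<dots> = (\<Sum>q\<in>Q. \<integral>\<omega>. I q \<omega> * (u \<omega> \<bullet> (G i q (Y i t \<omega>) - Gbar i q)) \<partial>M)"
    by (rule Bochner_Integration.integral_sum)
       (intro bounded_rv_integrable bounded_rv_mult bounded_rv_inner IM bounded_rv_mono[OF subalgebra_H u]
         bounded_rv_diff bounded_rv_G i bounded_rv_const Y_measurable)
  also have "\<dots> \<le> (\<Sum>q\<in>Q. \<integral>\<omega>. (I q \<omega> * d \<omega>) * (pm1 p * cn q * prho p ^ (t - s)) \<partial>M)"
  proof (rule sum_mono)
    fix q
    have "(\<integral>\<omega>. (I q \<omega> *\<^sub>R u \<omega>) \<bullet> (G i q (Y i t \<omega>) - Gbar i q) \<partial>M)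
      \<le> (\<integral>\<omega>. (I q \<omega> * d \<omega>) * (pm1 p * cn q * prho p ^ (t - s)) \<partial>M)"
      by (rule expectation_G_fixed[OF i st bounded_rv_scaleR[OF IH u] bounded_rv_mult[OF IM d]])
         (auto simp: I_def indicator_def d0 ud)
    then show "(\<integral>\<omega>. I q \<omega> * (u \<omega> \<bullet> (G i q (Y i t \<omega>) - Gbar i q)) \<partial>M)
      \<le> (\<integral>\<omega>. (I q \<omega> * d \<omega>) * (pm1 p * cn q * prho p ^ (t - s)) \<partial>M)" by simp
  qed
  also have "\<dots> = (\<integral>\<omega>. (\<Sum>q\<in>Q. (I q \<omega> * d \<omega>) * (pm1 p * cn q * prho p ^ (t - s))) \<partial>M)"
    by (rule Bochner_Integration.integral_sum[symmetric])
       (intro bounded_rv_integrable bounded_rv_mult IM d bounded_rv_const)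
  also have "\<dots> = (\<integral>\<omega>. d \<omega> * (pm1 p * cn (f \<omega>) * prho p ^ (t - s)) \<partial>M)"
    by (rule Bochner_Integration.integral_cong[OF refl], simp only: mult.assoc)
       (rule split[of _ "\<lambda>q \<omega>. d \<omega> * (pm1 p * (cn q * prho p ^ (t - s)))", symmetric])
  finally show ?thesis .
qed

text \<open>The substitution rule for a random parameter known at time \<open>s\<close>, as an
  inequality of expectations: simple approximations of \<open>f\<close> and dominated convergence on
  both sides, by continuity of \<open>G\<close>, \<open>Gbar\<close> and \<open>cn\<close>.\<close>

lemma expectation_G:
  assumes i: "i < N" and st: "s \<le> t" and u: "bounded_rv (H s) u" and d: "bounded_rv M d"
    and d0: "\<And>\<omega>. \<omega> \<in> space M \<Longrightarrow> 0 \<le> d \<omega>" and ud: "\<And>\<omega> w. \<omega> \<in> space M \<Longrightarrow> u \<omega> \<bullet> w \<le> d \<omega> * cn w"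
    and f: "bounded_rv (H s) f"
  shows "(\<integral>\<omega>. u \<omega> \<bullet> (G i (f \<omega>) (Y i t \<omega>) - Gbar i (f \<omega>)) \<partial>M)
    \<le> (\<integral>\<omega>. d \<omega> * (pm1 p * cn (f \<omega>) * prho p ^ (t - s)) \<partial>M)"
proof -
  obtain F where F0: "\<forall>k. simple_function (H s) (F k)" "\<forall>\<omega>\<in>space M. (\<lambda>k. F k \<omega>) \<longlonglongrightarrow> f \<omega>"
      "\<forall>k. \<forall>\<omega>\<in>space M. dist (F k \<omega>) 0 \<le> 2 * dist (f \<omega>) 0"
    using borel_measurable_implies_sequence_metric[OF bounded_rv_measurable[OF f], of 0]
    unfolding space_H by (elim exE conjE)
  have F: "simple_function (H s) (F k)" "\<omega> \<in> space M \<Longrightarrow> (\<lambda>k. F k \<omega>) \<longlonglongrightarrow> f \<omega>"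
      "\<omega> \<in> space M \<Longrightarrow> norm (F k \<omega>) \<le> 2 * norm (f \<omega>)" for k \<omega>
    using F0 by auto
  have FH: "F k \<in> borel_measurable (H s)" for k using F(1) by (rule borel_measurable_simple_function)
  obtain c where c: "0 \<le> c" "\<forall>\<omega>\<in>space M. norm (f \<omega>) \<le> c" using bounded_rv_bound[OF f] by auto
  obtain dc where dc: "0 \<le> dc" "\<forall>\<omega>\<in>space M. norm (d \<omega>) \<le> dc" using bounded_rv_bound[OF d] by auto
  obtain C where C: "0 < C" "\<And>x. cn x \<le> C * norm x" using is_norm_le_norm[OF cn] by blast
  \<comment> \<open>The factor 2 is inherited from the approximants, whose norm is at most twice
    that of \<open>f\<close>.\<close>
  have Fb: "cn (F k \<omega>) \<le> C * (2 * c)" if "\<omega> \<in> space M" for k \<omega>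
    using order_trans[OF F(3)[OF that, of k], of "2 * c"] c that C(1) by (intro order_trans[OF C(2)] mult_left_mono) auto
  have FR: "bounded_rv (H s) (F k)" for k
    by (rule bounded_rvI_cn[OF FH]) (use Fb in auto)
  note FM = bounded_rv_mono[OF subalgebra_H FR] and fM = bounded_rv_mono[OF subalgebra_H f] and uM = bounded_rv_mono[OF subalgebra_H u]
  have g: "bounded_rv M (\<lambda>\<omega>. u \<omega> \<bullet> (G i (h \<omega>) (Y i t \<omega>) - Gbar i (h \<omega>)))" if "bounded_rv M h" for h
    by (intro bounded_rv_inner uM bounded_rv_diff bounded_rv_G i that Y_measurable bounded_rv_continuous[OF Gbar_continuous])
  have g': "bounded_rv M (\<lambda>\<omega>. d \<omega> * (pm1 p * cn (h \<omega>) * prho p ^ (t - s)))" if "bounded_rv M h" for h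
    by (intro bounded_rv_mult d bounded_rv_const bounded_rv_cn that)
  have L: "(\<lambda>k. \<integral>\<omega>. u \<omega> \<bullet> (G i (F k \<omega>) (Y i t \<omega>) - Gbar i (F k \<omega>)) \<partial>M)
    \<longlonglongrightarrow> (\<integral>\<omega>. u \<omega> \<bullet> (G i (f \<omega>) (Y i t \<omega>) - Gbar i (f \<omega>)) \<partial>M)"
  proof (rule integral_dominated_convergence[where w="\<lambda>_. dc * ((pA2 p + pgamma p) * (C * (2 * c)))"])
    show "AE \<omega> in M. (\<lambda>k. u \<omega> \<bullet> (G i (F k \<omega>) (Y i t \<omega>) - Gbar i (F k \<omega>)))
      \<longlonglongrightarrow> u \<omega> \<bullet> (G i (f \<omega>) (Y i t \<omega>) - Gbar i (f \<omega>))"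
    proof (rule AE_I2)
      fix \<omega> assume w: "\<omega> \<in> space M"
      have "isCont (\<lambda>\<theta>. G i \<theta> (Y i t \<omega>)) (f \<omega>)" "isCont (Gbar i) (f \<omega>)"
        using G_continuous[OF i Y_space[OF i w]] Gbar_continuous[OF i] by (auto simp: continuous_on_eq_continuous_at)
      then show "(\<lambda>k. u \<omega> \<bullet> (G i (F k \<omega>) (Y i t \<omega>) - Gbar i (F k \<omega>)))
        \<longlonglongrightarrow> u \<omega> \<bullet> (G i (f \<omega>) (Y i t \<omega>) - Gbar i (f \<omega>))"
        using F(2)[OF w] by (intro tendsto_inner tendsto_diff tendsto_const) (auto intro: isCont_tendsto_compose)
    qed
    fix k
    show "AE \<omega> in M. norm (u \<omega> \<bullet> (G i (F k \<omega>) (Y i t \<omega>) - Gbar i (F k \<omega>))) \<le> dc * ((pA2 p + pgamma p) * (C * (2 * c)))"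
    proof (rule AE_I2)
      fix \<omega> assume w: "\<omega> \<in> space M"
      let ?x = "G i (F k \<omega>) (Y i t \<omega>) - Gbar i (F k \<omega>)"
      have "norm (u \<omega> \<bullet> ?x) \<le> d \<omega> * cn ?x"
        using ud[OF w, of ?x] ud[OF w, of "- ?x", unfolded inner_minus_right is_norm_uminus[OF cn]]
        unfolding real_norm_def abs_le_iff by (rule conjI)
      also have "\<dots> \<le> dc * ((pA2 p + pgamma p) * (C * (2 * c)))"
      proof (rule mult_mono)
        show "d \<omega> \<le> dc" using dc w by auto
        have "cn ?x \<le> cn (G i (F k \<omega>) (Y i t \<omega>)) + cn (Gbar i (F k \<omega>))" by (rule is_norm_diff[OF cn])
        also have "\<dots> \<le> pA2 p * cn (F k \<omega>) + pgamma p * cn (F k \<omega>)"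
          by (intro add_mono G_bound Gbar_bound i Y_space w)
        also have "\<dots> = (pA2 p + pgamma p) * cn (F k \<omega>)" by (simp add: algebra_simps)
        also have "\<dots> \<le> (pA2 p + pgamma p) * (C * (2 * c))"
          using constants_nonneg gamma by (intro mult_left_mono Fb w) auto
        finally show "cn ?x \<le> (pA2 p + pgamma p) * (C * (2 * c))" .
      qed (use dc in auto)
      finally show "norm (u \<omega> \<bullet> ?x) \<le> dc * ((pA2 p + pgamma p) * (C * (2 * c)))" .
    qed
  qed (use g[OF fM] g[OF FM] in \<open>auto intro: bounded_rv_measurable\<close>)
  have R: "(\<lambda>k. \<integral>\<omega>. d \<omega> * (pm1 p * cn (F k \<omega>) * prho p ^ (t - s)) \<partial>M)
    \<longlonglongrightarrow> (\<integral>\<omega>. d \<omega> * (pm1 p * cn (f \<omega>) * prho p ^ (t - s)) \<partial>M)"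
  proof (rule integral_dominated_convergence[where w="\<lambda>_. dc * (pm1 p * (C * (2 * c)) * prho p ^ (t - s))"])
    show "AE \<omega> in M. (\<lambda>k. d \<omega> * (pm1 p * cn (F k \<omega>) * prho p ^ (t - s)))
      \<longlonglongrightarrow> d \<omega> * (pm1 p * cn (f \<omega>) * prho p ^ (t - s))"
    proof (rule AE_I2)
      fix \<omega> assume w: "\<omega> \<in> space M"
      have "isCont cn (f \<omega>)" using is_norm_continuous[OF cn] by (auto simp: continuous_on_eq_continuous_at)
      then show "(\<lambda>k. d \<omega> * (pm1 p * cn (F k \<omega>) * prho p ^ (t - s)))
        \<longlonglongrightarrow> d \<omega> * (pm1 p * cn (f \<omega>) * prho p ^ (t - s))"
        using F(2)[OF w] by (intro tendsto_mult tendsto_const) (auto intro: isCont_tendsto_compose)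
    qed
    fix k
    show "AE \<omega> in M. norm (d \<omega> * (pm1 p * cn (F k \<omega>) * prho p ^ (t - s))) \<le> dc * (pm1 p * (C * (2 * c)) * prho p ^ (t - s))"
    proof (rule AE_I2)
      fix \<omega> assume w: "\<omega> \<in> space M"
      have "norm (d \<omega> * (pm1 p * cn (F k \<omega>) * prho p ^ (t - s))) = norm (d \<omega>) * (pm1 p * cn (F k \<omega>) * prho p ^ (t - s))"
        using m1 rho by (simp add: abs_mult)
      also have "\<dots> \<le> dc * (pm1 p * (C * (2 * c)) * prho p ^ (t - s))"
        using dc w Fb[OF w, of k] m1 rho by (intro mult_mono mult_right_mono mult_left_mono) auto
      finally show "norm (d \<omega> * (pm1 p * cn (F k \<omega>) * prho p ^ (t - s))) \<le> dc * (pm1 p * (C * (2 * c)) * prho p ^ (t - s))" .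
    qed
  qed (use g'[OF fM] g'[OF FM] in \<open>auto intro: bounded_rv_measurable\<close>)
  show ?thesis
    by (rule LIMSEQ_le[OF L R]) (intro exI allI impI expectation_G_simple[OF i st u d] d0 ud F(1))
qed

end

section \<open>The averaged noise: mixing, decay of correlations, variance\<close>

lemma agent_mean_nth: "agent_mean N f $ k = agent_mean N (\<lambda>i. (f i :: real ^ 'd) $ k)"
  by (simp add: agent_mean_def sum_component)

lemma agent_mean_inner_self:
  "agent_mean N f \<bullet> agent_mean N f = (1 / (real N)\<^sup>2) * (\<Sum>i<N. \<Sum>j<N. f i \<bullet> f j)"
proof -
  have "sum f {..<N} \<bullet> sum f {..<N} = (\<Sum>i<N. \<Sum>j<N. f i \<bullet> f j)"
    by (simp only: inner_sum_left) (simp only: inner_sum_right)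
  then show ?thesis by (simp add: agent_mean_def power2_eq_square)
qed

text \<open>A function measurable for the trivial sigma-algebra has only trivial level sets, hence
  is constant at every single point; the integral determines the constant.\<close>

lemma (in prob_space) real_cond_exp_trivial:
  assumes F: "subalgebra M F" "sets F \<subseteq> {{}, space M}" and h: "integrable M h" and w: "\<omega> \<in> space M"
  shows "real_cond_exp M F h \<omega> = (\<integral>x. h x \<partial>M)"
proof -
  interpret sigma_finite_subalgebra M F by (rule prob_subalgebra[OF F(1)])
  let ?g = "real_cond_exp M F h"
  have sp: "space F = space M" using F(1) by (simp add: subalgebra_def)
  have "?g -` {?g \<omega>} \<inter> space M \<in> sets F"
    using measurable_sets[of ?g F borel "{?g \<omega>}"] sp by auto
  moreover have "\<omega> \<in> ?g -` {?g \<omega>} \<inter> space M" using w by simp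
  ultimately have "?g -` {?g \<omega>} \<inter> space M = space M" using F(2) by blast
  then have "(\<integral>x. ?g x \<partial>M) = (\<integral>x. ?g \<omega> \<partial>M)"
    by (intro Bochner_Integration.integral_cong) auto
  then show ?thesis using real_cond_exp_int(2)[OF h] by (simp add: prob_space)
qed

context fegsam_process
begin

lemma expectation_bm_cond:
  assumes st: "s \<le> t" and u: "bounded_rv (H s) u"
  defines "V \<equiv> \<lambda>\<omega>. agent_mean N (\<lambda>i. vec_cond_exp M (VI i s) (\<lambda>\<omega>'. b i (Y i t \<omega>')) \<omega>)"
  shows "integrable M (\<lambda>\<omega>. u \<omega> \<bullet> V \<omega>)" "(\<integral>\<omega>. u \<omega> \<bullet> bm t \<omega> \<partial>M) = (\<integral>\<omega>. u \<omega> \<bullet> V \<omega> \<partial>M)"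
proof -
  have uM: "bounded_rv M u" by (rule bounded_rv_mono[OF subalgebra_H u])
  note v = expectation_cond_VI[OF _ st b_measurable ballI[OF b_bound] u]
  show "integrable M (\<lambda>\<omega>. u \<omega> \<bullet> V \<omega>)"
    unfolding V_def agent_mean_inner unfolding agent_mean_def
    by (intro integrable_scaleR_right Bochner_Integration.integrable_sum v(1)) auto
  have "(\<integral>\<omega>. u \<omega> \<bullet> bm t \<omega> \<partial>M) = agent_mean N (\<lambda>i. \<integral>\<omega>. u \<omega> \<bullet> b i (Y i t \<omega>) \<partial>M)"
    unfolding bm_def agent_mean_inner
    by (intro integral_agent_mean bounded_rv_integrable bounded_rv_inner uM rv_b)
  also have "\<dots> = agent_mean N (\<lambda>i. \<integral>\<omega>. u \<omega> \<bullet> vec_cond_exp M (VI i s) (\<lambda>\<omega>'. b i (Y i t \<omega>')) \<omega> \<partial>M)"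
    by (intro agent_mean_cong v(2)) auto
  also have "\<dots> = (\<integral>\<omega>. u \<omega> \<bullet> V \<omega> \<partial>M)"
    unfolding V_def agent_mean_inner by (intro integral_agent_mean[symmetric] v(1)) auto
  finally show "(\<integral>\<omega>. u \<omega> \<bullet> bm t \<omega> \<partial>M) = (\<integral>\<omega>. u \<omega> \<bullet> V \<omega> \<partial>M)" .
qed

text \<open>The mixing bound for the mean conditions on the joint present of all agents, while the
  Markov property speaks of one agent at a time. The average of the individual conditional
  expectations is measurable for the joint present and has the right integrals over all sets of the
  joint past, in particular over those of the joint present.\<close>

lemma vec_cond_exp_GY:
  assumes st: "s \<le> t"
  shows "AE \<omega> in M. vec_cond_exp M (GY s) (bm t) \<omega> = agent_mean N (\<lambda>i. vec_cond_exp M (VI i s) (\<lambda>\<omega>'. b i (Y i t \<omega>')) \<omega>)"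
proof -
  interpret GY: sigma_finite_subalgebra M "GY s" by (rule prob_subalgebra[OF subalgebra_GY])
  define V where "V \<omega> = agent_mean N (\<lambda>i. vec_cond_exp M (VI i s) (\<lambda>\<omega>'. b i (Y i t \<omega>')) \<omega>)" for \<omega>
  have "AE \<omega> in M. \<forall>k\<in>UNIV. real_cond_exp M (GY s) (\<lambda>\<omega>'. bm t \<omega>' $ k) \<omega> = V \<omega> $ k"
  proof (rule AE_finite_allI)
    fix k :: 'd
    show "AE \<omega> in M. real_cond_exp M (GY s) (\<lambda>\<omega>'. bm t \<omega>' $ k) \<omega> = V \<omega> $ k"
    proof (rule GY.real_cond_exp_charact)
      fix A assume "A \<in> sets (GY s)"
      then have "A \<in> sets (H s)" using sets_GY_H by blast
      \<comment> \<open>An indicator times a coordinate vector: tested against it, the identity for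
        inner products becomes the one for the coordinate \<open>k\<close> on the set
        \<open>A\<close>.\<close>
      then have u: "bounded_rv (H s) (\<lambda>\<omega>. indicator A \<omega> *\<^sub>R axis k (1::real))"
        by (intro bounded_rv_scaleR bounded_rv_indicator bounded_rv_const)
      show "(\<integral>x\<in>A. bm t x $ k \<partial>M) = (\<integral>x\<in>A. V x $ k \<partial>M)"
        using expectation_bm_cond(2)[OF st u]
        by (simp add: set_lebesgue_integral_def V_def cart_eq_inner_axis inner_commute)
    next
      show "integrable M (\<lambda>\<omega>. bm t \<omega> $ k)" by (intro bounded_rv_integrable bounded_rv_nth rv_bm)
      show "integrable M (\<lambda>\<omega>. V \<omega> $ k)"
        using expectation_bm_cond(1)[OF st bounded_rv_const[of "H s" "axis k (1::real)"]]
        by (simp add: V_def cart_eq_inner_axis inner_commute)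
      have "real_cond_exp M (VI i s) f \<in> borel_measurable (GY s)" if "i < N" for i f
      proof (rule measurable_from_subalg[of "GY s" "VI i s"])
        show "subalgebra (GY s) (VI i s)" using sets_VI_GY[OF that] by (simp add: subalgebra_def)
      qed auto
      then show "(\<lambda>\<omega>. V \<omega> $ k) \<in> borel_measurable (GY s)"
        unfolding V_def agent_mean_nth vec_cond_exp_def unfolding agent_mean_def
        by (auto intro!: borel_measurable_sum)
    qed
  qed auto
  then show ?thesis by eventually_elim (auto simp: vec_cond_exp_def V_def vec_eq_iff)
qed

lemma expectation_bm:
  assumes st: "s \<le> t" and u: "bounded_rv (H s) u" and d: "bounded_rv M d"
    and d0: "\<And>\<omega>. \<omega> \<in> space M \<Longrightarrow> 0 \<le> d \<omega>" and ud: "\<And>\<omega> w. \<omega> \<in> space M \<Longrightarrow> u \<omega> \<bullet> w \<le> d \<omega> * cn w"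
  shows "(\<integral>\<omega>. u \<omega> \<bullet> bm t \<omega> \<partial>M) \<le> (\<integral>\<omega>. d \<omega> * (pm4 p * prho p ^ (t - s)) \<partial>M)"
proof -
  have "AE \<omega> in M. cn (vec_cond_exp M (GY s) (bm t) \<omega>) \<le> pm4 p * prho p ^ (t - s)"
    using mix st unfolding mixing_def bm_def[abs_def] by blast
  then show ?thesis unfolding expectation_bm_cond(2)[OF st u]
  proof (intro integral_mono_AE expectation_bm_cond(1)[OF st u])
    show "integrable M (\<lambda>\<omega>. d \<omega> * (pm4 p * prho p ^ (t - s)))"
      by (intro bounded_rv_integrable bounded_rv_mult d bounded_rv_const)
    assume "AE \<omega> in M. cn (vec_cond_exp M (GY s) (bm t) \<omega>) \<le> pm4 p * prho p ^ (t - s)"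
    then show "AE \<omega> in M. u \<omega> \<bullet> agent_mean N (\<lambda>i. vec_cond_exp M (VI i s) (\<lambda>\<omega>'. b i (Y i t \<omega>')) \<omega>)
        \<le> d \<omega> * (pm4 p * prho p ^ (t - s))"
      using vec_cond_exp_GY[OF st] AE_space
    proof eventually_elim
      case (elim \<omega>)
      then show ?case by (intro order_trans[OF ud] mult_left_mono d0) auto
    qed
  qed
qed

text \<open>Conditioning on the earlier time leaves the mixing bound for the later factor, while the
  earlier one is bounded by \<open>pB\<close>. The part with \<open>\<eta> i\<close> does not decay
  in \<open>t - s\<close>: it reflects the asymptotic bias of the agent.\<close>

lemma expectation_bb:
  assumes i: "i < N" and st: "s \<le> t"
  shows "(\<integral>\<omega>. b i (Y i s \<omega>) \<bullet> b i (Y i t \<omega>) \<partial>M) \<le> pB p / (plc2 p)\<^sup>2 * (pm2 p * prho p ^ (t - s) + pm3 p * \<eta> i)"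
proof -
  have u: "bounded_rv (H s) (\<lambda>\<omega>. b i (Y i s \<omega>))" by (intro bounded_rv_b i Y_H) simp
  note v = expectation_cond_VI[OF i st b_measurable[OF i] ballI[OF b_bound[OF i]] u]
  have "AE \<omega> in M. cn (vec_cond_exp M (VI i s) (\<lambda>\<omega>'. b i (Y i t \<omega>')) \<omega>) \<le> pm2 p * prho p ^ (t - s) + pm3 p * \<eta> i"
    using mix i st unfolding mixing_def by blast
  then have "AE \<omega> in M. b i (Y i s \<omega>) \<bullet> vec_cond_exp M (VI i s) (\<lambda>\<omega>'. b i (Y i t \<omega>')) \<omega>
      \<le> pB p / (plc2 p)\<^sup>2 * (pm2 p * prho p ^ (t - s) + pm3 p * \<eta> i)"
    using AE_space
  proof eventually_elim
    case (elim \<omega>)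
    let ?w = "vec_cond_exp M (VI i s) (\<lambda>\<omega>'. b i (Y i t \<omega>')) \<omega>"
    have "norm (b i (Y i s \<omega>)) \<le> pB p / plc2 p"
      using norm_le b_bound[OF i Y_space[OF i elim(2)]] lc2 by (meson divide_right_mono less_imp_le order_trans)
    then have "norm (b i (Y i s \<omega>)) / plc2 p \<le> pB p / plc2 p / plc2 p" using lc2 by (intro divide_right_mono) auto
    then have "norm (b i (Y i s \<omega>)) / plc2 p * cn ?w \<le> pB p / plc2 p / plc2 p * (pm2 p * prho p ^ (t - s) + pm3 p * \<eta> i)"
      using elim(1) lc2 constants_nonneg by (intro mult_mono) auto
    then show ?case using inner_le_cn[of "b i (Y i s \<omega>)" ?w] by (simp add: power2_eq_square)
  qed
  then have "(\<integral>\<omega>. b i (Y i s \<omega>) \<bullet> vec_cond_exp M (VI i s) (\<lambda>\<omega>'. b i (Y i t \<omega>')) \<omega> \<partial>M)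
    \<le> (\<integral>\<omega>. pB p / (plc2 p)\<^sup>2 * (pm2 p * prho p ^ (t - s) + pm3 p * \<eta> i) \<partial>M)"
    by (intro integral_mono_AE v(1)) auto
  then show ?thesis using v(2) by (simp add: prob_space)
qed

text \<open>With \<open>r = t\<close> the independence assumption conditions on the iterates at time
  0. All agents start at the deterministic \<open>\<theta>0\<close>, so that history is trivial and
  conditional independence becomes plain independence.\<close>

lemma expectation_independent:
  fixes f g :: "'y \<Rightarrow> real"
  assumes ij: "i < N" "j < N" "i \<noteq> j"
    and f: "f \<in> borel_measurable (S i)" "\<forall>y\<in>space (S i). \<bar>f y\<bar> \<le> c"
    and g: "g \<in> borel_measurable (S j)" "\<forall>y\<in>space (S j). \<bar>g y\<bar> \<le> c"
  shows "(\<integral>\<omega>. f (Y i t \<omega>) * g (Y j t \<omega>) \<partial>M) = (\<integral>\<omega>. f (Y i t \<omega>) \<partial>M) * (\<integral>\<omega>. g (Y j t \<omega>) \<partial>M)"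
proof -
  let ?X = "\<lambda>i t \<omega>. fegsam N K \<alpha> G b \<theta>0 (\<lambda>j s. Y j s \<omega>) t i"
  let ?F = "iterate_history M N ?X 0"
  have bd: "bounded (f ` space (S i))" "bounded (g ` space (S j))"
    unfolding bounded_iff using f(2) g(2) by (auto intro!: exI[of _ c])
  have F: "subalgebra M ?F" unfolding iterate_history_def by (rule subalgebra_generated_by) auto
  have "sets ?F \<subseteq> sets (sigma (space M) {})"
    unfolding iterate_history_def by (rule sets_generated_by_le) (auto simp: space_measure_of_conv)
  then have trivial: "sets ?F \<subseteq> {{}, space M}" by (simp add: sigma_sets_empty_eq)
  have "AE \<omega> in M. real_cond_exp M (iterate_history M N ?X (t - t)) (\<lambda>\<omega>'. f (Y i t \<omega>') * g (Y j t \<omega>')) \<omega> =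
      real_cond_exp M (iterate_history M N ?X (t - t)) (\<lambda>\<omega>'. f (Y i t \<omega>')) \<omega> *
      real_cond_exp M (iterate_history M N ?X (t - t)) (\<lambda>\<omega>'. g (Y j t \<omega>')) \<omega>"
    by (rule ind[unfolded independent_noise_def, rule_format, OF ij order_refl f(1) g(1) bd])
  note ae = this[unfolded diff_self_eq_0]
  have fb: "bounded_rv M (\<lambda>\<omega>. f (Y i t \<omega>))" and gb: "bounded_rv M (\<lambda>\<omega>. g (Y j t \<omega>))"
    using f g Y_space ij
    by (auto intro!: bounded_rvI[where c=c] intro: measurable_compose[OF Y_measurable])
  from ae AE_space have "AE \<omega> in M. (\<integral>\<omega>. f (Y i t \<omega>) * g (Y j t \<omega>) \<partial>M) = (\<integral>\<omega>. f (Y i t \<omega>) \<partial>M) * (\<integral>\<omega>. g (Y j t \<omega>) \<partial>M)"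
    by eventually_elim (simp add: real_cond_exp_trivial[OF F trivial] bounded_rv_integrable fb gb bounded_rv_mult)
  then show ?thesis by simp
qed

text \<open>Expand the square over pairs of agents. Off the diagonal, independence leaves products
  of means, which recombine to the squared norm of the averaged mean and decay through
  \<open>pm4\<close>; the N diagonal terms against the factor 1 / N^2 give 1 / N.\<close>

lemma second_moment_bm:
  "(\<integral>\<omega>. (norm (bm t \<omega>))\<^sup>2 \<partial>M) \<le> (pB p / plc2 p)\<^sup>2 / real N + (pm4 p * prho p ^ t / plc2 p)\<^sup>2"
proof -
  define \<beta> where "\<beta> i = (\<integral>\<omega>. b i (Y i t \<omega>) \<partial>M)" for i
  define v where "v = agent_mean N \<beta>"
  let ?b = "\<lambda>i \<omega>. b i (Y i t \<omega>)"
  have ib: "integrable M (?b i)" if "i < N" for i by (intro bounded_rv_integrable rv_b that)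
  have v: "v = (\<integral>\<omega>. bm t \<omega> \<partial>M)"
    unfolding v_def \<beta>_def bm_def by (rule integral_agent_mean[symmetric]) (rule ib)
  \<comment> \<open>Testing \<open>bm t\<close> against its own mean turns the bound on linear
    functionals into a bound on \<open>norm v\<close>.\<close>
  have "v \<bullet> v = (\<integral>\<omega>. v \<bullet> bm t \<omega> \<partial>M)" using bounded_rv_integrable[OF rv_bm] by (simp add: v)
  also have "\<dots> \<le> (\<integral>\<omega>. norm v / plc2 p * (pm4 p * prho p ^ (t - 0)) \<partial>M)"
    by (rule expectation_bm[OF _ bounded_rv_const bounded_rv_const]) (use lc2 inner_le_cn in auto)
  also have "\<dots> = norm v * (pm4 p * prho p ^ t / plc2 p)" by (simp add: prob_space)
  finally have "norm v * norm v \<le> norm v * (pm4 p * prho p ^ t / plc2 p)"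
    by (simp add: power2_norm_eq_inner[symmetric] power2_eq_square)
  then have "norm v \<le> pm4 p * prho p ^ t / plc2 p"
  proof (cases "norm v = 0")
    case False
    then have "0 < norm v" by simp
    then show ?thesis using \<open>norm v * norm v \<le> _\<close> by (simp only: mult_le_cancel_left_pos)
  qed (use m4 rho lc2 in auto)
  then have vb: "v \<bullet> v \<le> (pm4 p * prho p ^ t / plc2 p)\<^sup>2"
    by (simp add: power2_norm_eq_inner[symmetric] power_mono)
  have bb: "(\<integral>\<omega>. ?b i \<omega> \<bullet> ?b j \<omega> \<partial>M) \<le> \<beta> i \<bullet> \<beta> j + (if i = j then (pB p / plc2 p)\<^sup>2 else 0)"
    if ij: "i < N" "j < N" for i j
  proof (cases "i = j")
    case True
    have "(\<integral>\<omega>. ?b i \<omega> \<bullet> ?b i \<omega> \<partial>M) \<le> (\<integral>\<omega>. (pB p / plc2 p)\<^sup>2 \<partial>M)"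
    proof (rule integral_mono)
      show "integrable M (\<lambda>\<omega>. ?b i \<omega> \<bullet> ?b i \<omega>)" by (intro bounded_rv_integrable bounded_rv_inner rv_b ij)
      fix \<omega> assume w: "\<omega> \<in> space M"
      have "norm (?b i \<omega>) \<le> pB p / plc2 p"
        using norm_le b_bound[OF ij(1) Y_space[OF ij(1) w]] lc2 by (meson divide_right_mono less_imp_le order_trans)
      then show "?b i \<omega> \<bullet> ?b i \<omega> \<le> (pB p / plc2 p)\<^sup>2"
        by (simp add: power2_norm_eq_inner[symmetric] power_mono)
    qed auto
    \<comment> \<open>The non-negative \<open>\<beta> i \<bullet> \<beta> i\<close> is added on the
      diagonal too, so that the double sum of products is a complete square.\<close>
    then show ?thesis using True by (simp add: prob_space add_increasing)
  next
    case False
    have comp: "\<bar>b i y $ k\<bar> \<le> pB p / plc2 p" if "i < N" "y \<in> space (S i)" for i y k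
      using component_le_norm_cart[of "b i y" k] norm_le[of "b i y"] b_bound[OF that] lc2
      by (meson divide_right_mono less_imp_le order_trans)
    have cm: "(\<lambda>y. b i y $ k) \<in> borel_measurable (S i)" if "i < N" for i k
      by (rule borel_measurable_continuous_on[OF _ b_measurable[OF that]]) (intro continuous_intros)
    have nth: "(\<integral>\<omega>. ?b i \<omega> $ k \<partial>M) = \<beta> i $ k" if "i < N" for i k
      unfolding \<beta>_def by (simp add: cart_eq_inner_axis integral_inner_left[OF ib[OF that]])
    have "(\<integral>\<omega>. ?b i \<omega> \<bullet> ?b j \<omega> \<partial>M) = (\<Sum>k\<in>UNIV. \<integral>\<omega>. ?b i \<omega> $ k * ?b j \<omega> $ k \<partial>M)"
      unfolding inner_vec_def inner_real_def
      by (intro Bochner_Integration.integral_sum bounded_rv_integrable bounded_rv_mult bounded_rv_nth rv_b ij)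
    also have "\<dots> = (\<Sum>k\<in>UNIV. \<beta> i $ k * \<beta> j $ k)"
      using expectation_independent[OF ij False cm[OF ij(1)] ballI[OF comp[OF ij(1)]] cm[OF ij(2)] ballI[OF comp[OF ij(2)]]] nth ij
      by (intro sum.cong) auto
    also have "\<dots> = \<beta> i \<bullet> \<beta> j" by (simp add: inner_vec_def)
    finally show ?thesis using False by simp
  qed
  have "(\<integral>\<omega>. (norm (bm t \<omega>))\<^sup>2 \<partial>M) = (\<integral>\<omega>. (1 / (real N)\<^sup>2) * (\<Sum>i<N. \<Sum>j<N. ?b i \<omega> \<bullet> ?b j \<omega>) \<partial>M)"
    by (simp only: power2_norm_eq_inner bm_def agent_mean_inner_self)
  also have "\<dots> = (1 / (real N)\<^sup>2) * (\<Sum>i<N. \<Sum>j<N. \<integral>\<omega>. ?b i \<omega> \<bullet> ?b j \<omega> \<partial>M)"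
  proof -
    have i: "integrable M (\<lambda>\<omega>. ?b i \<omega> \<bullet> ?b j \<omega>)" if "i < N" "j < N" for i j
      by (intro bounded_rv_integrable bounded_rv_inner rv_b that)
    have "(\<integral>\<omega>. (\<Sum>i<N. \<Sum>j<N. ?b i \<omega> \<bullet> ?b j \<omega>) \<partial>M) = (\<Sum>i<N. \<Sum>j<N. \<integral>\<omega>. ?b i \<omega> \<bullet> ?b j \<omega> \<partial>M)"
      by (subst Bochner_Integration.integral_sum)
         (auto intro!: i Bochner_Integration.integrable_sum sum.cong Bochner_Integration.integral_sum)
    then show ?thesis by simp
  qed
  also have "\<dots> \<le> (1 / (real N)\<^sup>2) * (\<Sum>i<N. \<Sum>j<N. \<beta> i \<bullet> \<beta> j + (if i = j then (pB p / plc2 p)\<^sup>2 else 0))"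
    by (intro mult_left_mono sum_mono bb) auto
  also have "\<dots> = (1 / (real N)\<^sup>2) * (\<Sum>i<N. \<Sum>j<N. \<beta> i \<bullet> \<beta> j) + (1 / (real N)\<^sup>2) * (real N * (pB p / plc2 p)\<^sup>2)"
    by (simp add: sum.distrib distrib_left)
  also have "(1 / (real N)\<^sup>2) * (\<Sum>i<N. \<Sum>j<N. \<beta> i \<bullet> \<beta> j) = v \<bullet> v"
    by (simp only: v_def agent_mean_inner_self)
  also have "(1 / (real N)\<^sup>2) * (real N * (pB p / plc2 p)\<^sup>2) = (pB p / plc2 p)\<^sup>2 / real N"
    by (simp add: power2_eq_square)
  finally show ?thesis using vb by linarith
qed

end

section \<open>Client drift\<close>

text \<open>A two-sided geometric series. Its bound is uniform in the length of the block, which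
  keeps the decaying part of the correlations linear in K - 1.\<close>

lemma sum_power_distance_le:
  fixes \<rho> :: real
  assumes \<rho>: "0 \<le> \<rho>" "\<rho> < 1" and I: "finite I"
  shows "(\<Sum>s\<in>I. if r \<le> s then \<rho> ^ (s - r) else \<rho> ^ (r - s :: nat)) \<le> 2 / (1 - \<rho>)"
proof -
  have g: "(\<Sum>k\<in>J. \<rho> ^ k) \<le> 1 / (1 - \<rho>)" if "finite J" for J
    using sum_le_suminf[of "\<lambda>k. \<rho> ^ k" J] that \<rho> by (simp add: suminf_geometric)
  have 1: "(\<Sum>s\<in>I \<inter> {s. r \<le> s}. \<rho> ^ (s - r)) = (\<Sum>k\<in>(\<lambda>s. s - r) ` (I \<inter> {s. r \<le> s}). \<rho> ^ k)"
    by (subst sum.reindex) (auto simp: inj_on_def)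
  have 2: "(\<Sum>s\<in>I \<inter> - {s. r \<le> s}. \<rho> ^ (r - s)) = (\<Sum>k\<in>(\<lambda>s. r - s) ` (I \<inter> - {s. r \<le> s}). \<rho> ^ k)"
    by (subst sum.reindex) (auto simp: inj_on_def)
  have "(\<Sum>s\<in>I. if r \<le> s then \<rho> ^ (s - r) else \<rho> ^ (r - s)) =
      (\<Sum>s\<in>I \<inter> {s. r \<le> s}. \<rho> ^ (s - r)) + (\<Sum>s\<in>I \<inter> - {s. r \<le> s}. \<rho> ^ (r - s))"
    by (rule sum.If_cases[OF I])
  also have "\<dots> \<le> 1 / (1 - \<rho>) + 1 / (1 - \<rho>)"
    unfolding 1 2 using I by (intro add_mono g) auto
  finally show ?thesis by simp
qed

text \<open>The variance is at most the second moment. The identity behind it needs an inner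
  product, which is why the b part of the client drift is measured in the Euclidean norm and not in
  \<open>cn\<close>.\<close>

lemma agent_mean_variance_le:
  "agent_mean N (\<lambda>i. (norm (f i - agent_mean N f))\<^sup>2) \<le> agent_mean N (\<lambda>i. (norm (f i :: 'a::real_inner))\<^sup>2)"
proof (cases "N = 0")
  case False
  let ?m = "agent_mean N f"
  have "agent_mean N (\<lambda>i. (norm (f i - ?m))\<^sup>2)
    = agent_mean N (\<lambda>i. (norm (f i))\<^sup>2 - 2 * (?m \<bullet> f i) + (?m \<bullet> ?m))"
    by (intro agent_mean_cong) (simp add: power2_norm_eq_inner inner_diff_left inner_diff_right inner_commute)
  also have "\<dots> = agent_mean N (\<lambda>i. (norm (f i))\<^sup>2) - 2 * (?m \<bullet> ?m) + (?m \<bullet> ?m)"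
    using False by (simp add: agent_mean_add agent_mean_diff agent_mean_mult agent_mean_const agent_mean_inner[symmetric])
  also have "\<dots> \<le> agent_mean N (\<lambda>i. (norm (f i))\<^sup>2)" using inner_ge_zero[of ?m] by linarith
  finally show ?thesis .
qed (simp add: agent_mean_def)

lemma sum_sq_le: "finite I \<Longrightarrow> real (card I) \<le> c \<Longrightarrow> (\<Sum>i\<in>I. f i)\<^sup>2 \<le> c * (\<Sum>i\<in>I. (f i :: real)\<^sup>2)"
proof -
  assume "real (card I) \<le> c"
  have "(\<Sum>i\<in>I. f i)\<^sup>2 \<le> real (card I) * (\<Sum>i\<in>I. (f i)\<^sup>2)"
    using Cauchy_Schwarz_ineq_sum[of "\<lambda>_. 1" f I] by simp
  also have "\<dots> \<le> c * (\<Sum>i\<in>I. (f i)\<^sup>2)"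
    using \<open>real (card I) \<le> c\<close> by (intro mult_right_mono sum_nonneg) auto
  finally show ?thesis .
qed

lemma sq_sum_le2: "(x + y)\<^sup>2 \<le> 2 * (x\<^sup>2 + (y::real)\<^sup>2)"
  using zero_le_power2[of "x - y"] by (simp add: power2_eq_square algebra_simps)

lemma sq_sum_le3: "(x + y + z)\<^sup>2 \<le> 3 * (x\<^sup>2 + y\<^sup>2 + (z::real)\<^sup>2)"
  using zero_le_power2[of "x - y"] zero_le_power2[of "x - z"] zero_le_power2[of "y - z"]
  by (simp add: power2_eq_square algebra_simps)

context fegsam_process
begin

definition GG :: "nat \<Rightarrow> 'w \<Rightarrow> real ^ 'd" where
  "GG t \<omega> = agent_mean N (\<lambda>i. G i (X i t \<omega>) (Y i t \<omega>))"

lemma th_0: "th 0 \<omega> = \<theta>0"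
  by (simp add: th_def X_0 agent_mean_const[OF N])

text \<open>Replacing all iterates by their mean does not change the mean, so synchronisation is
  invisible to \<open>th\<close>.\<close>

lemma th_Suc: "th (Suc t) \<omega> = th t \<omega> + \<alpha> *\<^sub>R (GG t \<omega> - th t \<omega> + bm t \<omega>)"
proof -
  let ?\<theta> = "\<lambda>i. X i t \<omega> + \<alpha> *\<^sub>R (G i (X i t \<omega>) (Y i t \<omega>) - X i t \<omega> + b i (Y i t \<omega>))"
  have "th (Suc t) \<omega> = agent_mean N ?\<theta>"
    by (cases "K dvd Suc t") (simp_all add: th_def X_Suc Let_def agent_mean_const[OF N])
  also have "\<dots> = th t \<omega> + \<alpha> *\<^sub>R (GG t \<omega> - th t \<omega> + bm t \<omega>)"
    by (simp only: agent_mean_add agent_mean_diff agent_mean_scaleR th_def GG_def bm_def)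
  finally show ?thesis .
qed

lemma X_sync: "K dvd Suc t \<Longrightarrow> i < N \<Longrightarrow> X i (Suc t) \<omega> = th (Suc t) \<omega>"
  by (simp add: th_def X_Suc Let_def agent_mean_const[OF N])

lemma cn_convex_step: "cn ((1 - \<alpha>) *\<^sub>R x + \<alpha> *\<^sub>R y) \<le> (1 - \<alpha>) * cn x + \<alpha> * cn y"
  using is_norm_triangle[OF cn, of "(1 - \<alpha>) *\<^sub>R x" "\<alpha> *\<^sub>R y"] \<alpha> by (simp add: is_norm_scale[OF cn])

text \<open>A crude pathwise bound, exponential in \<open>t\<close>. It serves for the initial
  stretch of \<open>tau\<close> steps, where the exponential is at most 2.\<close>

lemma X_growth:
  assumes w: "\<omega> \<in> space M"
  shows "i < N \<Longrightarrow> cn (X i t \<omega>) \<le> (1 + \<alpha> * pA2 p) ^ t * (cn \<theta>0 + \<alpha> * real t * pB p)"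
proof (induction t arbitrary: i)
  case 0
  then show ?case by (simp add: X_0)
next
  case (Suc t)
  let ?R = "(1 + \<alpha> * pA2 p) ^ t * (cn \<theta>0 + \<alpha> * real t * pB p)"
  let ?S = "(1 + \<alpha> * pA2 p) ^ Suc t * (cn \<theta>0 + \<alpha> * real (Suc t) * pB p)"
  have p1: "1 \<le> (1 + \<alpha> * pA2 p) ^ Suc t" using \<alpha> constants_nonneg by (intro one_le_power) auto
  have step: "cn (X j t \<omega> + \<alpha> *\<^sub>R (G j (X j t \<omega>) (Y j t \<omega>) - X j t \<omega> + b j (Y j t \<omega>))) \<le> ?S" if j: "j < N" for j
  proof -
    let ?x = "X j t \<omega>" and ?g = "G j (X j t \<omega>) (Y j t \<omega>)" and ?b = "b j (Y j t \<omega>)"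
    have "?x + \<alpha> *\<^sub>R (?g - ?x + ?b) = (1 - \<alpha>) *\<^sub>R ?x + \<alpha> *\<^sub>R (?g + ?b)"
      by (simp add: algebra_simps)
    then have "cn (?x + \<alpha> *\<^sub>R (?g - ?x + ?b)) \<le> (1 - \<alpha>) * cn ?x + \<alpha> * cn (?g + ?b)"
      using cn_convex_step[of ?x "?g + ?b"] by simp
    also have "\<dots> \<le> 1 * cn ?x + \<alpha> * (pA2 p * cn ?x + pB p)"
      using \<alpha> is_norm_triangle[OF cn, of ?g ?b] G_bound[OF j Y_space[OF j w]] b_bound[OF j Y_space[OF j w]]
      by (intro add_mono mult_mono) (auto intro!: order_trans[OF is_norm_triangle[OF cn]] add_mono)
    also have "\<dots> = (1 + \<alpha> * pA2 p) * cn ?x + \<alpha> * pB p * 1" by (simp add: algebra_simps)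
    also have "\<dots> \<le> (1 + \<alpha> * pA2 p) * ?R + \<alpha> * pB p * (1 + \<alpha> * pA2 p) ^ Suc t"
      using \<alpha> constants_nonneg p1 Suc.IH[OF j] by (intro add_mono mult_left_mono) auto
    also have "\<dots> = ?S" by (simp add: algebra_simps)
    finally show ?thesis .
  qed
  show ?case
  proof (cases "K dvd Suc t")
    case True
    have "cn (X i (Suc t) \<omega>) \<le> agent_mean N (\<lambda>j. cn (X j t \<omega> + \<alpha> *\<^sub>R (G j (X j t \<omega>) (Y j t \<omega>) - X j t \<omega> + b j (Y j t \<omega>))))"
      using True by (simp add: X_Suc Let_def is_norm_agent_mean[OF cn])
    also have "\<dots> \<le> ?S" by (rule agent_mean_le[OF N step])
    finally show ?thesis .
  next
    case False
    then show ?thesis using step[OF Suc.prems] by (simp add: X_Suc Let_def)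
  qed
qed

text \<open>\<open>Rb\<close> is the part of the client drift caused by \<open>b\<close>, \<open>PP\<close> the part caused by \<open>G\<close>.\<close>

primrec Rb :: "nat \<Rightarrow> nat \<Rightarrow> 'w \<Rightarrow> real ^ 'd" where
  "Rb i 0 = (\<lambda>\<omega>. 0)"
| "Rb i (Suc t) = (\<lambda>\<omega>. if K dvd Suc t then 0 else (1 - \<alpha>) *\<^sub>R Rb i t \<omega> + \<alpha> *\<^sub>R b i (Y i t \<omega>))"

definition PP :: "nat \<Rightarrow> nat \<Rightarrow> 'w \<Rightarrow> real ^ 'd" where
  "PP i t \<omega> = X i t \<omega> - th t \<omega> - (Rb i t \<omega> - agent_mean N (\<lambda>j. Rb j t \<omega>))"

definition dev :: "nat \<Rightarrow> 'w \<Rightarrow> real" where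
  "dev t \<omega> = agent_mean N (\<lambda>i. (cn (X i t \<omega> - th t \<omega>))\<^sup>2)"

lemma dev_nonneg: "0 \<le> dev t \<omega>"
  unfolding dev_def by (intro agent_mean_nonneg) auto

lemma PP_0: "i < N \<Longrightarrow> PP i 0 \<omega> = 0"
  by (simp add: PP_def X_0 th_0 agent_mean_const[OF N])

text \<open>Between synchronisations the deviation from the mean and the centred \<open>Rb\<close>
  are both damped by \<open>1 - \<alpha>\<close> and receive the same centred b, so their difference
  is driven by the centred \<open>G\<close> alone. Both vanish at a synchronisation.\<close>

lemma PP_Suc:
  assumes i: "i < N"
  shows "PP i (Suc t) \<omega> = (if K dvd Suc t then 0 else (1 - \<alpha>) *\<^sub>R PP i t \<omega> + \<alpha> *\<^sub>R (G i (X i t \<omega>) (Y i t \<omega>) - GG t \<omega>))"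
proof (cases "K dvd Suc t")
  case True
  then show ?thesis using X_sync[OF True i] by (simp add: PP_def agent_mean_const[OF N])
next
  case False
  have "agent_mean N (\<lambda>j. Rb j (Suc t) \<omega>) = (1 - \<alpha>) *\<^sub>R agent_mean N (\<lambda>j. Rb j t \<omega>) + \<alpha> *\<^sub>R bm t \<omega>"
    using False by (simp add: agent_mean_add agent_mean_scaleR bm_def)
  then show ?thesis using False
    by (simp add: PP_def th_Suc X_Suc Let_def algebra_simps)
qed

text \<open>\<open>t mod K\<close> counts the steps since the last synchronisation, so the interval
  is the current block; a step without synchronisation only adds its new right end.\<close>

lemma block_Suc:
  assumes "\<not> K dvd Suc t"
  shows "{Suc t - Suc t mod K..<Suc t} = insert t {t - t mod K..<t}"
proof -
  have "Suc t mod K = Suc (t mod K)" using assms by (auto simp: mod_Suc dvd_eq_mod_eq_0)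
  then show ?thesis by (auto simp: mod_less_eq_dividend)
qed

lemma PP_bound:
  assumes i: "i < N"
  shows "cn (PP i t \<omega>) \<le> \<alpha> * (\<Sum>r\<in>{t - t mod K..<t}. cn (G i (X i r \<omega>) (Y i r \<omega>) - GG r \<omega>))"
proof (induction t)
  case 0
  then show ?case by (simp add: PP_0[OF i] is_norm_zero[OF cn])
next
  case (Suc t)
  show ?case
  proof (cases "K dvd Suc t")
    case True
    then show ?thesis using \<alpha> by (auto simp: PP_Suc[OF i] is_norm_zero[OF cn] intro!: mult_nonneg_nonneg sum_nonneg)
  next
    case False
    have "cn (PP i (Suc t) \<omega>) \<le> (1 - \<alpha>) * cn (PP i t \<omega>) + \<alpha> * cn (G i (X i t \<omega>) (Y i t \<omega>) - GG t \<omega>)"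
      using False cn_convex_step by (simp add: PP_Suc[OF i])
    also have "\<dots> \<le> 1 * cn (PP i t \<omega>) + \<alpha> * cn (G i (X i t \<omega>) (Y i t \<omega>) - GG t \<omega>)"
      using \<alpha> by (intro add_mono mult_right_mono) auto
    also have "\<dots> \<le> \<alpha> * (\<Sum>r\<in>{Suc t - Suc t mod K..<Suc t}. cn (G i (X i r \<omega>) (Y i r \<omega>) - GG r \<omega>))"
      using Suc.IH unfolding block_Suc[OF False] by (simp add: algebra_simps)
    finally show ?thesis .
  qed
qed

lemma Rb_eq: "Rb i t \<omega> = (\<Sum>r\<in>{t - t mod K..<t}. (\<alpha> * (1 - \<alpha>) ^ (t - Suc r)) *\<^sub>R b i (Y i r \<omega>))"
proof (induction t)
  case (Suc t)
  show ?case
  proof (cases "K dvd Suc t")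
    case False
    have "(\<Sum>r\<in>{t - t mod K..<t}. (\<alpha> * (1 - \<alpha>) ^ (Suc t - Suc r)) *\<^sub>R b i (Y i r \<omega>)) = (1 - \<alpha>) *\<^sub>R Rb i t \<omega>"
      unfolding Suc scaleR_sum_right
    proof (rule sum.cong[OF refl])
      fix r assume "r \<in> {t - t mod K..<t}"
      then have "Suc t - Suc r = Suc (t - Suc r)" by auto
      then show "(\<alpha> * (1 - \<alpha>) ^ (Suc t - Suc r)) *\<^sub>R b i (Y i r \<omega>) = (1 - \<alpha>) *\<^sub>R (\<alpha> * (1 - \<alpha>) ^ (t - Suc r)) *\<^sub>R b i (Y i r \<omega>)"
        by simp
    qed
    then show ?thesis using False unfolding block_Suc[OF False] by simp
  qed auto
qed simp

text \<open>Blocks restart empty at a synchronisation, hence K - 1 and not K; for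
  \<open>K = 1\<close> the client drift is 0.\<close>

lemma card_block: "real (card {t - t mod K..<t}) \<le> real K - 1"
proof -
  have "t mod K < K" using K by simp
  then have "real (t mod K) \<le> real K - 1" by linarith
  then show ?thesis by simp
qed

lemma rv_Rb: "i < N \<Longrightarrow> bounded_rv M (Rb i t)"
  unfolding Rb_eq[abs_def] by (intro bounded_rv_sum bounded_rv_scaleR bounded_rv_const rv_b)

text \<open>Expanding the square gives at most (K - 1)^2 correlations inside the block. Their
  decaying part sums to a constant in each row, contributing K - 1, whereas the floor
  \<open>pm3 p * \<eta> i\<close> is paid once for each pair.\<close>

lemma second_moment_Rb:
  assumes i: "i < N"
  shows "(\<integral>\<omega>. (norm (Rb i t \<omega>))\<^sup>2 \<partial>M) \<le> \<alpha>\<^sup>2 * (pB p / (plc2 p)\<^sup>2) *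
    (2 * pm2 p / (1 - prho p) * (real K - 1) + pm3 p * \<eta> i * (real K - 1)\<^sup>2)"
proof -
  let ?I = "{t - t mod K..<t}" and ?C = "pB p / (plc2 p)\<^sup>2" and ?b = "\<lambda>r \<omega>. b i (Y i r \<omega>)"
  define w where "w r = \<alpha> * (1 - \<alpha>) ^ (t - Suc r)" for r
  \<comment> \<open>A bound for the correlations, symmetric in the two times and non-negative, so
    that the weights may afterwards be replaced by their upper bound
    \<open>\<alpha>\<close>.\<close>
  define q where "q r s = ?C * (pm2 p * (if r \<le> s then prho p ^ (s - r) else prho p ^ (r - s)) + pm3 p * \<eta> i)" for r s
  have w: "0 \<le> w r" "w r \<le> \<alpha>" for r
    using \<alpha> power_le_one[of "1 - \<alpha>" "t - Suc r"] by (auto simp: w_def mult_le_cancel_left1)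
  have C0: "0 \<le> ?C" using constants_nonneg by simp
  have q0: "0 \<le> q r s" for r s
    unfolding q_def using C0 m2 m3 rho eta[of i] by (intro mult_nonneg_nonneg add_nonneg_nonneg) auto
  have int: "integrable M (\<lambda>\<omega>. ?b r \<omega> \<bullet> ?b s \<omega>)" for r s
    by (intro bounded_rv_integrable bounded_rv_inner rv_b i)
  have bq: "(\<integral>\<omega>. ?b r \<omega> \<bullet> ?b s \<omega> \<partial>M) \<le> q r s" for r s
  proof (cases "r \<le> s")
    case True
    then show ?thesis using expectation_bb[OF i True] by (simp add: q_def)
  next
    case False
    then show ?thesis using expectation_bb[OF i, of s r] by (simp add: q_def inner_commute)
  qed
  have e1: "(norm (Rb i t \<omega>))\<^sup>2 = (\<Sum>r\<in>?I. \<Sum>s\<in>?I. (w r * w s) * (?b r \<omega> \<bullet> ?b s \<omega>))" for \<omega>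
  proof -
    have "(norm (Rb i t \<omega>))\<^sup>2 = (\<Sum>r\<in>?I. w r *\<^sub>R ?b r \<omega>) \<bullet> (\<Sum>r\<in>?I. w r *\<^sub>R ?b r \<omega>)"
      unfolding power2_norm_eq_inner Rb_eq w_def ..
    also have "\<dots> = (\<Sum>r\<in>?I. \<Sum>s\<in>?I. (w r *\<^sub>R ?b r \<omega>) \<bullet> (w s *\<^sub>R ?b s \<omega>))"
      by (simp only: inner_sum_left) (simp only: inner_sum_right)
    finally show ?thesis by (simp only: inner_scaleR_left inner_scaleR_right mult_ac)
  qed
  have "(\<integral>\<omega>. (norm (Rb i t \<omega>))\<^sup>2 \<partial>M) = (\<Sum>r\<in>?I. \<Sum>s\<in>?I. (w r * w s) * (\<integral>\<omega>. ?b r \<omega> \<bullet> ?b s \<omega> \<partial>M))"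
    unfolding e1 using int
    by (subst Bochner_Integration.integral_sum)
       (auto intro!: Bochner_Integration.integrable_sum sum.cong simp: Bochner_Integration.integral_sum)
  also have "\<dots> \<le> (\<Sum>r\<in>?I. \<Sum>s\<in>?I. \<alpha>\<^sup>2 * q r s)"
  proof (intro sum_mono)
    fix r s
    have "(w r * w s) * (\<integral>\<omega>. ?b r \<omega> \<bullet> ?b s \<omega> \<partial>M) \<le> (w r * w s) * q r s" using w bq by (intro mult_left_mono) auto
    also have "\<dots> \<le> \<alpha>\<^sup>2 * q r s" using w q0 \<alpha> by (intro mult_right_mono) (auto simp: power2_eq_square intro: mult_mono)
    finally show "(w r * w s) * (\<integral>\<omega>. ?b r \<omega> \<bullet> ?b s \<omega> \<partial>M) \<le> \<alpha>\<^sup>2 * q r s" .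
  qed
  also have "\<dots> = (\<Sum>r\<in>?I. \<alpha>\<^sup>2 * ?C * (pm2 p * (\<Sum>s\<in>?I. if r \<le> s then prho p ^ (s - r) else prho p ^ (r - s)) + real (card ?I) * (pm3 p * \<eta> i)))"
    by (simp add: q_def sum_distrib_left sum.distrib distrib_left mult.assoc del: card_atLeastLessThan)
  also have "\<dots> \<le> (\<Sum>r\<in>?I. \<alpha>\<^sup>2 * ?C * (pm2 p * (2 / (1 - prho p)) + (real K - 1) * (pm3 p * \<eta> i)))"
    using m2 m3 eta[of i] constants_nonneg card_block[of t]
    by (intro sum_mono mult_left_mono add_mono mult_right_mono sum_power_distance_le rho) auto
  also have "\<dots> = real (card ?I) * (\<alpha>\<^sup>2 * ?C * (pm2 p * (2 / (1 - prho p)) + (real K - 1) * (pm3 p * \<eta> i)))"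
    by (simp del: card_atLeastLessThan)
  also have "\<dots> \<le> (real K - 1) * (\<alpha>\<^sup>2 * ?C * (pm2 p * (2 / (1 - prho p)) + (real K - 1) * (pm3 p * \<eta> i)))"
    using m2 m3 eta[of i] C0 rho K
    by (intro mult_right_mono card_block mult_nonneg_nonneg add_nonneg_nonneg) auto
  also have "\<dots> = \<alpha>\<^sup>2 * ?C * (2 * pm2 p / (1 - prho p) * (real K - 1) + pm3 p * \<eta> i * (real K - 1)\<^sup>2)"
    by (simp only: power2_eq_square divide_inverse distrib_left distrib_right mult_ac)
  finally show ?thesis .
qed

lemma mean_sq_X: "agent_mean N (\<lambda>i. (cn (X i t \<omega>))\<^sup>2) \<le> 2 * ((cn (th t \<omega>))\<^sup>2 + dev t \<omega>)"
proof -
  have "agent_mean N (\<lambda>i. (cn (X i t \<omega>))\<^sup>2) \<le> agent_mean N (\<lambda>i. 2 * ((cn (th t \<omega>))\<^sup>2 + (cn (X i t \<omega> - th t \<omega>))\<^sup>2))"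
  proof (rule agent_mean_mono)
    fix i
    have "cn (X i t \<omega>) \<le> cn (th t \<omega>) + cn (X i t \<omega> - th t \<omega>)"
      using is_norm_triangle[OF cn, of "th t \<omega>" "X i t \<omega> - th t \<omega>"] by simp
    then have "(cn (X i t \<omega>))\<^sup>2 \<le> (cn (th t \<omega>) + cn (X i t \<omega> - th t \<omega>))\<^sup>2" by (intro power_mono) auto
    also have "\<dots> \<le> 2 * ((cn (th t \<omega>))\<^sup>2 + (cn (X i t \<omega> - th t \<omega>))\<^sup>2)" by (rule sq_sum_le2)
    finally show "(cn (X i t \<omega>))\<^sup>2 \<le> 2 * ((cn (th t \<omega>))\<^sup>2 + (cn (X i t \<omega> - th t \<omega>))\<^sup>2)" .
  qed
  then show ?thesis by (simp add: agent_mean_mult agent_mean_add agent_mean_const[OF N] dev_def)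
qed

text \<open>The 8 is 2 * 2 * 2: from splitting the difference, from bounding the square of
  \<open>GG\<close> by the mean square of its summands, and from splitting each iterate into mean
  and deviation.\<close>

lemma mean_sq_G_diff:
  assumes w: "\<omega> \<in> space M"
  shows "agent_mean N (\<lambda>i. (cn (G i (X i t \<omega>) (Y i t \<omega>) - GG t \<omega>))\<^sup>2) \<le> 8 * (pA2 p)\<^sup>2 * ((cn (th t \<omega>))\<^sup>2 + dev t \<omega>)"
proof -
  let ?g = "\<lambda>i. G i (X i t \<omega>) (Y i t \<omega>)"
  have gb: "agent_mean N (\<lambda>i. (cn (?g i))\<^sup>2) \<le> (pA2 p)\<^sup>2 * agent_mean N (\<lambda>i. (cn (X i t \<omega>))\<^sup>2)"
    unfolding agent_mean_mult[symmetric] power_mult_distrib[symmetric]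
    by (intro agent_mean_mono power_mono G_bound Y_space w) auto
  have "cn (GG t \<omega>) \<le> agent_mean N (\<lambda>i. cn (?g i))" unfolding GG_def by (rule is_norm_agent_mean[OF cn])
  then have "(cn (GG t \<omega>))\<^sup>2 \<le> (agent_mean N (\<lambda>i. cn (?g i)))\<^sup>2" by (intro power_mono) auto
  also have "\<dots> \<le> agent_mean N (\<lambda>i. (cn (?g i))\<^sup>2)" by (rule agent_mean_sq_le)
  finally have G2: "(cn (GG t \<omega>))\<^sup>2 \<le> agent_mean N (\<lambda>i. (cn (?g i))\<^sup>2)" .
  have "agent_mean N (\<lambda>i. (cn (?g i - GG t \<omega>))\<^sup>2) \<le> agent_mean N (\<lambda>i. 2 * ((cn (?g i))\<^sup>2 + (cn (GG t \<omega>))\<^sup>2))"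
  proof (rule agent_mean_mono)
    fix i
    have "(cn (?g i - GG t \<omega>))\<^sup>2 \<le> (cn (?g i) + cn (GG t \<omega>))\<^sup>2" by (intro power_mono is_norm_diff[OF cn]) auto
    also have "\<dots> \<le> 2 * ((cn (?g i))\<^sup>2 + (cn (GG t \<omega>))\<^sup>2)" by (rule sq_sum_le2)
    finally show "(cn (?g i - GG t \<omega>))\<^sup>2 \<le> 2 * ((cn (?g i))\<^sup>2 + (cn (GG t \<omega>))\<^sup>2)" .
  qed
  also have "\<dots> = 2 * (agent_mean N (\<lambda>i. (cn (?g i))\<^sup>2) + (cn (GG t \<omega>))\<^sup>2)"
    by (simp add: agent_mean_mult agent_mean_add agent_mean_const[OF N])
  also have "\<dots> \<le> 4 * ((pA2 p)\<^sup>2 * agent_mean N (\<lambda>i. (cn (X i t \<omega>))\<^sup>2))" 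
  proof -
    have "2 * (x + g) \<le> 4 * P" if "g \<le> x" "x \<le> P" for x g P :: real using that by simp
    from this[OF G2 gb] show ?thesis .
  qed
  also have "\<dots> \<le> 4 * ((pA2 p)\<^sup>2 * (2 * ((cn (th t \<omega>))\<^sup>2 + dev t \<omega>)))"
    by (intro mult_left_mono mean_sq_X) auto
  also have "\<dots> = 8 * (pA2 p)\<^sup>2 * ((cn (th t \<omega>))\<^sup>2 + dev t \<omega>)" by (simp add: algebra_simps)
  finally show ?thesis .
qed

text \<open>The two parts of the drift are treated differently: Cauchy-Schwarz over the block for
  \<open>PP\<close>, and for \<open>Rb\<close> a passage to the Euclidean norm, where the variance
  inequality removes the centring.\<close>

lemma dev_bound:
  assumes w: "\<omega> \<in> space M"
  shows "dev t \<omega> \<le> 16 * \<alpha>\<^sup>2 * (real K - 1) * (pA2 p)\<^sup>2 * (\<Sum>r\<in>{t - t mod K..<t}. (cn (th r \<omega>))\<^sup>2 + dev r \<omega>)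
    + 2 * (puc2 p)\<^sup>2 * agent_mean N (\<lambda>i. (norm (Rb i t \<omega>))\<^sup>2)"
proof -
  let ?I = "{t - t mod K..<t}" and ?mR = "agent_mean N (\<lambda>j. Rb j t \<omega>)"
  let ?v = "\<lambda>i r. cn (G i (X i r \<omega>) (Y i r \<omega>) - GG r \<omega>)"
  have K1: "0 \<le> real K - 1" using K by simp
  have "dev t \<omega> \<le> agent_mean N (\<lambda>i. 2 * (\<alpha>\<^sup>2 * ((real K - 1) * (\<Sum>r\<in>?I. (?v i r)\<^sup>2)) + (puc2 p)\<^sup>2 * (norm (Rb i t \<omega> - ?mR))\<^sup>2))"
    unfolding dev_def
  proof (rule agent_mean_mono)
    fix i assume i: "i < N"
    have "cn (X i t \<omega> - th t \<omega>) \<le> cn (PP i t \<omega>) + cn (Rb i t \<omega> - ?mR)"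
      using is_norm_triangle[OF cn, of "PP i t \<omega>" "Rb i t \<omega> - ?mR"] by (simp add: PP_def)
    also have "\<dots> \<le> \<alpha> * (\<Sum>r\<in>?I. ?v i r) + puc2 p * norm (Rb i t \<omega> - ?mR)"
      by (intro add_mono PP_bound i cn_le_norm)
    finally have "(cn (X i t \<omega> - th t \<omega>))\<^sup>2 \<le> (\<alpha> * (\<Sum>r\<in>?I. ?v i r) + puc2 p * norm (Rb i t \<omega> - ?mR))\<^sup>2"
      by (intro power_mono) auto
    also have "\<dots> \<le> 2 * (\<alpha>\<^sup>2 * (\<Sum>r\<in>?I. ?v i r)\<^sup>2 + (puc2 p)\<^sup>2 * (norm (Rb i t \<omega> - ?mR))\<^sup>2)"
      using sq_sum_le2[of "\<alpha> * (\<Sum>r\<in>?I. ?v i r)" "puc2 p * norm (Rb i t \<omega> - ?mR)"] by (simp add: power_mult_distrib)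
    also have "\<dots> \<le> 2 * (\<alpha>\<^sup>2 * ((real K - 1) * (\<Sum>r\<in>?I. (?v i r)\<^sup>2)) + (puc2 p)\<^sup>2 * (norm (Rb i t \<omega> - ?mR))\<^sup>2)"
      by (intro mult_left_mono add_right_mono sum_sq_le card_block) auto
    finally show "(cn (X i t \<omega> - th t \<omega>))\<^sup>2 \<le> 2 * (\<alpha>\<^sup>2 * ((real K - 1) * (\<Sum>r\<in>?I. (?v i r)\<^sup>2)) + (puc2 p)\<^sup>2 * (norm (Rb i t \<omega> - ?mR))\<^sup>2)" .
  qed
  also have "\<dots> = 2 * (\<alpha>\<^sup>2 * ((real K - 1) * (\<Sum>r\<in>?I. agent_mean N (\<lambda>i. (?v i r)\<^sup>2))) + (puc2 p)\<^sup>2 * agent_mean N (\<lambda>i. (norm (Rb i t \<omega> - ?mR))\<^sup>2))"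
    by (simp only: agent_mean_mult agent_mean_add agent_mean_sum)
  also have "\<dots> \<le> 2 * (\<alpha>\<^sup>2 * ((real K - 1) * (\<Sum>r\<in>?I. 8 * (pA2 p)\<^sup>2 * ((cn (th r \<omega>))\<^sup>2 + dev r \<omega>))) + (puc2 p)\<^sup>2 * agent_mean N (\<lambda>i. (norm (Rb i t \<omega>))\<^sup>2))"
    using K1 by (intro mult_left_mono add_mono sum_mono mean_sq_G_diff w agent_mean_variance_le) auto
  also have "\<dots> = 16 * \<alpha>\<^sup>2 * (real K - 1) * (pA2 p)\<^sup>2 * (\<Sum>r\<in>?I. (cn (th r \<omega>))\<^sup>2 + dev r \<omega>)
    + 2 * (puc2 p)\<^sup>2 * agent_mean N (\<lambda>i. (norm (Rb i t \<omega>))\<^sup>2)"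
    unfolding sum_distrib_left[symmetric] by (simp add: algebra_simps)
  finally show ?thesis .
qed

lemma rv_dev: "bounded_rv M (dev t)"
  unfolding dev_def[abs_def] by (intro bounded_rv_agent_mean bounded_rv_power bounded_rv_cn bounded_rv_diff rv_X rv_th)

section \<open>Expected squares of mean iterate, client deviation and noise\<close>

definition Ea :: "nat \<Rightarrow> real" where "Ea t = (\<integral>\<omega>. (cn (th t \<omega>))\<^sup>2 \<partial>M)"
definition Ed :: "nat \<Rightarrow> real" where "Ed t = (\<integral>\<omega>. dev t \<omega> \<partial>M)"
definition Eb :: "nat \<Rightarrow> real" where "Eb t = (\<integral>\<omega>. (cn (bm t \<omega>))\<^sup>2 \<partial>M)"

lemma E_nonneg: "0 \<le> Ea t" "0 \<le> Ed t" "0 \<le> Eb t"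
  unfolding Ea_def Ed_def Eb_def by (auto simp: dev_nonneg intro: Bochner_Integration.integral_nonneg)

lemma int_a: "integrable M (\<lambda>\<omega>. (cn (th t \<omega>))\<^sup>2)"
  and int_d: "integrable M (dev t)"
  and int_b: "integrable M (\<lambda>\<omega>. (cn (bm t \<omega>))\<^sup>2)"
  by (intro bounded_rv_integrable bounded_rv_power bounded_rv_cn rv_th rv_bm rv_dev)+

text \<open>The block is enlarged to a window of the last K - 1 times, whose shape does not depend
  on \<open>t mod K\<close>, as required by \<open>weighted_window_sum\<close>. The bound is
  implicit, since \<open>Ed\<close> recurs on the right; it is resolved after summation.\<close>

lemma Ed_bound:
  "Ed t \<le> 16 * \<alpha>\<^sup>2 * (real K - 1) * (pA2 p)\<^sup>2 * (\<Sum>r\<in>{t - (K - 1)..<t}. Ea r + Ed r)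
    + 2 * (puc2 p)\<^sup>2 * (\<alpha>\<^sup>2 * (pB p / (plc2 p)\<^sup>2) *
    (2 * pm2 p / (1 - prho p) * (real K - 1) + pm3 p * ((1 / real N) * (\<Sum>i<N. \<eta> i)) * (real K - 1)\<^sup>2))"
proof -
  let ?I = "{t - t mod K..<t}" and ?c = "16 * \<alpha>\<^sup>2 * (real K - 1) * (pA2 p)\<^sup>2"
  let ?C = "\<alpha>\<^sup>2 * (pB p / (plc2 p)\<^sup>2)"
  have iR: "integrable M (\<lambda>\<omega>. (norm (Rb i t \<omega>))\<^sup>2)" if "i < N" for i
    unfolding power2_norm_eq_inner by (intro bounded_rv_integrable bounded_rv_inner rv_Rb that)
  have iS: "integrable M (\<lambda>\<omega>. \<Sum>r\<in>?I. (cn (th r \<omega>))\<^sup>2 + dev r \<omega>)"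
    by (intro Bochner_Integration.integrable_sum Bochner_Integration.integrable_add int_a int_d)
  have iM: "integrable M (\<lambda>\<omega>. agent_mean N (\<lambda>i. (norm (Rb i t \<omega>))\<^sup>2))"
    unfolding agent_mean_def by (intro integrable_scaleR_right Bochner_Integration.integrable_sum iR) auto
  have c0: "0 \<le> ?c" using K by auto
  have "Ed t \<le> (\<integral>\<omega>. ?c * (\<Sum>r\<in>?I. (cn (th r \<omega>))\<^sup>2 + dev r \<omega>)
    + 2 * (puc2 p)\<^sup>2 * agent_mean N (\<lambda>i. (norm (Rb i t \<omega>))\<^sup>2) \<partial>M)"
    unfolding Ed_def
    by (intro integral_mono int_d Bochner_Integration.integrable_add integrable_mult_right iS iM dev_bound)
  also have "\<dots> = ?c * (\<integral>\<omega>. (\<Sum>r\<in>?I. (cn (th r \<omega>))\<^sup>2 + dev r \<omega>) \<partial>M)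
    + 2 * (puc2 p)\<^sup>2 * (\<integral>\<omega>. agent_mean N (\<lambda>i. (norm (Rb i t \<omega>))\<^sup>2) \<partial>M)"
    using iS iM by (subst Bochner_Integration.integral_add) auto
  also have "(\<integral>\<omega>. (\<Sum>r\<in>?I. (cn (th r \<omega>))\<^sup>2 + dev r \<omega>) \<partial>M) = (\<Sum>r\<in>?I. Ea r + Ed r)"
    by (subst Bochner_Integration.integral_sum) (auto simp: Ea_def Ed_def int_a int_d)
  also have "(\<integral>\<omega>. agent_mean N (\<lambda>i. (norm (Rb i t \<omega>))\<^sup>2) \<partial>M) = agent_mean N (\<lambda>i. \<integral>\<omega>. (norm (Rb i t \<omega>))\<^sup>2 \<partial>M)"
    by (rule integral_agent_mean) (rule iR)
  also have "?c * (\<Sum>r\<in>?I. Ea r + Ed r) + 2 * (puc2 p)\<^sup>2 * agent_mean N (\<lambda>i. \<integral>\<omega>. (norm (Rb i t \<omega>))\<^sup>2 \<partial>M)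
    \<le> ?c * (\<Sum>r\<in>{t - (K - 1)..<t}. Ea r + Ed r) + 2 * (puc2 p)\<^sup>2 * agent_mean N (\<lambda>i. ?C *
    (2 * pm2 p / (1 - prho p) * (real K - 1) + pm3 p * \<eta> i * (real K - 1)\<^sup>2))"
  proof (intro add_mono mult_left_mono c0 agent_mean_mono second_moment_Rb sum_mono2)
    have "t mod K \<le> K - 1" using K by (metis Suc_pred' less_Suc_eq_le less_le_trans mod_less_divisor zero_less_one)
    then show "?I \<subseteq> {t - (K - 1)..<t}" by auto
  qed (auto simp: E_nonneg)
  also have "agent_mean N (\<lambda>i. ?C * (2 * pm2 p / (1 - prho p) * (real K - 1) + pm3 p * \<eta> i * (real K - 1)\<^sup>2))
    = ?C * (2 * pm2 p / (1 - prho p) * (real K - 1) + pm3 p * ((1 / real N) * (\<Sum>i<N. \<eta> i)) * (real K - 1)\<^sup>2)"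
  proof -
    have "agent_mean N (\<lambda>i. (pm3 p * (real K - 1)\<^sup>2) * \<eta> i) = (pm3 p * (real K - 1)\<^sup>2) * agent_mean N \<eta>"
      by (rule agent_mean_mult)
    then have "agent_mean N (\<lambda>i. pm3 p * \<eta> i * (real K - 1)\<^sup>2) = pm3 p * agent_mean N \<eta> * (real K - 1)\<^sup>2"
      by (simp add: algebra_simps)
    then show ?thesis by (simp only: agent_mean_mult agent_mean_add agent_mean_const[OF N]) (simp add: agent_mean_def)
  qed
  finally show ?thesis .
qed

lemma Eb_bound: "Eb t \<le> (puc2 p)\<^sup>2 * ((pB p / plc2 p)\<^sup>2 / real N + (pm4 p * prho p ^ t / plc2 p)\<^sup>2)"
proof -
  have "Eb t \<le> (\<integral>\<omega>. (puc2 p)\<^sup>2 * (norm (bm t \<omega>))\<^sup>2 \<partial>M)"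
    unfolding Eb_def
  proof (intro integral_mono int_b integrable_mult_right)
    show "integrable M (\<lambda>\<omega>. (norm (bm t \<omega>))\<^sup>2)"
      unfolding power2_norm_eq_inner by (intro bounded_rv_integrable bounded_rv_inner rv_bm)
    fix \<omega>
    have "(cn (bm t \<omega>))\<^sup>2 \<le> (puc2 p * norm (bm t \<omega>))\<^sup>2" by (intro power_mono cn_le_norm) auto
    then show "(cn (bm t \<omega>))\<^sup>2 \<le> (puc2 p)\<^sup>2 * (norm (bm t \<omega>))\<^sup>2" by (simp add: power_mult_distrib)
  qed
  also have "\<dots> \<le> (puc2 p)\<^sup>2 * ((pB p / plc2 p)\<^sup>2 / real N + (pm4 p * prho p ^ t / plc2 p)\<^sup>2)"
    using second_moment_bm[of t] by (simp add: mult_left_mono)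
  finally show ?thesis .
qed

lemma Ea_growth:
  "Ea t \<le> ((1 + \<alpha> * pA2 p) ^ t * (cn \<theta>0 + \<alpha> * real t * pB p))\<^sup>2"
proof -
  have "Ea t \<le> (\<integral>\<omega>. ((1 + \<alpha> * pA2 p) ^ t * (cn \<theta>0 + \<alpha> * real t * pB p))\<^sup>2 \<partial>M)"
    unfolding Ea_def
  proof (intro integral_mono int_a)
    fix \<omega> assume w: "\<omega> \<in> space M"
    have "cn (th t \<omega>) \<le> agent_mean N (\<lambda>i. cn (X i t \<omega>))" unfolding th_def by (rule is_norm_agent_mean[OF cn])
    also have "\<dots> \<le> (1 + \<alpha> * pA2 p) ^ t * (cn \<theta>0 + \<alpha> * real t * pB p)"
      by (rule agent_mean_le[OF N X_growth[OF w]])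
    finally show "(cn (th t \<omega>))\<^sup>2 \<le> ((1 + \<alpha> * pA2 p) ^ t * (cn \<theta>0 + \<alpha> * real t * pB p))\<^sup>2"
      by (intro power_mono) auto
  qed auto
  then show ?thesis by (simp add: prob_space)
qed

end

section \<open>The Lyapunov drift\<close>

lemma am_gm_weighted: "0 < k \<Longrightarrow> x * y \<le> x\<^sup>2 / (4 * k) + k * (y::real)\<^sup>2"
  using zero_le_power2[of "x - 2 * k * y"] by (simp add: power2_eq_square field_simps)

text \<open>\<open>m\<close> stands for the envelope norm and \<open>U\<close> for its equivalence
  constant with \<open>cn\<close>. \<open>Gbar_m\<close> is the form in which contraction in
  \<open>m\<close> enters the drift, and \<open>rho_tau\<close> is what \<open>\<tau>\<close> as a
  mixing time has to provide.\<close>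

locale fegsam_lyapunov = fegsam_process M p cn \<theta>0 N K \<alpha> S Y G b Gbar bbar \<eta> + Ly: smooth_norm m cn g \<Lambda>
  for M :: "'w measure" and p and cn :: "real ^ 'd \<Rightarrow> real" and \<theta>0 N K \<alpha> and S :: "nat \<Rightarrow> 'y measure"
    and Y G b Gbar bbar \<eta> m g \<Lambda> +
  fixes U \<phi> :: real and \<tau> :: nat
  assumes U: "0 < U" and cn_le_m: "\<And>x. (cn x)\<^sup>2 \<le> U * (m x)\<^sup>2" and m_le_cn: "\<And>x. (m x)\<^sup>2 \<le> (cn x)\<^sup>2"
    and \<phi>: "0 < \<phi>" and Gbar_m: "\<And>i x. i < N \<Longrightarrow> g x \<bullet> (Gbar i x - x) \<le> - \<phi> * (m x)\<^sup>2"
    and \<tau>: "1 \<le> \<tau>" and rho_tau: "prho p ^ \<tau> \<le> \<alpha>\<^sup>2"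
begin

definition hh :: "nat \<Rightarrow> 'w \<Rightarrow> real ^ 'd" where "hh t \<omega> = GG t \<omega> - th t \<omega> + bm t \<omega>"

definition Del :: "nat \<Rightarrow> 'w \<Rightarrow> real" where "Del t \<omega> = agent_mean N (\<lambda>i. cn (X i t \<omega> - th t \<omega>))"

definition FF :: "nat \<Rightarrow> 'w \<Rightarrow> real" where
  "FF t \<omega> = (pA2 p + 1)\<^sup>2 * (cn (th t \<omega>))\<^sup>2 + (pA2 p)\<^sup>2 * dev t \<omega> + (cn (bm t \<omega>))\<^sup>2"

definition EF :: "nat \<Rightarrow> real" where
  "EF t = (pA2 p + 1)\<^sup>2 * Ea t + (pA2 p)\<^sup>2 * Ed t + Eb t"

definition xi :: "nat \<Rightarrow> 'w \<Rightarrow> real ^ 'd" where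
  "xi t \<omega> = agent_mean N (\<lambda>i. G i (th (t - \<tau>) \<omega>) (Y i t \<omega>) - Gbar i (th (t - \<tau>) \<omega>))"

definition Ev :: "nat \<Rightarrow> real" where "Ev t = (\<integral>\<omega>. (m (th t \<omega>))\<^sup>2 / 2 \<partial>M)"
definition Ee :: "nat \<Rightarrow> real" where "Ee t = (\<integral>\<omega>. (cn (th t \<omega> - th (t - \<tau>) \<omega>))\<^sup>2 \<partial>M)"

lemma Del_nonneg: "0 \<le> Del t \<omega>"
  unfolding Del_def by (intro agent_mean_nonneg) auto

lemma Del_sq: "(Del t \<omega>)\<^sup>2 \<le> dev t \<omega>"
  unfolding Del_def dev_def by (rule agent_mean_sq_le)

lemma cn_X_le: "cn (X i t \<omega> - x) \<le> cn (X i t \<omega> - th t \<omega>) + cn (th t \<omega> - x)"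
  using is_norm_triangle[OF cn, of "X i t \<omega> - th t \<omega>" "th t \<omega> - x"] by simp

lemma hh_bound:
  assumes w: "\<omega> \<in> space M"
  shows "cn (hh t \<omega>) \<le> (pA2 p + 1) * cn (th t \<omega>) + pA2 p * Del t \<omega> + cn (bm t \<omega>)"
proof -
  have "cn (GG t \<omega>) \<le> agent_mean N (\<lambda>i. cn (G i (X i t \<omega>) (Y i t \<omega>)))"
    unfolding GG_def by (rule is_norm_agent_mean[OF cn])
  also have "\<dots> \<le> agent_mean N (\<lambda>i. pA2 p * (cn (X i t \<omega> - th t \<omega>) + cn (th t \<omega>)))"
  proof (rule agent_mean_mono)
    fix i assume i: "i < N"
    have "cn (G i (X i t \<omega>) (Y i t \<omega>)) \<le> pA2 p * cn (X i t \<omega>)" by (intro G_bound i Y_space w)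
    also have "\<dots> \<le> pA2 p * (cn (X i t \<omega> - th t \<omega>) + cn (th t \<omega>))"
      using cn_X_le[of i t \<omega> 0] constants_nonneg by (intro mult_left_mono) auto
    finally show "cn (G i (X i t \<omega>) (Y i t \<omega>)) \<le> pA2 p * (cn (X i t \<omega> - th t \<omega>) + cn (th t \<omega>))" .
  qed
  also have "\<dots> = pA2 p * (Del t \<omega> + cn (th t \<omega>))"
    by (simp only: agent_mean_mult agent_mean_add agent_mean_const[OF N] Del_def)
  finally have "cn (GG t \<omega>) \<le> pA2 p * (Del t \<omega> + cn (th t \<omega>))" .
  moreover have "cn (hh t \<omega>) \<le> cn (GG t \<omega>) + cn (th t \<omega>) + cn (bm t \<omega>)"
    unfolding hh_def using is_norm_triangle[OF cn, of "GG t \<omega> - th t \<omega>" "bm t \<omega>"] is_norm_diff[OF cn, of "GG t \<omega>" "th t \<omega>"] by linarith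
  ultimately show ?thesis by (simp add: algebra_simps)
qed

lemma hh_sq:
  assumes w: "\<omega> \<in> space M"
  shows "(cn (hh t \<omega>))\<^sup>2 \<le> 3 * FF t \<omega>"
proof -
  have "(cn (hh t \<omega>))\<^sup>2 \<le> ((pA2 p + 1) * cn (th t \<omega>) + pA2 p * Del t \<omega> + cn (bm t \<omega>))\<^sup>2"
    by (intro power_mono hh_bound w) auto
  also have "\<dots> \<le> 3 * (((pA2 p + 1) * cn (th t \<omega>))\<^sup>2 + (pA2 p * Del t \<omega>)\<^sup>2 + (cn (bm t \<omega>))\<^sup>2)"
    by (rule sq_sum_le3)
  also have "\<dots> \<le> 3 * FF t \<omega>"
    unfolding FF_def power_mult_distrib by (intro mult_left_mono add_mono Del_sq) auto
  finally show ?thesis .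
qed

lemma rv_FF: "bounded_rv M (FF t)"
  unfolding FF_def[abs_def]
  by (intro bounded_rv_add bounded_rv_mult bounded_rv_power bounded_rv_cn bounded_rv_const rv_th rv_bm rv_dev)

lemma integral_FF: "(\<integral>\<omega>. FF t \<omega> \<partial>M) = EF t"
  unfolding FF_def EF_def Ea_def Ed_def Eb_def using int_a int_b int_d by simp

lemma rv_diff: "bounded_rv M (\<lambda>\<omega>. th t \<omega> - th s \<omega>)"
  by (intro bounded_rv_diff rv_th)

lemma th_telescope: "th (s + k) \<omega> - th s \<omega> = (\<Sum>r\<in>{s..<s + k}. \<alpha> *\<^sub>R hh r \<omega>)"
  by (induction k) (simp_all add: th_Suc hh_def)

text \<open>Cauchy-Schwarz over the increments yields one factor \<open>\<tau>\<close>; summing over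
  the window yields the second one later.\<close>

lemma d_sq:
  assumes w: "\<omega> \<in> space M" and t: "\<tau> \<le> t"
  shows "(cn (th t \<omega> - th (t - \<tau>) \<omega>))\<^sup>2 \<le> 3 * \<alpha>\<^sup>2 * real \<tau> * (\<Sum>r\<in>{t - \<tau>..<t}. FF r \<omega>)"
proof -
  have "cn (th t \<omega> - th (t - \<tau>) \<omega>) = cn (\<Sum>r\<in>{t - \<tau>..<t}. \<alpha> *\<^sub>R hh r \<omega>)"
    using th_telescope[of "t - \<tau>" \<tau> \<omega>] t by simp
  also have "\<dots> \<le> (\<Sum>r\<in>{t - \<tau>..<t}. cn (\<alpha> *\<^sub>R hh r \<omega>))" by (rule is_norm_sum[OF cn])
  also have "\<dots> = \<alpha> * (\<Sum>r\<in>{t - \<tau>..<t}. cn (hh r \<omega>))"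
    using \<alpha> by (simp add: is_norm_scale[OF cn] sum_distrib_left)
  finally have "(cn (th t \<omega> - th (t - \<tau>) \<omega>))\<^sup>2 \<le> (\<alpha> * (\<Sum>r\<in>{t - \<tau>..<t}. cn (hh r \<omega>)))\<^sup>2"
    by (intro power_mono) auto
  also have "\<dots> = \<alpha>\<^sup>2 * (\<Sum>r\<in>{t - \<tau>..<t}. cn (hh r \<omega>))\<^sup>2" by (simp add: power_mult_distrib)
  also have "\<dots> \<le> \<alpha>\<^sup>2 * (real \<tau> * (\<Sum>r\<in>{t - \<tau>..<t}. (cn (hh r \<omega>))\<^sup>2))"
    using t by (intro mult_left_mono sum_sq_le) auto
  also have "\<dots> \<le> \<alpha>\<^sup>2 * (real \<tau> * (\<Sum>r\<in>{t - \<tau>..<t}. 3 * FF r \<omega>))"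
    by (intro mult_left_mono sum_mono hh_sq w) auto
  finally show ?thesis unfolding sum_distrib_left[symmetric] by (simp add: mult_ac)
qed

lemma Ee_bound:
  assumes t: "\<tau> \<le> t"
  shows "Ee t \<le> 3 * \<alpha>\<^sup>2 * real \<tau> * (\<Sum>r\<in>{t - \<tau>..<t}. EF r)"
proof -
  have "Ee t \<le> (\<integral>\<omega>. 3 * \<alpha>\<^sup>2 * real \<tau> * (\<Sum>r\<in>{t - \<tau>..<t}. FF r \<omega>) \<partial>M)"
    unfolding Ee_def
    by (intro integral_mono d_sq t bounded_rv_integrable bounded_rv_power bounded_rv_cn rv_diff
        bounded_rv_mult bounded_rv_sum bounded_rv_const rv_FF)
  also have "\<dots> = 3 * \<alpha>\<^sup>2 * real \<tau> * (\<Sum>r\<in>{t - \<tau>..<t}. EF r)"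
    by (subst integral_mult_right_zero, subst Bochner_Integration.integral_sum)
       (auto simp: integral_FF intro: bounded_rv_integrable rv_FF)
  finally show ?thesis .
qed

lemma Ee_nonneg: "0 \<le> Ee t"
  unfolding Ee_def by (rule Bochner_Integration.integral_nonneg) auto

text \<open>The descent inequality for m^2 / 2, with the direction split into the averaged operator
  at the current mean, the noise with frozen parameter, and the error \<open>\<delta>\<close> caused
  by freezing and by client deviation. The two products with \<open>g (th s)\<close> are left
  standing, because only their expectations are small.\<close>

lemma drift_pointwise:
  fixes t :: nat
  assumes w: "\<omega> \<in> space M"
  defines "s \<equiv> t - \<tau>" and "\<sigma> \<equiv> \<alpha> * real \<tau> * (pA2 p + 1)"
  shows "(m (th (Suc t) \<omega>))\<^sup>2 / 2 \<le> (1 - 2 * \<alpha> * \<phi>) * ((m (th t \<omega>))\<^sup>2 / 2)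
    + \<alpha> * (g (th s \<omega>) \<bullet> xi t \<omega> + g (th s \<omega>) \<bullet> bm t \<omega>
      + \<Lambda> * (2 * (pA2 p + 1) + (pA1 p + 1)) / (4 * \<sigma>) * (cn (th t \<omega> - th s \<omega>))\<^sup>2
      + \<Lambda> * (pA2 p + 1) * \<sigma> * (cn (th s \<omega>))\<^sup>2
      + (\<Lambda> * (pA1 p + 1) * \<sigma> + \<phi> / (20 * U)) * (cn (th t \<omega>))\<^sup>2
      + 5 * U * \<Lambda>\<^sup>2 * (pA1 p + 1)\<^sup>2 / \<phi> * dev t \<omega>
      + \<Lambda> * \<alpha> * real \<tau> * (cn (bm t \<omega>))\<^sup>2
      + 3 / 2 * \<Lambda> * \<alpha> * FF t \<omega>)"
proof -
  define d ns nt \<beta> D A2 A1 where "d = cn (th t \<omega> - th s \<omega>)" and "ns = cn (th s \<omega>)" and "nt = cn (th t \<omega>)"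
    and "\<beta> = cn (bm t \<omega>)" and "D = Del t \<omega>" and "A2 = pA2 p + 1" and "A1 = pA1 p + 1"
  define GB where "GB x = agent_mean N (\<lambda>i. Gbar i x)" for x
  define \<delta> where "\<delta> = agent_mean N (\<lambda>i. (G i (X i t \<omega>) (Y i t \<omega>) - G i (th s \<omega>) (Y i t \<omega>)) + (Gbar i (th s \<omega>) - Gbar i (th t \<omega>)))"
  note L0 = Ly.\<Lambda>
  have A2: "1 \<le> A2" and A1: "1 \<le> A1" using constants_nonneg by (auto simp: A2_def A1_def)
  \<comment> \<open>The displacement \<open>d\<close> is of order \<open>\<sigma>\<close> relative
    to the iterates, so d^2 / sigma and sigma times a squared iterate have the same order; hence the
    weight \<open>\<sigma>\<close> in the splittings below.\<close>
  have \<sigma>: "\<sigma> = \<alpha> * real \<tau> * A2" "0 < \<sigma>" using \<alpha> \<tau> A2 by (auto simp: \<sigma>_def A2_def)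
  have nn: "0 \<le> d" "0 \<le> ns" "0 \<le> nt" "0 \<le> \<beta>" "0 \<le> D"
    by (auto simp: d_def ns_def nt_def \<beta>_def D_def Del_nonneg)
  have h: "hh t \<omega> = (GB (th t \<omega>) - th t \<omega>) + (xi t \<omega> + bm t \<omega>) + \<delta>"
    unfolding hh_def GG_def GB_def xi_def \<delta>_def s_def[symmetric] agent_mean_add agent_mean_diff by simp
  have "cn \<delta> \<le> agent_mean N (\<lambda>i. cn ((G i (X i t \<omega>) (Y i t \<omega>) - G i (th s \<omega>) (Y i t \<omega>)) + (Gbar i (th s \<omega>) - Gbar i (th t \<omega>))))"
    unfolding \<delta>_def by (rule is_norm_agent_mean[OF cn])
  also have "\<dots> \<le> agent_mean N (\<lambda>i. A1 * (cn (X i t \<omega> - th t \<omega>) + d))"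
  proof (rule agent_mean_mono)
    fix i assume i: "i < N"
    have "cn ((G i (X i t \<omega>) (Y i t \<omega>) - G i (th s \<omega>) (Y i t \<omega>)) + (Gbar i (th s \<omega>) - Gbar i (th t \<omega>)))
      \<le> cn (G i (X i t \<omega>) (Y i t \<omega>) - G i (th s \<omega>) (Y i t \<omega>)) + cn (Gbar i (th s \<omega>) - Gbar i (th t \<omega>))"
      by (rule is_norm_triangle[OF cn])
    also have "\<dots> \<le> pA1 p * cn (X i t \<omega> - th s \<omega>) + pgamma p * cn (th s \<omega> - th t \<omega>)"
      by (intro add_mono G_lip Gbar_contr i Y_space w)
    also have "\<dots> \<le> pA1 p * (cn (X i t \<omega> - th t \<omega>) + d) + 1 * (cn (X i t \<omega> - th t \<omega>) + d)"
      using constants_nonneg gamma nn is_norm_minus_commute[OF cn, of "th s \<omega>" "th t \<omega>"]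
      by (intro add_mono mult_mono) (auto simp: d_def cn_X_le)
    finally show "cn ((G i (X i t \<omega>) (Y i t \<omega>) - G i (th s \<omega>) (Y i t \<omega>)) + (Gbar i (th s \<omega>) - Gbar i (th t \<omega>)))
      \<le> A1 * (cn (X i t \<omega> - th t \<omega>) + d)" by (simp add: A1_def algebra_simps)
  qed
  also have "\<dots> = A1 * (D + d)"
    by (simp only: agent_mean_mult agent_mean_add agent_mean_const[OF N] D_def Del_def)
  finally have \<delta>: "cn \<delta> \<le> A1 * (D + d)" .
  have "cn (xi t \<omega>) \<le> agent_mean N (\<lambda>i. cn (G i (th s \<omega>) (Y i t \<omega>) - Gbar i (th s \<omega>)))"
    unfolding xi_def s_def by (rule is_norm_agent_mean[OF cn])
  also have "\<dots> \<le> A2 * ns"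
  proof (rule agent_mean_le[OF N])
    fix i assume i: "i < N"
    have "cn (G i (th s \<omega>) (Y i t \<omega>) - Gbar i (th s \<omega>)) \<le> cn (G i (th s \<omega>) (Y i t \<omega>)) + cn (Gbar i (th s \<omega>))"
      by (rule is_norm_diff[OF cn])
    also have "\<dots> \<le> pA2 p * ns + pgamma p * ns"
      unfolding ns_def by (intro add_mono G_bound Gbar_bound i Y_space w)
    also have "\<dots> \<le> pA2 p * ns + 1 * ns" using gamma nn by (intro add_mono mult_right_mono) auto
    finally show "cn (G i (th s \<omega>) (Y i t \<omega>) - Gbar i (th s \<omega>)) \<le> A2 * ns" by (simp add: A2_def algebra_simps)
  qed
  finally have xi: "cn (xi t \<omega>) \<le> A2 * ns" .
  have 1: "g (th t \<omega>) \<bullet> (GB (th t \<omega>) - th t \<omega>) \<le> - \<phi> * (m (th t \<omega>))\<^sup>2"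
  proof -
    have "g (th t \<omega>) \<bullet> (GB (th t \<omega>) - th t \<omega>) = agent_mean N (\<lambda>i. g (th t \<omega>) \<bullet> (Gbar i (th t \<omega>) - th t \<omega>))"
      unfolding agent_mean_inner[symmetric] by (simp add: agent_mean_diff agent_mean_const[OF N] GB_def)
    also have "\<dots> \<le> - \<phi> * (m (th t \<omega>))\<^sup>2" by (rule agent_mean_le[OF N Gbar_m])
    finally show ?thesis .
  qed
  have "(g (th t \<omega>) - g (th s \<omega>)) \<bullet> (xi t \<omega> + bm t \<omega>) \<le> \<Lambda> * d * cn (xi t \<omega> + bm t \<omega>)"
    unfolding d_def by (rule Ly.gradient_lipschitz)
  also have "\<dots> \<le> \<Lambda> * d * (A2 * ns + \<beta>)"
    using L0 nn xi is_norm_triangle[OF cn, of "xi t \<omega>" "bm t \<omega>"] by (intro mult_left_mono) (auto simp: \<beta>_def)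
  also have "\<dots> = \<Lambda> * (A2 * (d * ns) + d * \<beta>)" by (simp add: algebra_simps)
  also have "\<dots> \<le> \<Lambda> * (A2 * (d\<^sup>2 / (4 * \<sigma>) + \<sigma> * ns\<^sup>2) + (A2 * d\<^sup>2 / (4 * \<sigma>) + \<alpha> * real \<tau> * \<beta>\<^sup>2))"
  proof (intro mult_left_mono add_mono am_gm_weighted \<sigma>)
    \<comment> \<open>This product is split with weight \<open>\<alpha> * \<tau>\<close> so that the
      squared noise, the source of the 1 / N term, keeps exactly this coefficient; the displacement
      gets the same coefficient as in the other splitting.\<close>
    have "0 < \<alpha> * real \<tau>" using \<alpha> \<tau> by simp
    from am_gm_weighted[OF this, of d \<beta>] show "d * \<beta> \<le> A2 * d\<^sup>2 / (4 * \<sigma>) + \<alpha> * real \<tau> * \<beta>\<^sup>2"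
      using A2 by (simp add: \<sigma>(1))
  qed (use L0 A2 in auto)
  finally have 2: "(g (th t \<omega>) - g (th s \<omega>)) \<bullet> (xi t \<omega> + bm t \<omega>)
    \<le> \<Lambda> * (A2 * (d\<^sup>2 / (4 * \<sigma>) + \<sigma> * ns\<^sup>2) + (A2 * d\<^sup>2 / (4 * \<sigma>) + \<alpha> * real \<tau> * \<beta>\<^sup>2))" .
  have "g (th t \<omega>) \<bullet> \<delta> \<le> \<Lambda> * nt * cn \<delta>" unfolding nt_def by (rule Ly.gradient_bound)
  also have "\<dots> \<le> \<Lambda> * nt * (A1 * (D + d))" using L0 nn \<delta> by (intro mult_left_mono) auto
  also have "\<dots> = (\<Lambda> * A1 * D) * nt + \<Lambda> * A1 * (d * nt)" by (simp add: algebra_simps)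
  \<comment> \<open>\<open>D\<close> comes without a small factor, so its product with
    \<open>nt\<close> is charged to a fixed fraction of the contraction,
    \<open>\<phi> / (20 * U)\<close>, which the final summation can afford.\<close>
  also have "\<dots> \<le> ((\<Lambda> * A1 * D)\<^sup>2 / (4 * (\<phi> / (20 * U))) + \<phi> / (20 * U) * nt\<^sup>2) + \<Lambda> * A1 * (d\<^sup>2 / (4 * \<sigma>) + \<sigma> * nt\<^sup>2)"
    using L0 A1 \<phi> U by (intro add_mono mult_left_mono am_gm_weighted \<sigma>) auto
  also have "(\<Lambda> * A1 * D)\<^sup>2 / (4 * (\<phi> / (20 * U))) = 5 * U * \<Lambda>\<^sup>2 * A1\<^sup>2 / \<phi> * D\<^sup>2"
    using \<phi> U by (simp add: power_mult_distrib field_simps)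
  also have "5 * U * \<Lambda>\<^sup>2 * A1\<^sup>2 / \<phi> * D\<^sup>2 \<le> 5 * U * \<Lambda>\<^sup>2 * A1\<^sup>2 / \<phi> * dev t \<omega>"
    unfolding D_def using U \<phi> by (intro mult_left_mono Del_sq) auto
  finally have 3: "g (th t \<omega>) \<bullet> \<delta> \<le> (5 * U * \<Lambda>\<^sup>2 * A1\<^sup>2 / \<phi> * dev t \<omega> + \<phi> / (20 * U) * nt\<^sup>2) + \<Lambda> * A1 * (d\<^sup>2 / (4 * \<sigma>) + \<sigma> * nt\<^sup>2)"
    by simp
  \<comment> \<open>Only the noise is paired with the old gradient; the contraction term needs the
    gradient at the current mean.\<close>
  have gh: "g (th t \<omega>) \<bullet> hh t \<omega> = g (th t \<omega>) \<bullet> (GB (th t \<omega>) - th t \<omega>)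
      + (g (th t \<omega>) - g (th s \<omega>)) \<bullet> (xi t \<omega> + bm t \<omega>) + g (th s \<omega>) \<bullet> xi t \<omega> + g (th s \<omega>) \<bullet> bm t \<omega> + g (th t \<omega>) \<bullet> \<delta>"
    unfolding h by (simp add: inner_add_right inner_diff_left)
  have E: "g (th t \<omega>) \<bullet> hh t \<omega> \<le> - \<phi> * (m (th t \<omega>))\<^sup>2 + (g (th s \<omega>) \<bullet> xi t \<omega> + g (th s \<omega>) \<bullet> bm t \<omega>)
      + \<Lambda> * (A2 * (d\<^sup>2 / (4 * \<sigma>) + \<sigma> * ns\<^sup>2) + (A2 * d\<^sup>2 / (4 * \<sigma>) + \<alpha> * real \<tau> * \<beta>\<^sup>2))
      + ((5 * U * \<Lambda>\<^sup>2 * A1\<^sup>2 / \<phi> * dev t \<omega> + \<phi> / (20 * U) * nt\<^sup>2) + \<Lambda> * A1 * (d\<^sup>2 / (4 * \<sigma>) + \<sigma> * nt\<^sup>2))"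
    unfolding gh using 1 2 3 by linarith
  have "(m (th (Suc t) \<omega>))\<^sup>2 / 2 \<le> (m (th t \<omega>))\<^sup>2 / 2 + \<alpha> * (g (th t \<omega>) \<bullet> hh t \<omega>) + \<Lambda> / 2 * \<alpha>\<^sup>2 * (cn (hh t \<omega>))\<^sup>2"
    using Ly.smooth_line[of "th t \<omega>" \<alpha> "hh t \<omega>"] by (simp add: th_Suc hh_def)
  also have "\<dots> \<le> (m (th t \<omega>))\<^sup>2 / 2 + \<alpha> * (- \<phi> * (m (th t \<omega>))\<^sup>2 + (g (th s \<omega>) \<bullet> xi t \<omega> + g (th s \<omega>) \<bullet> bm t \<omega>)
      + \<Lambda> * (A2 * (d\<^sup>2 / (4 * \<sigma>) + \<sigma> * ns\<^sup>2) + (A2 * d\<^sup>2 / (4 * \<sigma>) + \<alpha> * real \<tau> * \<beta>\<^sup>2))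
      + ((5 * U * \<Lambda>\<^sup>2 * A1\<^sup>2 / \<phi> * dev t \<omega> + \<phi> / (20 * U) * nt\<^sup>2) + \<Lambda> * A1 * (d\<^sup>2 / (4 * \<sigma>) + \<sigma> * nt\<^sup>2)))
      + \<Lambda> / 2 * \<alpha>\<^sup>2 * (3 * FF t \<omega>)"
    using \<alpha> L0 by (intro add_mono mult_left_mono E hh_sq w order_refl) auto
  also have "\<dots> = (1 - 2 * \<alpha> * \<phi>) * ((m (th t \<omega>))\<^sup>2 / 2)
    + \<alpha> * (g (th s \<omega>) \<bullet> xi t \<omega> + g (th s \<omega>) \<bullet> bm t \<omega>
      + \<Lambda> * (2 * A2 + A1) / (4 * \<sigma>) * d\<^sup>2 + \<Lambda> * A2 * \<sigma> * ns\<^sup>2 + (\<Lambda> * A1 * \<sigma> + \<phi> / (20 * U)) * nt\<^sup>2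
      + 5 * U * \<Lambda>\<^sup>2 * A1\<^sup>2 / \<phi> * dev t \<omega> + \<Lambda> * \<alpha> * real \<tau> * \<beta>\<^sup>2 + 3 / 2 * \<Lambda> * \<alpha> * FF t \<omega>)"
    by (simp add: algebra_simps add_divide_distrib diff_divide_distrib power2_eq_square)
  finally show ?thesis by (simp only: d_def ns_def nt_def \<beta>_def A2_def A1_def)
qed

lemma bounded_rv_m: "bounded_rv M f \<Longrightarrow> bounded_rv M (\<lambda>\<omega>. m (f \<omega> :: real ^ 'd))"
  by (rule bounded_rv_is_norm[OF Ly.m])

lemma bounded_rv_g: "bounded_rv F f \<Longrightarrow> bounded_rv F (\<lambda>\<omega>. g (f \<omega>))"
  by (rule bounded_rv_continuous[OF Ly.gradient_continuous])

text \<open>In expectation the two remaining products are small, by mixing over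
  \<open>\<tau>\<close> steps. The one with \<open>xi\<close> is quadratic in the iterate. The one
  with \<open>bm\<close> is only linear, so a fraction \<open>\<phi> / (40 * U)\<close> of the
  contraction is spent on it, which leaves the constant of order alpha^4.\<close>

lemma drift:
  fixes t :: nat
  assumes t: "\<tau> \<le> t"
  defines "s \<equiv> t - \<tau>" and "\<sigma> \<equiv> \<alpha> * real \<tau> * (pA2 p + 1)"
  shows "Ev (Suc t) \<le> (1 - 2 * \<alpha> * \<phi>) * Ev t
    + \<alpha> * ((\<Lambda> * pm1 p * \<alpha>\<^sup>2 + \<phi> / (40 * U) + \<Lambda> * (pA2 p + 1) * \<sigma>) * Ea s + 10 * U * \<Lambda>\<^sup>2 * (pm4 p)\<^sup>2 * \<alpha> ^ 4 / \<phi>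
      + \<Lambda> * (2 * (pA2 p + 1) + (pA1 p + 1)) / (4 * \<sigma>) * Ee t
      + (\<Lambda> * (pA1 p + 1) * \<sigma> + \<phi> / (20 * U)) * Ea t
      + 5 * U * \<Lambda>\<^sup>2 * (pA1 p + 1)\<^sup>2 / \<phi> * Ed t
      + \<Lambda> * \<alpha> * real \<tau> * Eb t
      + 3 / 2 * \<Lambda> * \<alpha> * EF t)"
proof -
  have st: "s \<le> t" "t - s = \<tau>" using t by (auto simp: s_def)
  note L0 = Ly.\<Lambda>
  have gH: "bounded_rv (H s) (\<lambda>\<omega>. g (th s \<omega>))" by (intro bounded_rv_g bounded_rv_th) simp
  have gM: "bounded_rv M (\<lambda>\<omega>. g (th s \<omega>))" by (rule bounded_rv_mono[OF subalgebra_H gH])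
  have thH: "bounded_rv (H s) (th s)" by (rule bounded_rv_th) simp
  have dM: "bounded_rv M (\<lambda>\<omega>. \<Lambda> * cn (th s \<omega>))" by (intro bounded_rv_mult bounded_rv_const bounded_rv_cn rv_th)
  have rvd: "bounded_rv M (\<lambda>\<omega>. G i (th s \<omega>) (Y i t \<omega>) - Gbar i (th s \<omega>))" if "i < N" for i
    by (intro bounded_rv_diff bounded_rv_G that rv_th Y_measurable bounded_rv_continuous[OF Gbar_continuous])
  have rxi: "bounded_rv M (xi t)"
    unfolding xi_def[abs_def] s_def[symmetric] by (intro bounded_rv_agent_mean rvd)
  have d0: "0 \<le> \<Lambda> * cn (th s \<omega>)" for \<omega> using L0 by simp
  have ud: "g (th s \<omega>) \<bullet> w \<le> \<Lambda> * cn (th s \<omega>) * cn w" for \<omega> w by (rule Ly.gradient_bound)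
  have "(\<integral>\<omega>. g (th s \<omega>) \<bullet> xi t \<omega> \<partial>M) = agent_mean N (\<lambda>i. \<integral>\<omega>. g (th s \<omega>) \<bullet> (G i (th s \<omega>) (Y i t \<omega>) - Gbar i (th s \<omega>)) \<partial>M)"
    unfolding xi_def s_def[symmetric] agent_mean_inner
    by (intro integral_agent_mean bounded_rv_integrable bounded_rv_inner gM rvd)
  also have "\<dots> \<le> (\<integral>\<omega>. \<Lambda> * cn (th s \<omega>) * (pm1 p * cn (th s \<omega>) * prho p ^ (t - s)) \<partial>M)"
    by (rule agent_mean_le[OF N]) (intro expectation_G st gH dM d0 ud thH)
  also have "\<dots> = \<Lambda> * pm1 p * prho p ^ \<tau> * Ea s"
    unfolding Ea_def st integral_mult_right_zero[symmetric]
    by (intro Bochner_Integration.integral_cong) (auto simp: power2_eq_square)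
  also have "\<dots> \<le> \<Lambda> * pm1 p * \<alpha>\<^sup>2 * Ea s"
    using L0 m1 rho_tau E_nonneg by (intro mult_right_mono mult_left_mono) auto
  finally have x1: "(\<integral>\<omega>. g (th s \<omega>) \<bullet> xi t \<omega> \<partial>M) \<le> \<Lambda> * pm1 p * \<alpha>\<^sup>2 * Ea s" .
  have "(\<integral>\<omega>. g (th s \<omega>) \<bullet> bm t \<omega> \<partial>M) \<le> (\<integral>\<omega>. \<Lambda> * cn (th s \<omega>) * (pm4 p * prho p ^ (t - s)) \<partial>M)"
    by (intro expectation_bm st gH dM d0 ud)
  also have "\<dots> \<le> (\<integral>\<omega>. 10 * U * \<Lambda>\<^sup>2 * (pm4 p)\<^sup>2 * \<alpha> ^ 4 / \<phi> + \<phi> / (40 * U) * (cn (th s \<omega>))\<^sup>2 \<partial>M)"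
  proof (rule integral_mono)
    show "integrable M (\<lambda>\<omega>. \<Lambda> * cn (th s \<omega>) * (pm4 p * prho p ^ (t - s)))"
      by (intro bounded_rv_integrable bounded_rv_mult dM bounded_rv_const)
    show "integrable M (\<lambda>\<omega>. 10 * U * \<Lambda>\<^sup>2 * (pm4 p)\<^sup>2 * \<alpha> ^ 4 / \<phi> + \<phi> / (40 * U) * (cn (th s \<omega>))\<^sup>2)"
      using int_a by simp
    fix \<omega>
    have "\<Lambda> * cn (th s \<omega>) * (pm4 p * prho p ^ (t - s)) \<le> \<Lambda> * cn (th s \<omega>) * (pm4 p * \<alpha>\<^sup>2)"
      unfolding st using rho_tau d0 m4 by (intro mult_left_mono) auto
    also have "\<dots> = (\<Lambda> * pm4 p * \<alpha>\<^sup>2) * cn (th s \<omega>)" by simp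
    also have "\<dots> \<le> (\<Lambda> * pm4 p * \<alpha>\<^sup>2)\<^sup>2 / (4 * (\<phi> / (40 * U))) + \<phi> / (40 * U) * (cn (th s \<omega>))\<^sup>2"
      using \<phi> U by (intro am_gm_weighted) auto
    also have "(\<Lambda> * pm4 p * \<alpha>\<^sup>2)\<^sup>2 / (4 * (\<phi> / (40 * U))) = 10 * U * \<Lambda>\<^sup>2 * (pm4 p)\<^sup>2 * \<alpha> ^ 4 / \<phi>"
      using \<phi> U by (simp add: power_mult_distrib field_simps)
    finally show "\<Lambda> * cn (th s \<omega>) * (pm4 p * prho p ^ (t - s)) \<le> 10 * U * \<Lambda>\<^sup>2 * (pm4 p)\<^sup>2 * \<alpha> ^ 4 / \<phi> + \<phi> / (40 * U) * (cn (th s \<omega>))\<^sup>2" .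
  qed
  also have "\<dots> = 10 * U * \<Lambda>\<^sup>2 * (pm4 p)\<^sup>2 * \<alpha> ^ 4 / \<phi> + \<phi> / (40 * U) * Ea s"
    unfolding Ea_def using int_a by (simp add: prob_space)
  finally have x2: "(\<integral>\<omega>. g (th s \<omega>) \<bullet> bm t \<omega> \<partial>M) \<le> 10 * U * \<Lambda>\<^sup>2 * (pm4 p)\<^sup>2 * \<alpha> ^ 4 / \<phi> + \<phi> / (40 * U) * Ea s" .
  define cd cs ct cD cb cF where "cd = \<Lambda> * (2 * (pA2 p + 1) + (pA1 p + 1)) / (4 * \<sigma>)"
    and "cs = \<Lambda> * (pA2 p + 1) * \<sigma>" and "ct = \<Lambda> * (pA1 p + 1) * \<sigma> + \<phi> / (20 * U)"
    and "cD = 5 * U * \<Lambda>\<^sup>2 * (pA1 p + 1)\<^sup>2 / \<phi>" and "cb = \<Lambda> * \<alpha> * real \<tau>" and "cF = 3 / 2 * \<Lambda> * \<alpha>"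
  have i1: "integrable M (\<lambda>\<omega>. g (th s \<omega>) \<bullet> xi t \<omega>)" by (intro bounded_rv_integrable bounded_rv_inner gM rxi)
  have i2: "integrable M (\<lambda>\<omega>. g (th s \<omega>) \<bullet> bm t \<omega>)" by (intro bounded_rv_integrable bounded_rv_inner gM rv_bm)
  have i3: "integrable M (\<lambda>\<omega>. (cn (th t \<omega> - th s \<omega>))\<^sup>2)"
    by (intro bounded_rv_integrable bounded_rv_power bounded_rv_cn rv_diff)
  have i4: "integrable M (FF t)" by (intro bounded_rv_integrable rv_FF)
  have i5: "integrable M (\<lambda>\<omega>. (m (th t \<omega>))\<^sup>2)" for t
    by (intro bounded_rv_integrable bounded_rv_power bounded_rv_m rv_th)
  have "Ev (Suc t) \<le> (\<integral>\<omega>. (1 - 2 * \<alpha> * \<phi>) * ((m (th t \<omega>))\<^sup>2 / 2)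
    + \<alpha> * (g (th s \<omega>) \<bullet> xi t \<omega> + g (th s \<omega>) \<bullet> bm t \<omega> + cd * (cn (th t \<omega> - th s \<omega>))\<^sup>2 + cs * (cn (th s \<omega>))\<^sup>2
      + ct * (cn (th t \<omega>))\<^sup>2 + cD * dev t \<omega> + cb * (cn (bm t \<omega>))\<^sup>2 + cF * FF t \<omega>) \<partial>M)"
    unfolding Ev_def
  proof (rule integral_mono)
    show "integrable M (\<lambda>\<omega>. (1 - 2 * \<alpha> * \<phi>) * ((m (th t \<omega>))\<^sup>2 / 2)
    + \<alpha> * (g (th s \<omega>) \<bullet> xi t \<omega> + g (th s \<omega>) \<bullet> bm t \<omega> + cd * (cn (th t \<omega> - th s \<omega>))\<^sup>2 + cs * (cn (th s \<omega>))\<^sup>2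
      + ct * (cn (th t \<omega>))\<^sup>2 + cD * dev t \<omega> + cb * (cn (bm t \<omega>))\<^sup>2 + cF * FF t \<omega>))"
      by (intro Bochner_Integration.integrable_add integrable_mult_right integrable_divide i1 i2 i3 i4 i5 int_a int_b int_d)
  qed (use i5 drift_pointwise[of _ t] in \<open>auto simp: cd_def cs_def ct_def cD_def cb_def cF_def s_def \<sigma>_def\<close>)
  also have "\<dots> = (1 - 2 * \<alpha> * \<phi>) * Ev t + \<alpha> * ((\<integral>\<omega>. g (th s \<omega>) \<bullet> xi t \<omega> \<partial>M) + (\<integral>\<omega>. g (th s \<omega>) \<bullet> bm t \<omega> \<partial>M)
      + cd * Ee t + cs * Ea s + ct * Ea t + cD * Ed t + cb * Eb t + cF * EF t)"
    unfolding Ev_def Ee_def Ea_def Ed_def Eb_def integral_FF[symmetric] s_def[symmetric]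
    by (simp only: Bochner_Integration.integral_add Bochner_Integration.integrable_add integrable_mult_right
        integrable_divide i1 i2 i3 i4 i5 int_a int_b int_d integral_mult_right_zero)
  also have "\<dots> \<le> (1 - 2 * \<alpha> * \<phi>) * Ev t + \<alpha> * (\<Lambda> * pm1 p * \<alpha>\<^sup>2 * Ea s + (10 * U * \<Lambda>\<^sup>2 * (pm4 p)\<^sup>2 * \<alpha> ^ 4 / \<phi> + \<phi> / (40 * U) * Ea s)
      + cd * Ee t + cs * Ea s + ct * Ea t + cD * Ed t + cb * Eb t + cF * EF t)"
    using \<alpha> by (intro add_left_mono mult_left_mono add_right_mono add_mono x1 x2) auto
  also have "\<dots> = (1 - 2 * \<alpha> * \<phi>) * Ev t
    + \<alpha> * ((\<Lambda> * pm1 p * \<alpha>\<^sup>2 + \<phi> / (40 * U) + cs) * Ea s + 10 * U * \<Lambda>\<^sup>2 * (pm4 p)\<^sup>2 * \<alpha> ^ 4 / \<phi>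
      + cd * Ee t + ct * Ea t + cD * Ed t + cb * Eb t + cF * EF t)"
    by (simp add: algebra_simps)
  finally show ?thesis by (simp only: cd_def cs_def ct_def cD_def cb_def cF_def)
qed

lemma Ea_le_Ev: "Ea t \<le> 2 * U * Ev t"
proof -
  have "Ea t \<le> (\<integral>\<omega>. 2 * U * ((m (th t \<omega>))\<^sup>2 / 2) \<partial>M)"
    unfolding Ea_def
  proof (intro integral_mono int_a integrable_mult_right)
    show "integrable M (\<lambda>\<omega>. (m (th t \<omega>))\<^sup>2 / 2)"
      by (intro integrable_divide bounded_rv_integrable bounded_rv_power bounded_rv_m rv_th)
  qed (use cn_le_m in auto)
  then show ?thesis by (simp add: Ev_def)
qed

lemma Ev_le_Ea: "Ev t \<le> Ea t"
proof -
  have "Ev t \<le> (\<integral>\<omega>. (cn (th t \<omega>))\<^sup>2 \<partial>M)"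
    unfolding Ev_def
  proof (intro integral_mono int_a)
    show "integrable M (\<lambda>\<omega>. (m (th t \<omega>))\<^sup>2 / 2)"
      by (intro integrable_divide bounded_rv_integrable bounded_rv_power bounded_rv_m rv_th)
    fix \<omega> show "(m (th t \<omega>))\<^sup>2 / 2 \<le> (cn (th t \<omega>))\<^sup>2"
      using m_le_cn[of "th t \<omega>"] zero_le_power2[of "m (th t \<omega>)"] by linarith
  qed
  then show ?thesis by (simp add: Ea_def)
qed

end

section \<open>Summing the drift against the output weights\<close>

text \<open>After exchanging the sums, each \<open>r\<close> lies in at most \<open>w\<close>
  windows, all within \<open>w\<close> steps after \<open>r\<close>, over which the weight grows by
  at most \<open>z ^ w\<close>.\<close>

lemma weighted_window_sum:
  fixes h :: "nat \<Rightarrow> real" and z :: real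
  assumes z: "1 \<le> z" and h: "\<And>r. 0 \<le> h r"
  shows "(\<Sum>t<T. z ^ t * (\<Sum>r\<in>{t - w..<t}. h r)) \<le> real w * z ^ w * (\<Sum>t<T. z ^ t * h t)"
proof -
  have "(\<Sum>t<T. z ^ t * (\<Sum>r\<in>{t - w..<t}. h r)) \<le> (\<Sum>t<T. \<Sum>r\<in>{t - w..<t}. z ^ w * (z ^ r * h r))"
    unfolding sum_distrib_left
  proof (intro sum_mono)
    fix t r assume "r \<in> {t - w..<t}"
    then have "t \<le> w + r" by auto
    then have "z ^ t \<le> z ^ (w + r)" using z by (rule power_increasing)
    then show "z ^ t * h r \<le> z ^ w * (z ^ r * h r)"
      using h[of r] by (simp add: power_add mult_right_mono flip: mult.assoc)
  qed
  also have "\<dots> = (\<Sum>t<T. \<Sum>r<T. if t - w \<le> r \<and> r < t then z ^ w * (z ^ r * h r) else 0)"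
  proof (rule sum.cong[OF refl])
    fix t assume "t \<in> {..<T}"
    then have "{..<T} \<inter> {r. t - w \<le> r \<and> r < t} = {t - w..<t}" by auto
    then show "(\<Sum>r\<in>{t - w..<t}. z ^ w * (z ^ r * h r)) = (\<Sum>r<T. if t - w \<le> r \<and> r < t then z ^ w * (z ^ r * h r) else 0)"
      by (simp add: sum.inter_restrict[symmetric] sum.If_cases)
  qed
  also have "\<dots> = (\<Sum>r<T. \<Sum>t<T. if t - w \<le> r \<and> r < t then z ^ w * (z ^ r * h r) else 0)"
    by (rule sum.swap)
  also have "\<dots> \<le> (\<Sum>r<T. real w * (z ^ w * (z ^ r * h r)))"
  proof (rule sum_mono)
    fix r
    have "(\<Sum>t<T. if t - w \<le> r \<and> r < t then z ^ w * (z ^ r * h r) else 0)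
      = real (card ({..<T} \<inter> {t. t - w \<le> r \<and> r < t})) * (z ^ w * (z ^ r * h r))"
      by (simp add: sum.If_cases)
    also have "card ({..<T} \<inter> {t. t - w \<le> r \<and> r < t}) \<le> card {r<..r + w}"
      by (rule card_mono) auto
    then have "real (card ({..<T} \<inter> {t. t - w \<le> r \<and> r < t})) * (z ^ w * (z ^ r * h r)) \<le> real w * (z ^ w * (z ^ r * h r))"
      using z h[of r] by (intro mult_right_mono) auto
    finally show "(\<Sum>t<T. if t - w \<le> r \<and> r < t then z ^ w * (z ^ r * h r) else 0) \<le> real w * (z ^ w * (z ^ r * h r))" .
  qed
  also have "\<dots> = real w * z ^ w * (\<Sum>t<T. z ^ t * h t)"
    by (simp add: sum_distrib_left mult.assoc)
  finally show ?thesis .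
qed

lemma weighted_shift_sum:
  fixes h :: "nat \<Rightarrow> real" and z :: real
  assumes z: "1 \<le> z" and h: "\<And>r. 0 \<le> h r"
  shows "(\<Sum>t\<in>{w..<T}. z ^ t * h (t - w)) \<le> z ^ w * (\<Sum>t<T. z ^ t * h t)"
proof -
  have "(\<Sum>t\<in>{w..<T}. z ^ t * h (t - w)) = (\<Sum>t\<in>{..<T - w}. z ^ (t + w) * h t)"
    by (rule sum.reindex_bij_witness[of _ "\<lambda>t. t + w" "\<lambda>t. t - w"]) auto
  also have "\<dots> = z ^ w * (\<Sum>t<T - w. z ^ t * h t)"
    by (simp add: sum_distrib_left power_add mult_ac)
  also have "\<dots> \<le> z ^ w * (\<Sum>t<T. z ^ t * h t)"
    using z h by (intro mult_left_mono sum_mono2) auto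
  finally show ?thesis .
qed

lemma sum_tail_le:
  fixes h :: "nat \<Rightarrow> real"
  assumes "\<And>t. 0 \<le> h t" shows "(\<Sum>t\<in>{w..<T}. h t) \<le> (\<Sum>t<T. h t)"
  using assms by (intro sum_mono2) auto

text \<open>Bernoulli's inequality; it gives explicit rational bounds for geometric growth over
  \<open>\<tau>\<close> or \<open>K - 1\<close> steps.\<close>

lemma inverse_power_le:
  fixes x :: real
  assumes "0 \<le> x" "x < 1" "real n * x \<le> y" "y < 1"
  shows "(1 / (1 - x)) ^ n \<le> 1 / (1 - y)"
proof -
  have "1 - y \<le> 1 + real n * (- x)" using assms by simp
  also have "\<dots> \<le> (1 + (- x)) ^ n" using assms by (intro Bernoulli_inequality) auto
  finally have "1 - y \<le> (1 - x) ^ n" by simp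
  then show ?thesis using assms by (simp add: power_one_over divide_simps)
qed

text \<open>The discount rate of the output weights is a quarter of the drift, so that after summing the
  drift inequality against the weights three quarters of it remain to absorb all error terms.\<close>

lemma weighted_drift_bound:
  fixes a D b v e :: "nat \<Rightarrow> real" and \<alpha> \<phi> U \<Lambda> m1 m4 A1 A2 a0 b0 b1 E0 :: real and \<tau> K T :: nat
  assumes nonneg: "\<And>t. 0 \<le> a t" "\<And>t. 0 \<le> D t" "\<And>t. 0 \<le> b t" "\<And>t. 0 \<le> v t" "\<And>t. 0 \<le> e t"
    and av: "\<And>t. a t \<le> 2 * U * v t" and va: "\<And>t. v t \<le> a t"
    and \<alpha>: "0 < \<alpha>" and \<phi>: "0 < \<phi>" "\<phi> < 1" and U: "1 \<le> U" and \<Lambda>: "0 < \<Lambda>"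
    and A: "0 \<le> A1" "0 \<le> A2" and \<tau>: "1 \<le> \<tau>" "\<tau> \<le> T" and K: "1 \<le> K" and m1: "0 \<le> m1"
    and bounds: "0 \<le> a0" "0 \<le> b0" "0 \<le> b1" "0 \<le> E0"
    and a0: "\<And>t. t \<le> \<tau> \<Longrightarrow> a t \<le> a0" and b0: "\<And>t. b t \<le> b0" and b1: "\<And>t. \<tau> \<le> t \<Longrightarrow> b t \<le> b1"
    and s1: "\<alpha> * real \<tau> \<le> 1 / 24" and s2: "\<alpha> * (real K - 1) \<le> 1 / 2"
    and s3: "\<Lambda> * U * (\<alpha> * real \<tau>) * (A2 + 1)\<^sup>2 \<le> \<phi> / 24"
    and s4: "\<Lambda> * U * (\<alpha> * real \<tau>) * (A1 + 1) * (A2 + 1) \<le> \<phi> / 46"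
    and s5: "\<Lambda> * U * m1 * \<alpha> \<le> \<phi> / 12"
    and s6: "\<alpha> * real K * A2 * (A1 + 1) * (\<Lambda> * U) \<le> \<phi> / 69" and s7: "1 \<le> \<Lambda> * U"
    and De: "\<And>t. D t \<le> 16 * \<alpha>\<^sup>2 * (real K - 1) * A2\<^sup>2 * (\<Sum>r\<in>{t - (K - 1)..<t}. a r + D r) + E0"
    and ee: "\<And>t. \<tau> \<le> t \<Longrightarrow> e t \<le> 3 * \<alpha>\<^sup>2 * real \<tau> * (\<Sum>r\<in>{t - \<tau>..<t}. (A2 + 1)\<^sup>2 * a r + A2\<^sup>2 * D r + b r)"
    and drift: "\<And>t. \<tau> \<le> t \<Longrightarrow> v (Suc t) \<le> (1 - 2 * \<alpha> * \<phi>) * v t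
      + \<alpha> * ((\<Lambda> * m1 * \<alpha>\<^sup>2 + \<phi> / (40 * U) + \<Lambda> * (A2 + 1) * (\<alpha> * real \<tau> * (A2 + 1))) * a (t - \<tau>)
      + 10 * U * \<Lambda>\<^sup>2 * m4\<^sup>2 * \<alpha> ^ 4 / \<phi>
      + \<Lambda> * (2 * (A2 + 1) + (A1 + 1)) / (4 * (\<alpha> * real \<tau> * (A2 + 1))) * e t
      + (\<Lambda> * (A1 + 1) * (\<alpha> * real \<tau> * (A2 + 1)) + \<phi> / (20 * U)) * a t
      + 5 * U * \<Lambda>\<^sup>2 * (A1 + 1)\<^sup>2 / \<phi> * D t
      + \<Lambda> * \<alpha> * real \<tau> * b t
      + 3 / 2 * \<Lambda> * \<alpha> * ((A2 + 1)\<^sup>2 * a t + A2\<^sup>2 * D t + b t))"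
  defines "z \<equiv> 1 / (1 - \<alpha> * \<phi> / 2)"
  defines "W \<equiv> (\<Sum>t<T. z ^ t)"
  shows "(\<Sum>t<T. z ^ t * a t) \<le> 5 / 2 * U / \<phi> *
    ((2 * a0 + \<Lambda> * (A1 + 6) * b0) / \<alpha> + W * (10 * U * \<Lambda>\<^sup>2 * m4\<^sup>2 * \<alpha> ^ 4 / \<phi> + \<Lambda> * (A1 + 6) * (\<alpha> * real \<tau>) * b1
      + (2 * \<Lambda> * (A1 + 6) * A2\<^sup>2 + 10 * U * \<Lambda>\<^sup>2 * (A1 + 1)\<^sup>2 / \<phi>) * E0))"
proof -
  define y where "y = \<alpha> * real \<tau>"
  \<comment> \<open>By \<open>av\<close>, the contraction \<open>\<phi> * v t\<close> is at least
    \<open>r * a t / 2\<close>. All error terms are therefore measured as multiples of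
    \<open>r\<close>.\<close>
  define r where "r = \<phi> / U"
  define x where "x = \<alpha>\<^sup>2 * (real K - 1)\<^sup>2 * A2\<^sup>2"
  define S where "S h = (\<Sum>t<T. z ^ t * h t)" for h
  define S' where "S' h = (\<Sum>t\<in>{\<tau>..<T}. z ^ t * h t)" for h
  define f where "f t = (A2 + 1)\<^sup>2 * a t + A2\<^sup>2 * D t + b t" for t
  have y: "0 < y" "y \<le> 1 / 24" using \<alpha> \<tau> s1 by (auto simp: y_def)
  have "\<alpha> * 1 \<le> \<alpha> * real \<tau>" using \<alpha> \<tau> by (intro mult_left_mono) auto
  then have \<alpha>y: "\<alpha> \<le> y" by (simp add: y_def)
  have \<alpha>24: "\<alpha> \<le> 1 / 24" using \<alpha>y y by simp
  have \<alpha>\<phi>: "0 < \<alpha> * \<phi>" "\<alpha> * \<phi> \<le> \<alpha>" using \<alpha> \<phi> by auto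
  have c: "0 < 1 - \<alpha> * \<phi> / 2" using \<alpha>\<phi> \<alpha>24 by simp
  have z1: "1 \<le> z" using c \<alpha>\<phi> by (simp add: z_def)
  have z0: "0 \<le> z ^ t" for t using z1 by simp
  have r: "0 < r" using \<phi> U by (simp add: r_def)
  \<comment> \<open>Half of \<open>\<alpha> * \<tau> * \<phi>\<close> is at most 1 / 48, and 48 / 47
    = 1 / (1 - 1 / 48).\<close>
  have z\<tau>: "z ^ \<tau> \<le> 48 / 47"
  proof -
    have "real \<tau> * (\<alpha> * \<phi> / 2) = (y * \<phi>) / 2" by (simp add: y_def)
    moreover have "y * \<phi> \<le> y * 1" using y \<phi> by (intro mult_left_mono) auto
    ultimately have "real \<tau> * (\<alpha> * \<phi> / 2) \<le> 1 / 48" using y by linarith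
    then show ?thesis unfolding z_def using inverse_power_le[of "\<alpha> * \<phi> / 2" \<tau> "1 / 48"] c \<alpha>\<phi> by simp
  qed
  have zK: "z ^ (K - 1) \<le> 4 / 3"
  proof -
    have "real (K - 1) * (\<alpha> * \<phi> / 2) = (\<alpha> * (real K - 1)) * \<phi> / 2" using K by (simp add: of_nat_diff)
    moreover have "(\<alpha> * (real K - 1)) * \<phi> \<le> (1 / 2) * 1" using s2 \<phi> \<alpha> K by (intro mult_mono) auto
    ultimately have "real (K - 1) * (\<alpha> * \<phi> / 2) \<le> 1 / 4" by linarith
    then show ?thesis unfolding z_def using inverse_power_le[of "\<alpha> * \<phi> / 2" "K - 1" "1 / 4"] c \<alpha>\<phi> by simp
  qed
  have Sn: "0 \<le> S h" if "\<And>t. 0 \<le> h t" for h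
    unfolding S_def using that z0 by (intro sum_nonneg mult_nonneg_nonneg) auto
  have S'S: "S' h \<le> S h" if "\<And>t. 0 \<le> h t" for h
    unfolding S_def S'_def using that z0 by (intro sum_tail_le mult_nonneg_nonneg) auto
  have f0: "0 \<le> f t" for t unfolding f_def using nonneg by (intro add_nonneg_nonneg mult_nonneg_nonneg) auto
  note Sa0 = Sn[of a, OF nonneg(1)] and SD0 = Sn[of D, OF nonneg(2)] and Sb0 = Sn[of b, OF nonneg(3)] and Sf0 = Sn[of f, OF f0]
  have W0: "0 \<le> W" unfolding W_def using z0 by (intro sum_nonneg)
  have p1: "\<Lambda> * y * (A2 + 1)\<^sup>2 \<le> r / 24" using s3 U unfolding r_def y_def by (simp add: field_simps)
  have p2: "\<Lambda> * y * (A1 + 1) * (A2 + 1) \<le> r / 46" using s4 U unfolding r_def y_def by (simp add: field_simps)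
  have p3: "\<Lambda> * m1 * \<alpha> \<le> r / 12" using s5 U unfolding r_def by (simp add: field_simps)
  have x0: "0 \<le> x" by (simp add: x_def)
  \<comment> \<open>The condition with \<open>\<phi> / 69\<close>, squared; 4761 is the square of
    69.\<close>
  have xK: "x * (A1 + 1)\<^sup>2 * (\<Lambda> * U)\<^sup>2 \<le> \<phi>\<^sup>2 / 4761"
  proof -
    have "x * (A1 + 1)\<^sup>2 * (\<Lambda> * U)\<^sup>2 = (\<alpha> * (real K - 1) * A2 * (A1 + 1) * (\<Lambda> * U))\<^sup>2"
      by (simp add: x_def power_mult_distrib)
    also have "\<dots> \<le> (\<phi> / 69)\<^sup>2"
    proof (rule power_mono)
      have "\<alpha> * (real K - 1) * A2 * (A1 + 1) * (\<Lambda> * U) \<le> \<alpha> * real K * A2 * (A1 + 1) * (\<Lambda> * U)"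
        using \<alpha> A \<Lambda> U K by (intro mult_right_mono mult_left_mono) auto
      then show "\<alpha> * (real K - 1) * A2 * (A1 + 1) * (\<Lambda> * U) \<le> \<phi> / 69" using s6 by linarith
      show "0 \<le> \<alpha> * (real K - 1) * A2 * (A1 + 1) * (\<Lambda> * U)" using \<alpha> A \<Lambda> U K by simp
    qed
    finally show ?thesis by (simp add: power_divide)
  qed
  have x1: "x \<le> 1 / 4761"
  proof -
    have "1 \<le> (A1 + 1)\<^sup>2 * (\<Lambda> * U)\<^sup>2"
      using A s7 one_le_power[of "(A1 + 1)" 2] one_le_power[of "\<Lambda> * U" 2] mult_mono[of 1 "(A1 + 1)\<^sup>2" 1 "(\<Lambda> * U)\<^sup>2"] by simp
    then have "x * 1 \<le> x * ((A1 + 1)\<^sup>2 * (\<Lambda> * U)\<^sup>2)" using x0 by (rule mult_left_mono)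
    also have "\<dots> \<le> \<phi>\<^sup>2 / 4761" using xK by (simp add: mult.assoc)
    also have "\<dots> \<le> 1 / 4761" using \<phi> power_le_one[of \<phi> 2] by (intro divide_right_mono) auto
    finally show ?thesis by simp
  qed
  define cD where "cD = 5 * U * \<Lambda>\<^sup>2 * (A1 + 1)\<^sup>2 / \<phi>"
  have cD0: "0 \<le> cD" using U \<phi> by (simp add: cD_def)
  have p5: "cD * x \<le> 5 / 4761 * r"
  proof -
    \<comment> \<open>The division by \<open>\<phi>\<close> inside \<open>cD\<close> is paid for by
      the square of \<open>\<phi>\<close> in \<open>xK\<close>.\<close>
    have "cD * x = 5 / (\<phi> * U) * (x * (A1 + 1)\<^sup>2 * (\<Lambda> * U)\<^sup>2)"
      using U \<phi> by (simp add: cD_def power_mult_distrib field_simps power2_eq_square)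
    also have "\<dots> \<le> 5 / (\<phi> * U) * (\<phi>\<^sup>2 / 4761)" using xK U \<phi> by (intro mult_left_mono) auto
    also have "\<dots> = 5 / 4761 * r" using U \<phi> by (simp add: r_def power2_eq_square)
    finally show ?thesis .
  qed
  have SD: "S D \<le> 43 / 2 * x * S a + 11 / 10 * (W * E0)"
  proof -
    have "S D \<le> (\<Sum>t<T. z ^ t * (16 * \<alpha>\<^sup>2 * (real K - 1) * A2\<^sup>2 * (\<Sum>r\<in>{t - (K - 1)..<t}. a r + D r) + E0))"
      unfolding S_def using z0 De by (intro sum_mono mult_left_mono) auto
    also have "\<dots> = 16 * \<alpha>\<^sup>2 * (real K - 1) * A2\<^sup>2 * (\<Sum>t<T. z ^ t * (\<Sum>r\<in>{t - (K - 1)..<t}. a r + D r)) + W * E0"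
      by (simp add: W_def distrib_left sum.distrib sum_distrib_left sum_distrib_right mult_ac)
    also have "\<dots> \<le> 16 * \<alpha>\<^sup>2 * (real K - 1) * A2\<^sup>2 * (real (K - 1) * z ^ (K - 1) * (\<Sum>t<T. z ^ t * (a t + D t))) + W * E0"
      using K nonneg by (intro add_right_mono mult_left_mono weighted_window_sum z1) auto
    also have "\<dots> = 16 * x * z ^ (K - 1) * (S a + S D) + W * E0"
      using K by (simp add: x_def S_def distrib_left sum.distrib of_nat_diff power2_eq_square mult_ac)
    also have "\<dots> \<le> 16 * x * (4 / 3) * (S a + S D) + W * E0"
      using zK x0 Sa0 SD0 by (intro add_right_mono mult_right_mono mult_left_mono) auto
    finally have 1: "S D \<le> 64 / 3 * (x * S a) + 64 / 3 * (x * S D) + W * E0" by (simp add: algebra_simps add_divide_distrib)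
    \<comment> \<open>Here the self-reference of the client deviation is absorbed:
      \<open>64 / 3 * x\<close> is far below 1. The constants 43 / 2 and 11 / 10 round up the result
      of dividing by \<open>1 - 64 / (3 * 4761)\<close>.\<close>
    have "x * S D \<le> 1 / 4761 * S D" using x1 SD0 by (rule mult_right_mono)
    then have "S D * (1 - 64 / (3 * 4761)) \<le> 64 / 3 * (x * S a) + W * E0" using 1 by simp
    moreover have "0 \<le> x * S a" "0 \<le> W * E0" using x0 Sa0 W0 bounds by auto
    ultimately show ?thesis by simp
  qed
  have Sf: "S f \<le> 101 / 100 * (A2 + 1)\<^sup>2 * S a + 11 / 10 * A2\<^sup>2 * (W * E0) + S b"
  proof -
    have eq: "S f = (A2 + 1)\<^sup>2 * S a + A2\<^sup>2 * S D + S b"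
      by (simp add: S_def f_def distrib_left sum.distrib sum_distrib_left mult_ac)
    have "A2\<^sup>2 * S D \<le> A2\<^sup>2 * (43 / 2 * x * S a + 11 / 10 * (W * E0))" using SD by (intro mult_left_mono) auto
    also have "\<dots> = (43 / 2 * x) * (A2\<^sup>2 * S a) + 11 / 10 * A2\<^sup>2 * (W * E0)" by (simp add: algebra_simps)
    also have "\<dots> \<le> (1 / 100) * ((A2 + 1)\<^sup>2 * S a) + 11 / 10 * A2\<^sup>2 * (W * E0)"
      using x1 x0 A Sa0 by (intro add_right_mono mult_mono mult_right_mono power_mono) auto
    finally show ?thesis unfolding eq by simp
  qed
  \<comment> \<open>Before time \<open>\<tau>\<close> the mean of the noise has not decayed and only
    \<open>b0\<close> is available. As \<open>\<alpha> * \<tau> \<le> 1 / 24\<close>, these times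
    amount to a multiple of \<open>b0 / \<alpha>\<close>, which ends up in the transient
    term.\<close>
  have Sb: "S b \<le> W * b1 + b0 / (20 * \<alpha>)"
  proof -
    have "S b = (\<Sum>t<\<tau>. z ^ t * b t) + (\<Sum>t\<in>{\<tau>..<T}. z ^ t * b t)"
      unfolding S_def lessThan_atLeast0 by (rule sum.atLeastLessThan_concat[symmetric]) (use \<tau> in auto)
    also have "\<dots> \<le> (\<Sum>t<\<tau>. 48 / 47 * b0) + (\<Sum>t\<in>{\<tau>..<T}. z ^ t * b1)"
    proof (intro add_mono sum_mono mult_mono mult_left_mono b0 b1 nonneg)
      fix t assume "t \<in> {..<\<tau>}"
      then have "z ^ t \<le> z ^ \<tau>" using z1 by (intro power_increasing) auto
      then show "z ^ t \<le> 48 / 47" using z\<tau> by linarith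
    qed (use z0 in auto)
    also have "\<dots> \<le> 48 / 47 * real \<tau> * b0 + W * b1"
    proof -
      have "(\<Sum>t\<in>{\<tau>..<T}. z ^ t * b1) \<le> (\<Sum>t<T. z ^ t * b1)" using z0 bounds by (intro sum_tail_le) auto
      then show ?thesis by (simp add: W_def sum_distrib_right)
    qed
    also have "48 / 47 * real \<tau> * b0 \<le> b0 / (20 * \<alpha>)"
    proof -
      have "48 / 47 * real \<tau> \<le> 1 / (20 * \<alpha>)" using s1 \<alpha> by (simp add: field_simps)
      from mult_right_mono[OF this bounds(2)] show ?thesis by simp
    qed
    finally show ?thesis by simp
  qed
  have Sa: "S a \<le> a0 / (20 * \<alpha>) + S' a"
  proof -
    have "S a = (\<Sum>t<\<tau>. z ^ t * a t) + S' a"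
      unfolding S_def S'_def lessThan_atLeast0 by (rule sum.atLeastLessThan_concat[symmetric]) (use \<tau> in auto)
    also have "\<dots> \<le> (\<Sum>t<\<tau>. 48 / 47 * a0) + S' a"
    proof (intro add_mono sum_mono mult_mono a0 nonneg order_refl)
      fix t assume t: "t \<in> {..<\<tau>}"
      then have "z ^ t \<le> z ^ \<tau>" using z1 by (intro power_increasing) auto
      then show "z ^ t \<le> 48 / 47" using z\<tau> by linarith
      show "t \<le> \<tau>" using t by simp
    qed auto
    also have "(\<Sum>t<\<tau>. 48 / 47 * a0) = (48 / 47 * real \<tau>) * a0" by simp
    also have "\<dots> \<le> 1 / (20 * \<alpha>) * a0" using s1 \<alpha> bounds by (intro mult_right_mono) (auto simp: field_simps)
    finally show ?thesis by simp
  qed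
  \<comment> \<open>The window sum supplies the second factor \<open>\<tau>\<close>; 31 / 10 rounds
    up 3 * 48 / 47.\<close>
  have Se: "S' e \<le> 31 / 10 * y\<^sup>2 * S f"
  proof -
    have "S' e \<le> (\<Sum>t\<in>{\<tau>..<T}. z ^ t * (3 * \<alpha>\<^sup>2 * real \<tau> * (\<Sum>r\<in>{t - \<tau>..<t}. f r)))"
      unfolding S'_def using z0 ee by (intro sum_mono mult_left_mono) (auto simp: f_def)
    also have "\<dots> \<le> (\<Sum>t<T. z ^ t * (3 * \<alpha>\<^sup>2 * real \<tau> * (\<Sum>r\<in>{t - \<tau>..<t}. f r)))"
      using z0 f0 by (intro sum_tail_le mult_nonneg_nonneg sum_nonneg) auto
    also have "\<dots> = 3 * \<alpha>\<^sup>2 * real \<tau> * (\<Sum>t<T. z ^ t * (\<Sum>r\<in>{t - \<tau>..<t}. f r))"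
      by (simp add: sum_distrib_left mult_ac)
    also have "\<dots> \<le> 3 * \<alpha>\<^sup>2 * real \<tau> * (real \<tau> * z ^ \<tau> * S f)"
      unfolding S_def by (intro mult_left_mono weighted_window_sum z1 f0) auto
    also have "\<dots> = 3 * y\<^sup>2 * z ^ \<tau> * S f" by (simp add: y_def power2_eq_square mult_ac)
    also have "\<dots> \<le> 3 * y\<^sup>2 * (48 / 47) * S f" using z\<tau> Sf0 by (intro mult_right_mono mult_left_mono) auto
    also have "\<dots> \<le> 31 / 10 * y\<^sup>2 * S f" using Sf0 by (intro mult_right_mono) auto
    finally show ?thesis .
  qed
  define R where "R t = (\<Lambda> * m1 * \<alpha>\<^sup>2 + \<phi> / (40 * U) + \<Lambda> * (A2 + 1) * (y * (A2 + 1))) * a (t - \<tau>)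
      + 10 * U * \<Lambda>\<^sup>2 * m4\<^sup>2 * \<alpha> ^ 4 / \<phi>
      + \<Lambda> * (2 * (A2 + 1) + (A1 + 1)) / (4 * (y * (A2 + 1))) * e t
      + (\<Lambda> * (A1 + 1) * (y * (A2 + 1)) + \<phi> / (20 * U)) * a t
      + cD * D t + \<Lambda> * y * b t + 3 / 2 * \<Lambda> * \<alpha> * f t" for t
  have drift': "v (Suc t) \<le> (1 - 2 * \<alpha> * \<phi>) * v t + \<alpha> * R t" if "\<tau> \<le> t" for t
    using drift[OF that] by (simp only: R_def y_def cD_def f_def mult.assoc)
  \<comment> \<open>A summed Gronwall argument: shifting the sum by one step and multiplying by
    \<open>1 - \<alpha> * \<phi> / 2\<close>, the inverse of \<open>z\<close>, leaves
    \<open>2 * \<alpha> * \<phi> - \<alpha> * \<phi> / 2\<close> of the drift in front of the sum of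
    \<open>v\<close>.\<close>
  have main: "3 / 4 * r * S' a \<le> 11 / 10 * a0 / \<alpha> + S' R"
  proof -
    have "(\<Sum>t\<in>{\<tau>..<T}. z ^ Suc t * v (Suc t)) \<le> (\<Sum>t\<in>{\<tau>..<T}. z ^ Suc t * ((1 - 2 * \<alpha> * \<phi>) * v t + \<alpha> * R t))"
      using z0 drift' z1 by (intro sum_mono mult_left_mono) auto
    also have "\<dots> = z * ((1 - 2 * \<alpha> * \<phi>) * S' v + \<alpha> * S' R)"
      by (simp add: S'_def distrib_left sum.distrib sum_distrib_left mult_ac)
    also have "(\<Sum>t\<in>{\<tau>..<T}. z ^ Suc t * v (Suc t)) = (\<Sum>t\<in>{Suc \<tau>..<Suc T}. z ^ t * v t)"
      by (rule sum.atLeast_Suc_lessThan_Suc_shift[symmetric, unfolded comp_def])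
    finally have 1: "(\<Sum>t\<in>{Suc \<tau>..<Suc T}. z ^ t * v t) \<le> z * ((1 - 2 * \<alpha> * \<phi>) * S' v + \<alpha> * S' R)" .
    have "S' v \<le> (\<Sum>t\<in>{\<tau>..<Suc T}. z ^ t * v t)"
      unfolding S'_def using z0 nonneg by (intro sum_mono2) auto
    also have "\<dots> = z ^ \<tau> * v \<tau> + (\<Sum>t\<in>{Suc \<tau>..<Suc T}. z ^ t * v t)"
      by (rule sum.atLeast_Suc_lessThan) (use \<tau> in simp)
    finally have 2: "S' v \<le> z ^ \<tau> * v \<tau> + z * ((1 - 2 * \<alpha> * \<phi>) * S' v + \<alpha> * S' R)" using 1 by linarith
    have cz: "(1 - \<alpha> * \<phi> / 2) * z = 1" using c by (simp add: z_def)
    have "(1 - \<alpha> * \<phi> / 2) * S' v \<le> (1 - \<alpha> * \<phi> / 2) * (z ^ \<tau> * v \<tau> + z * ((1 - 2 * \<alpha> * \<phi>) * S' v + \<alpha> * S' R))"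
      using 2 c by (intro mult_left_mono) auto
    also have "\<dots> = (1 - \<alpha> * \<phi> / 2) * (z ^ \<tau> * v \<tau>) + ((1 - \<alpha> * \<phi> / 2) * z) * ((1 - 2 * \<alpha> * \<phi>) * S' v + \<alpha> * S' R)"
      by (simp only: distrib_left mult.assoc)
    also have "\<dots> \<le> 1 * (z ^ \<tau> * v \<tau>) + ((1 - 2 * \<alpha> * \<phi>) * S' v + \<alpha> * S' R)"
      unfolding cz using z0[of \<tau>] nonneg(4)[of \<tau>] \<alpha>\<phi> by (intro add_mono mult_right_mono) auto
    finally have "3 / 2 * \<alpha> * \<phi> * S' v \<le> z ^ \<tau> * v \<tau> + \<alpha> * S' R" by (simp add: algebra_simps)
    also have "z ^ \<tau> * v \<tau> \<le> 48 / 47 * a0"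
      using z\<tau> order_trans[OF va a0[OF order_refl]] nonneg by (intro mult_mono) auto
    finally have "\<alpha> * (3 / 2 * \<phi> * S' v) \<le> \<alpha> * (48 / 47 * a0 / \<alpha> + S' R)" using \<alpha> by (simp add: algebra_simps)
    then have 3: "3 / 2 * \<phi> * S' v \<le> 48 / 47 * a0 / \<alpha> + S' R" using \<alpha> by (simp only: mult_le_cancel_left_pos)
    have "S' a \<le> 2 * U * S' v"
      unfolding S'_def sum_distrib_left using mult_left_mono[OF av z0] by (intro sum_mono) (simp add: mult_ac)
    then have "3 / 4 * r * S' a \<le> 3 / 4 * r * (2 * U * S' v)" using r by (intro mult_left_mono) auto
    also have "\<dots> = 3 / 2 * \<phi> * S' v" using U by (simp add: r_def)
    also have "\<dots> \<le> 48 / 47 * a0 / \<alpha> + S' R" by (rule 3)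
    also have "48 / 47 * a0 / \<alpha> \<le> 11 / 10 * a0 / \<alpha>" using bounds \<alpha> by (intro divide_right_mono mult_right_mono) auto
    finally show ?thesis by simp
  qed
  define Q where "Q = r * S a"
  have Q0: "0 \<le> Q" using r Sa0 by (simp add: Q_def)
  define ke where "ke = \<Lambda> * (2 * (A2 + 1) + (A1 + 1)) / (4 * (y * (A2 + 1)))"
  have ke0: "0 \<le> ke" using \<Lambda> A y by (simp add: ke_def)
  \<comment> \<open>The square of \<open>y\<close> in the displacement bound cancels the
    \<open>1 / y\<close> from the weighted splitting. One factor \<open>y\<close> survives, so this
    error is small along with \<open>\<alpha> * \<tau>\<close>.\<close>
  have key: "ke * (31 / 10 * y\<^sup>2) = 31 / 40 * \<Lambda> * y * (2 * (A2 + 1) + (A1 + 1)) / (A2 + 1)"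
    using y A by (simp add: ke_def power2_eq_square)
  define kf where "kf = ke * (31 / 10 * y\<^sup>2) + 3 / 2 * \<Lambda> * \<alpha>"
  have kf0: "0 \<le> kf" using ke0 \<Lambda> \<alpha> by (simp add: kf_def)
  have kf1: "kf * (A2 + 1)\<^sup>2 \<le> (31 / 40 * (2 / 24 + 1 / 46) + 3 / 2 / 24) * r"
  proof -
    have "31 / 40 * \<Lambda> * y * (2 * (A2 + 1) + (A1 + 1)) / (A2 + 1) * (A2 + 1)\<^sup>2
      = 31 / 40 * (2 * (\<Lambda> * y * (A2 + 1)\<^sup>2) + \<Lambda> * y * (A1 + 1) * (A2 + 1))"
    proof -
      have "q / (A2 + 1) * (A2 + 1)\<^sup>2 = q * (A2 + 1)" for q using A by (simp add: power2_eq_square)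
      then show ?thesis by (simp only:) (simp add: power2_eq_square algebra_simps)
    qed
    also have "\<dots> \<le> 31 / 40 * (2 * (r / 24) + r / 46)" using p1 p2 by (intro mult_left_mono add_mono) auto
    finally have 1: "ke * (31 / 10 * y\<^sup>2) * (A2 + 1)\<^sup>2 \<le> 31 / 40 * (2 * (r / 24) + r / 46)" unfolding key .
    have "\<Lambda> * \<alpha> * (A2 + 1)\<^sup>2 \<le> \<Lambda> * y * (A2 + 1)\<^sup>2" using \<alpha>y \<Lambda> by (intro mult_right_mono mult_left_mono) auto
    then have 2: "\<Lambda> * \<alpha> * (A2 + 1)\<^sup>2 \<le> r / 24" using p1 by linarith
    have "kf * (A2 + 1)\<^sup>2 = ke * (31 / 10 * y\<^sup>2) * (A2 + 1)\<^sup>2 + 3 / 2 * (\<Lambda> * \<alpha> * (A2 + 1)\<^sup>2)"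
      by (simp add: kf_def algebra_simps)
    also have "\<dots> \<le> 31 / 40 * (2 * (r / 24) + r / 46) + 3 / 2 * (r / 24)" using 1 2 by linarith
    also have "\<dots> = (31 / 40 * (2 / 24 + 1 / 46) + 3 / 2 / 24) * r" by (simp add: field_simps)
    finally show ?thesis .
  qed
  have kf2: "kf \<le> \<Lambda> * (A1 + 5) * y"
  proof -
    have "(2 * (A2 + 1) + (A1 + 1)) / (A2 + 1) = 2 + (A1 + 1) / (A2 + 1)"
    proof -
      have ne: "A2 + 1 \<noteq> 0" using A by simp
      show ?thesis by (simp only: add_divide_distrib nonzero_mult_div_cancel_right[OF ne])
    qed
    also have "\<dots> \<le> 2 + (A1 + 1) / 1" using A by (intro add_left_mono divide_left_mono) auto
    finally have "31 / 40 * \<Lambda> * y * ((2 * (A2 + 1) + (A1 + 1)) / (A2 + 1)) \<le> 1 * \<Lambda> * y * (A1 + 3)"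
      using \<Lambda> y A by (intro mult_mono) auto
    moreover have "3 / 2 * \<Lambda> * \<alpha> \<le> 2 * \<Lambda> * y" using \<alpha>y \<alpha> \<Lambda> by (intro mult_mono) auto
    ultimately show ?thesis unfolding kf_def key by (simp add: algebra_simps)
  qed
  have shift: "S' (\<lambda>t. a (t - \<tau>)) \<le> 48 / 47 * S a"
  proof -
    have "S' (\<lambda>t. a (t - \<tau>)) \<le> z ^ \<tau> * S a" unfolding S_def S'_def by (rule weighted_shift_sum[OF z1 nonneg(1)])
    also have "\<dots> \<le> 48 / 47 * S a" using z\<tau> Sa0 by (rule mult_right_mono)
    finally show ?thesis .
  qed
  define k1 where "k1 = \<Lambda> * m1 * \<alpha>\<^sup>2 + \<phi> / (40 * U) + \<Lambda> * (A2 + 1) * (y * (A2 + 1))"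
  have k10: "0 \<le> k1" using \<Lambda> m1 \<phi> U y A by (simp add: k1_def)
  have k1: "k1 \<le> (1 / 288 + 1 / 40 + 1 / 24) * r"
  proof -
    have "\<Lambda> * m1 * \<alpha>\<^sup>2 = (\<Lambda> * m1 * \<alpha>) * \<alpha>" by (simp add: power2_eq_square)
    also have "\<dots> \<le> (r / 12) * (1 / 24)" using p3 \<alpha>24 \<Lambda> m1 \<alpha> r by (intro mult_mono) auto
    finally have "\<Lambda> * m1 * \<alpha>\<^sup>2 \<le> r / 288" by simp
    moreover have "\<phi> / (40 * U) = r / 40" by (simp add: r_def)
    moreover have "\<Lambda> * (A2 + 1) * (y * (A2 + 1)) = \<Lambda> * y * (A2 + 1)\<^sup>2" by (simp add: power2_eq_square mult_ac)
    ultimately show ?thesis unfolding k1_def using p1 by (simp add: algebra_simps)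
  qed
  define k2 where "k2 = \<Lambda> * (A1 + 1) * (y * (A2 + 1)) + \<phi> / (20 * U)"
  have k20: "0 \<le> k2" using \<Lambda> \<phi> U y A by (simp add: k2_def)
  have k2: "k2 \<le> (1 / 46 + 1 / 20) * r"
    using p2 by (simp add: k2_def r_def algebra_simps)
  define n0 where "n0 = 10 * U * \<Lambda>\<^sup>2 * m4\<^sup>2 * \<alpha> ^ 4 / \<phi>"
  have n00: "0 \<le> n0" using U \<phi> by (simp add: n0_def)
  have SR: "S' R \<le> (48 / 47 * (1 / 288 + 1 / 40 + 1 / 24)
      + (1 / 46 + 1 / 20) + 43 / 2 * 5 / 4761 + 101 / 100 * (31 / 40 * (2 / 24 + 1 / 46) + 3 / 2 / 24)) * Q
      + (W * n0 + (11 / 10 * kf * A2\<^sup>2 + 11 / 10 * cD) * (W * E0) + (kf + \<Lambda> * y) * S b)"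
  proof -
    have "S' R = k1 * S' (\<lambda>t. a (t - \<tau>)) + S' (\<lambda>t. n0) + ke * S' e + k2 * S' a + cD * S' D + \<Lambda> * y * S' b + 3 / 2 * \<Lambda> * \<alpha> * S' f"
      unfolding S'_def R_def k1_def[symmetric] k2_def[symmetric] n0_def[symmetric] ke_def[symmetric]
      by (simp only: distrib_left sum.distrib sum_distrib_left mult_ac)
    also have "\<dots> \<le> k1 * (48 / 47 * S a) + W * n0 + ke * (31 / 10 * y\<^sup>2 * S f) + k2 * S a + cD * S D + \<Lambda> * y * S b + 3 / 2 * \<Lambda> * \<alpha> * S f"
    proof (intro add_mono mult_left_mono shift Se S'S nonneg k10 ke0 k20 cD0 f0)
      have "S' (\<lambda>t. n0) \<le> S (\<lambda>t. n0)" by (rule S'S[OF n00])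
      then show "S' (\<lambda>t. n0) \<le> W * n0" by (simp add: S_def W_def sum_distrib_right)
    qed (use \<Lambda> y \<alpha> in auto)
    also have "\<dots> = k1 * (48 / 47 * S a) + W * n0 + kf * S f + k2 * S a + cD * S D + \<Lambda> * y * S b"
      by (simp add: kf_def algebra_simps)
    also have "\<dots> \<le> k1 * (48 / 47 * S a) + W * n0
        + kf * (101 / 100 * (A2 + 1)\<^sup>2 * S a + 11 / 10 * A2\<^sup>2 * (W * E0) + S b) + k2 * S a
        + cD * (43 / 2 * x * S a + 11 / 10 * (W * E0)) + \<Lambda> * y * S b"
      by (intro add_mono mult_left_mono Sf SD order_refl kf0 cD0)
    also have "\<dots> = (48 / 47 * k1 + k2 + 43 / 2 * (cD * x) + 101 / 100 * (kf * (A2 + 1)\<^sup>2)) * S a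
        + (W * n0 + (11 / 10 * kf * A2\<^sup>2 + 11 / 10 * cD) * (W * E0) + (kf + \<Lambda> * y) * S b)"
      by (simp add: algebra_simps)
    also have "(48 / 47 * k1 + k2 + 43 / 2 * (cD * x) + 101 / 100 * (kf * (A2 + 1)\<^sup>2)) * S a
      \<le> (48 / 47 * ((1 / 288 + 1 / 40 + 1 / 24) * r) + (1 / 46 + 1 / 20) * r + 43 / 2 * (5 / 4761 * r)
        + 101 / 100 * ((31 / 40 * (2 / 24 + 1 / 46) + 3 / 2 / 24) * r)) * S a"
      by (intro mult_right_mono add_mono mult_left_mono k1 k2 p5 kf1 Sa0) auto
    also have "\<dots> = (48 / 47 * (1 / 288 + 1 / 40 + 1 / 24)
      + (1 / 46 + 1 / 20) + 43 / 2 * 5 / 4761 + 101 / 100 * (31 / 40 * (2 / 24 + 1 / 46) + 3 / 2 / 24)) * Q"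
      by (simp add: Q_def field_simps)
    finally show ?thesis by simp
  qed
  have num: "48 / 47 * (1 / 288 + 1 / 40 + 1 / 24)
      + (1 / 46 + 1 / 20) + 43 / 2 * 5 / 4761 + 101 / 100 * (31 / 40 * (2 / 24 + 1 / 46) + 3 / 2 / 24) \<le> (7 / 20 :: real)"
    by simp
  define rest where "rest = W * n0 + (11 / 10 * kf * A2\<^sup>2 + 11 / 10 * cD) * (W * E0) + (kf + \<Lambda> * y) * S b"
  have SR': "S' R \<le> 7 / 20 * Q + rest" using SR mult_right_mono[OF num Q0] unfolding rest_def by linarith
  have "2 / 5 * Q \<le> 2 * a0 / \<alpha> + rest"
  proof -
    have "3 / 4 * Q \<le> 3 / 4 * r * (a0 / (20 * \<alpha>) + S' a)"
      unfolding Q_def using Sa r by simp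
    also have "\<dots> = 3 / 80 * (r * (a0 / \<alpha>)) + 3 / 4 * r * S' a" by (simp add: algebra_simps)
    also have "r * (a0 / \<alpha>) \<le> 1 * (a0 / \<alpha>)"
    proof (rule mult_right_mono)
      show "r \<le> 1" unfolding r_def using \<phi> U by simp
    qed (use bounds \<alpha> in auto)
    finally have "3 / 4 * Q \<le> 3 / 80 * (a0 / \<alpha>) + (11 / 10 * (a0 / \<alpha>) + (7 / 20 * Q + rest))" using main SR' by simp
    moreover have "0 \<le> a0 / \<alpha>" using bounds \<alpha> by simp
    ultimately show ?thesis by simp
  qed
  also have "rest \<le> \<Lambda> * (A1 + 6) * b0 / \<alpha> + W * (n0 + \<Lambda> * (A1 + 6) * y * b1 + (2 * \<Lambda> * (A1 + 6) * A2\<^sup>2 + 2 * cD) * E0)"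
  proof -
    have k6: "kf + \<Lambda> * y \<le> \<Lambda> * (A1 + 6) * y" using kf2 by (simp add: algebra_simps)
    have k60: "0 \<le> \<Lambda> * (A1 + 6) * y" using \<Lambda> A y by simp
    have ky1: "\<Lambda> * (A1 + 6) * y \<le> \<Lambda> * (A1 + 6)" using \<Lambda> A y by (intro mult_right_le_one_le) auto
    have "(kf + \<Lambda> * y) * S b \<le> \<Lambda> * (A1 + 6) * y * (W * b1 + b0 / (20 * \<alpha>))"
      using k6 Sb k60 Sb0 by (intro mult_mono) auto
    also have "\<dots> = W * (\<Lambda> * (A1 + 6) * y * b1) + \<Lambda> * (A1 + 6) * y * (b0 / (20 * \<alpha>))" by (simp add: algebra_simps)
    also have "\<Lambda> * (A1 + 6) * y * (b0 / (20 * \<alpha>)) \<le> \<Lambda> * (A1 + 6) * (b0 / \<alpha>)"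
    proof (rule mult_mono[OF ky1])
      have "b0 / \<alpha> / 20 \<le> b0 / \<alpha> / 1" using bounds \<alpha> by (intro divide_left_mono) auto
      then show "b0 / (20 * \<alpha>) \<le> b0 / \<alpha>" by (simp add: mult.commute)
    qed (use \<Lambda> A bounds \<alpha> in auto)
    finally have b: "(kf + \<Lambda> * y) * S b \<le> W * (\<Lambda> * (A1 + 6) * y * b1) + \<Lambda> * (A1 + 6) * b0 / \<alpha>" by simp
    have "0 \<le> \<Lambda> * y" using \<Lambda> y by simp
    then have "kf \<le> \<Lambda> * (A1 + 6)" using k6 ky1 by linarith
    then have "11 / 10 * kf \<le> 2 * (\<Lambda> * (A1 + 6))" using kf0 by linarith
    then have "11 / 10 * kf * A2\<^sup>2 \<le> 2 * (\<Lambda> * (A1 + 6)) * A2\<^sup>2" by (rule mult_right_mono) simp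
    then have "11 / 10 * kf * A2\<^sup>2 + 11 / 10 * cD \<le> 2 * \<Lambda> * (A1 + 6) * A2\<^sup>2 + 2 * cD"
      using cD0 by (simp add: mult.assoc)
    then have "(11 / 10 * kf * A2\<^sup>2 + 11 / 10 * cD) * (W * E0) \<le> (2 * \<Lambda> * (A1 + 6) * A2\<^sup>2 + 2 * cD) * (W * E0)"
      by (rule mult_right_mono) (use W0 bounds in simp)
    then show ?thesis unfolding rest_def using b by (simp add: algebra_simps)
  qed
  finally have fin: "2 / 5 * Q \<le> 2 * a0 / \<alpha> + (\<Lambda> * (A1 + 6) * b0 / \<alpha>
      + W * (n0 + \<Lambda> * (A1 + 6) * y * b1 + (2 * \<Lambda> * (A1 + 6) * A2\<^sup>2 + 2 * cD) * E0))" by simp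
  have "S a = 5 / 2 * U / \<phi> * (2 / 5 * Q)" using U \<phi> by (simp add: Q_def r_def)
  also have "\<dots> \<le> 5 / 2 * U / \<phi> * (2 * a0 / \<alpha> + (\<Lambda> * (A1 + 6) * b0 / \<alpha>
      + W * (n0 + \<Lambda> * (A1 + 6) * y * b1 + (2 * \<Lambda> * (A1 + 6) * A2\<^sup>2 + 2 * cD) * E0)))"
    using fin U \<phi> by (intro mult_left_mono) auto
  also have "2 * a0 / \<alpha> + (\<Lambda> * (A1 + 6) * b0 / \<alpha>
      + W * (n0 + \<Lambda> * (A1 + 6) * y * b1 + (2 * \<Lambda> * (A1 + 6) * A2\<^sup>2 + 2 * cD) * E0))
    = (2 * a0 + \<Lambda> * (A1 + 6) * b0) / \<alpha> + W * (10 * U * \<Lambda>\<^sup>2 * m4\<^sup>2 * \<alpha> ^ 4 / \<phi> + \<Lambda> * (A1 + 6) * (\<alpha> * real \<tau>) * b1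
      + (2 * \<Lambda> * (A1 + 6) * A2\<^sup>2 + 10 * U * \<Lambda>\<^sup>2 * (A1 + 1)\<^sup>2 / \<phi>) * E0)"
    by (simp add: n0_def y_def cD_def add_divide_distrib)
  finally show ?thesis by (simp only: S_def)
qed

section \<open>Sampling and step sizes\<close>

text \<open>The weights sum to 1, so the sampled time is almost surely below \<open>T\<close> and
  the variable is a finite sum over the events that it equals \<open>t\<close>. Each
  \<open>f t\<close> is a function of the independent sigma-algebra, hence every summand
  factors.\<close>

lemma (in prob_space) expectation_at_independent_time:
  fixes f :: "nat \<Rightarrow> 'a \<Rightarrow> real" and R :: "'a \<Rightarrow> nat"
  assumes R: "R \<in> measurable M (count_space UNIV)" and F: "subalgebra M F"
    and ind: "indep_set (sets (vimage_algebra (space M) R (count_space UNIV))) (sets F)"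
    and q: "\<And>t. t < T \<Longrightarrow> measure M {\<omega> \<in> space M. R \<omega> = t} = q t" "(\<Sum>t<T. q t) = 1"
    and f: "\<And>t. bounded_rv F (f t)"
  shows "(\<integral>\<omega>. f (R \<omega>) \<omega> \<partial>M) = (\<Sum>t<T. q t * (\<integral>\<omega>. f t \<omega> \<partial>M))"
proof -
  define A where "A t = {\<omega> \<in> space M. R \<omega> = t}" for t
  have Aeq: "A t = R -` {t} \<inter> space M" for t by (auto simp: A_def)
  have AR: "A t \<in> sets (vimage_algebra (space M) R (count_space UNIV))" for t
    unfolding Aeq by (rule in_vimage_algebra) simp
  have AM: "A t \<in> sets M" for t unfolding Aeq using measurable_sets[OF R, of "{t}"] by simp
  have fM: "bounded_rv M (f t)" for t by (rule bounded_rv_mono[OF F f])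
  have IM: "bounded_rv M (\<lambda>\<omega>. indicator (A t) \<omega> :: real)" for t by (rule bounded_rv_indicator[OF AM])
  have "(\<Sum>t<T. measure M (A t)) = measure M (\<Union>t<T. A t)"
  proof (rule finite_measure_finite_Union[symmetric])
    show "A ` {..<T} \<subseteq> sets M" using AM by blast
    show "disjoint_family_on A {..<T}" by (auto simp: disjoint_family_on_def A_def)
  qed simp
  then have "measure M (\<Union>t<T. A t) = 1" using q by (simp add: A_def)
  moreover have "(\<Union>t<T. A t) \<in> sets M" using AM by blast
  ultimately have "AE \<omega> in M. \<omega> \<in> (\<Union>t<T. A t)" using prob_eq_1 by blast
  then have ae: "AE \<omega> in M. f (R \<omega>) \<omega> = (\<Sum>t<T. indicator (A t) \<omega> * f t \<omega>)"
  proof eventually_elim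
    case (elim \<omega>)
    then have w: "\<omega> \<in> space M" "R \<omega> < T" by (auto simp: A_def)
    have "(\<Sum>t<T. indicator (A t) \<omega> * f t \<omega>) = (\<Sum>t<T. if t = R \<omega> then f t \<omega> else 0)"
      using w by (intro sum.cong) (auto simp: A_def)
    then show ?case using w by simp
  qed
  have "(\<integral>\<omega>. f (R \<omega>) \<omega> \<partial>M) = (\<integral>\<omega>. (\<Sum>t<T. indicator (A t) \<omega> * f t \<omega>) \<partial>M)"
  proof (rule integral_cong_AE[OF _ _ ae])
    show "(\<lambda>\<omega>. f (R \<omega>) \<omega>) \<in> borel_measurable M"
      by (rule measurable_compose_countable[OF bounded_rv_measurable[OF fM] R])
    show "(\<lambda>\<omega>. \<Sum>t<T. indicator (A t) \<omega> * f t \<omega>) \<in> borel_measurable M"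
      by (intro bounded_rv_measurable bounded_rv_sum bounded_rv_mult IM fM)
  qed
  also have "\<dots> = (\<Sum>t<T. \<integral>\<omega>. indicator (A t) \<omega> * f t \<omega> \<partial>M)"
    by (intro Bochner_Integration.integral_sum bounded_rv_integrable bounded_rv_mult IM fM)
  also have "\<dots> = (\<Sum>t<T. q t * (\<integral>\<omega>. f t \<omega> \<partial>M))"
  proof (rule sum.cong[OF refl])
    fix t assume t: "t \<in> {..<T}"
    let ?I = "\<lambda>\<omega>. indicator (A t) \<omega> :: real"
    have spF: "space F = space M" using F by (simp add: subalgebra_def)
    let ?V = "vimage_algebra (space M) R (count_space UNIV)"
    have "?I \<in> borel_measurable ?V" using AR by simp
    then have "{?I -` B \<inter> space M | B. B \<in> sets borel} \<subseteq> sets ?V" by (auto dest: measurable_sets)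
    then have s1: "sigma_sets (space M) {?I -` B \<inter> space M | B. B \<in> sets borel} \<subseteq> sets ?V"
      using sets.sigma_sets_subset[of _ ?V] by simp
    have "{f t -` B \<inter> space M | B. B \<in> sets borel} \<subseteq> sets F"
      using bounded_rv_measurable[OF f[of t]] spF by (auto dest: measurable_sets)
    then have s2: "sigma_sets (space M) {f t -` B \<inter> space M | B. B \<in> sets borel} \<subseteq> sets F"
      using sets.sigma_sets_subset[of _ F] spF by simp
    have "indep_var borel ?I borel (f t)"
      unfolding indep_var_eq
    proof (intro conjI)
      show "indep_set (sigma_sets (space M) {?I -` B \<inter> space M | B. B \<in> sets borel})
        (sigma_sets (space M) {f t -` B \<inter> space M | B. B \<in> sets borel})"
        unfolding indep_set_def
        by (rule indep_sets_mono_sets[OF ind[unfolded indep_set_def]]) (use s1 s2 in \<open>auto split: bool.split\<close>)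
    qed (use bounded_rv_measurable[OF IM] bounded_rv_measurable[OF fM] in auto)
    then have "(\<integral>\<omega>. ?I \<omega> * f t \<omega> \<partial>M) = (\<integral>\<omega>. ?I \<omega> \<partial>M) * (\<integral>\<omega>. f t \<omega> \<partial>M)"
      by (rule indep_var_lebesgue_integral) (intro bounded_rv_integrable IM fM)+
    then show "(\<integral>\<omega>. ?I \<omega> * f t \<omega> \<partial>M) = q t * (\<integral>\<omega>. f t \<omega> \<partial>M)"
      using AM q t by (simp add: A_def)
  qed
  finally show ?thesis .
qed

text \<open>The step size condition excludes degenerate cases: \<open>\<tau> = 0\<close> would turn
  its first bound into a division by zero, that is \<open>\<alpha> \<le> 0\<close>, and
  \<open>prho p = 0\<close> would make the logarithm 0. The last claim is the rounding up in
  \<open>tau\<close>.\<close>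

lemma small_step_tau:
  assumes \<alpha>: "0 < \<alpha>" and rho: "0 \<le> prho p" "prho p < 1" and s: "small_step p K \<alpha>"
  shows "1 \<le> tau p \<alpha>" "0 < log (prho p) \<alpha>" "prho p ^ tau p \<alpha> \<le> \<alpha>\<^sup>2"
proof -
  let ?\<tau> = "tau p \<alpha>"
  have "\<alpha> \<le> 1 / (360 * real ?\<tau> * ((pA2 p)\<^sup>2 + 1))" using s by (simp add: small_step_def)
  then have "?\<tau> \<noteq> 0" using \<alpha> by (intro notI) simp
  then show \<tau>1: "1 \<le> ?\<tau>" by simp
  then have "1 \<le> nat \<lceil>2 * log (prho p) \<alpha>\<rceil>" by (simp only: tau_def)
  then have "0 < \<lceil>2 * log (prho p) \<alpha>\<rceil>" by linarith
  then show lg: "0 < log (prho p) \<alpha>" by simp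
  have "prho p \<noteq> 0" using lg by (auto simp: log_def)
  then have r0: "0 < prho p" using rho by simp
  have "2 * log (prho p) \<alpha> \<le> real ?\<tau>" unfolding tau_def by (simp add: real_nat_ceiling_ge)
  then have "prho p powr real ?\<tau> \<le> prho p powr (2 * log (prho p) \<alpha>)" using rho by (intro powr_mono') auto
  also have "\<dots> = (prho p powr log (prho p) \<alpha>)\<^sup>2"
    using r0 by (simp add: powr_realpow[symmetric] powr_powr mult.commute)
  also have "\<dots> = \<alpha>\<^sup>2" using r0 rho \<alpha> by simp
  finally show "prho p ^ ?\<tau> \<le> \<alpha>\<^sup>2" using r0 by (simp add: powr_realpow)
qed

text \<open>The values of \<open>zeta2\<close> and \<open>zeta3\<close> make the bounds through \<open>C_15\<close> and \<open>vconst\<close> quadratic in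
  \<open>\<Lambda> U \<alpha> \<tau>\<close> and \<open>\<Lambda> U \<alpha> K\<close>; the constants 24, 46 and 69 come from taking square roots.\<close>

lemma small_step_bounds:
  fixes p \<alpha> K
  defines "\<Lambda> \<equiv> pL p / (ppsi p * (plcs p)\<^sup>2)" and "U \<equiv> 1 + ppsi p * (pucs p)\<^sup>2" and "y \<equiv> \<alpha> * real (tau p \<alpha>)"
  assumes \<alpha>: "0 < \<alpha>" and rho: "0 \<le> prho p" "prho p < 1" and s: "small_step p K \<alpha>"
    and L: "1 \<le> pL p" and cs: "0 < plcs p" "plcs p \<le> pucs p" and c2: "0 < plc2 p" "plc2 p \<le> puc2 p"
    and psi: "0 < ppsi p" and phi: "0 < phi2 p" "phi2 p < 1" and m: "0 \<le> pm1 p" "0 \<le> pm4 p"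
    and A: "0 \<le> pA1 p" "0 \<le> pA2 p" and K: "1 \<le> K"
  shows "y \<le> 1 / 24" "y * (pA2 p + 1) \<le> 1 / 8" "\<alpha> * (real K - 1) \<le> 1 / 2"
    "\<Lambda> * U * y * (pA2 p + 1)\<^sup>2 \<le> phi2 p / 24"
    "\<Lambda> * U * y * (pA1 p + 1) * (pA2 p + 1) \<le> phi2 p / 46"
    "\<Lambda> * U * pm1 p * \<alpha> \<le> phi2 p / 12"
    "\<alpha> * real K * pA2 p * (pA1 p + 1) * (\<Lambda> * U) \<le> phi2 p / 69"
    "1 \<le> \<Lambda> * U" "0 < \<Lambda>" "1 \<le> U"
proof -
  note st = small_step_tau[OF \<alpha> rho s]
  define \<tau> where "\<tau> = real (tau p \<alpha>)"
  define \<phi> A1 A2 where "\<phi> = phi2 p" and "A1 = pA1 p" and "A2 = pA2 p"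
  note A' = A[folded A1_def A2_def] and phi' = phi[folded \<phi>_def]
  have \<tau>: "1 \<le> \<tau>" using st(1) by (simp add: \<tau>_def)
  have y: "y = \<alpha> * \<tau>" "0 < y" using \<alpha> \<tau> by (auto simp: y_def \<tau>_def)
  have \<psi>l: "0 < ppsi p * (plcs p)\<^sup>2" using psi cs by simp
  show \<Lambda>: "0 < \<Lambda>" using L \<psi>l by (simp add: \<Lambda>_def)
  show U: "1 \<le> U" using psi by (simp add: U_def)
  show \<Lambda>U: "1 \<le> \<Lambda> * U"
  proof -
    have "(plcs p)\<^sup>2 \<le> (pucs p)\<^sup>2" using cs by (intro power_mono) auto
    then have "ppsi p * (plcs p)\<^sup>2 \<le> U" using psi by (simp add: U_def mult_left_mono add_increasing)
    then have "1 * (ppsi p * (plcs p)\<^sup>2) \<le> pL p * U" using L \<psi>l by (intro mult_mono) auto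
    then show ?thesis using \<psi>l by (simp add: \<Lambda>_def field_simps)
  qed
  have ucm: "(ucm p)\<^sup>2 = U" using psi by (simp add: ucm_def U_def add_nonneg_nonneg)
  have sq1: "1 \<le> sqrt (A2\<^sup>2 + 1)" by simp
  have "y \<le> 1 / (24 * sqrt (A2\<^sup>2 + 1))" and y8: "y \<le> 1 / (8 * (A2 + 1))"
    using s by (auto simp: small_step_def y_def A2_def)
  moreover have "1 / (24 * sqrt (A2\<^sup>2 + 1)) \<le> 1 / (24 * 1)"
    by (intro divide_left_mono mult_left_mono sq1) (auto simp: add_nonneg_pos)
  ultimately show y24: "y \<le> 1 / 24" by linarith
  show "y * (pA2 p + 1) \<le> 1 / 8" using y8 A' by (simp add: A2_def field_simps)
  show "\<alpha> * (real K - 1) \<le> 1 / 2"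
  proof (rule power2_le_imp_le)
    \<comment> \<open>The logarithm is at most 1 / 4, so the square to be bounded is at most 1 /
      8.\<close>
    have "ln (5 / 4 :: real) \<le> 1 / 4" using ln_add_one_self_le_self[of "1 / 4 :: real"] by simp
    moreover have "0 \<le> A1t p" by (simp add: A1t_def)
    ultimately have "ln (5 / 4) / (2 * (1 + A1t p)) \<le> (1 / 4) / (2 * 1)" by (intro frac_le) auto
    moreover have "(\<alpha> * (real K - 1))\<^sup>2 \<le> ln (5 / 4) / (2 * (1 + A1t p))"
      using s by (simp add: small_step_def power_mult_distrib)
    moreover have "(1 / 2 :: real)\<^sup>2 = 1 / 4" by (simp add: power2_eq_square)
    ultimately show "(\<alpha> * (real K - 1))\<^sup>2 \<le> (1 / 2)\<^sup>2" by linarith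
  qed simp
  \<comment> \<open>Inserting \<open>zeta2\<close> turns a term linear in \<open>A2\<close> into a
    quadratic one with a factor \<open>\<Lambda> * U\<close>. For \<open>A2 = 0\<close> both sides
    vanish.\<close>
  have z2: "A2 * (U / (zeta2 p)\<^sup>2) = 20 * \<Lambda> * U * A2\<^sup>2 / \<phi>"
  proof (cases "A2 = 0")
    case False
    then have "(zeta2 p)\<^sup>2 = \<phi> / (20 * \<Lambda> * A2)"
      using A' phi' psi L \<psi>l by (simp add: zeta2_def \<phi>_def A2_def \<Lambda>_def)
    then show ?thesis using False phi' \<Lambda> by (simp add: power2_eq_square)
  qed simp
  have z3: "(zeta3 p)\<^sup>2 = \<phi> / (10 * \<Lambda> * (A1 + 1))"
    using A' phi' psi L \<psi>l by (simp add: zeta3_def \<phi>_def A1_def \<Lambda>_def)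
  have z3': "(A1 + 1) * (3 * U / (2 * (zeta3 p)\<^sup>2)) = 15 * \<Lambda> * U * (A1 + 1)\<^sup>2 / \<phi>"
    unfolding z3 using A' phi' \<Lambda> by (simp add: field_simps power2_eq_square)
  \<comment> \<open>Only the two terms of \<open>C_4\<close> divided by a squared zeta are kept;
    they carry the additional \<open>\<Lambda> * U * \<alpha> / \<phi>\<close>.\<close>
  have C4: "\<Lambda> * (\<alpha> * (20 * \<Lambda> * U * A2\<^sup>2 / \<phi> + 15 * \<Lambda> * U * (A1 + 1)\<^sup>2 / \<phi>)) \<le> C_4 p \<alpha>"
  proof -
    have "C_4 p \<alpha> = \<Lambda> * (\<Lambda> / 2 + \<alpha> * (A2 + A2 * (U / (zeta2 p)\<^sup>2)) + \<alpha> * ((A1 + 1) * (3 * U / (2 * (zeta3 p)\<^sup>2)) + (A1 + 1) * 2) + 3 * pm1 p * \<alpha>\<^sup>2)"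
      using psi cs by (simp add: C_4_def \<Lambda>_def ucm A1_def A2_def algebra_simps)
    also have "\<dots> = \<Lambda> * (\<alpha> * (20 * \<Lambda> * U * A2\<^sup>2 / \<phi> + 15 * \<Lambda> * U * (A1 + 1)\<^sup>2 / \<phi>)
        + (\<Lambda> / 2 + \<alpha> * A2 + \<alpha> * ((A1 + 1) * 2) + 3 * pm1 p * \<alpha>\<^sup>2))"
      unfolding z2 z3' by (simp only: distrib_left add_ac)
    finally show ?thesis using \<Lambda> \<alpha> A' m by (simp add: mult_le_cancel_left_pos)
  qed
  have C40: "0 \<le> C_4 p \<alpha>"
    by (rule order_trans[OF _ C4]) (use \<Lambda> U \<alpha> phi' A' in simp)
  define X where "X = C_15 p \<alpha> (tau p \<alpha>)"
  have X: "X = (6 * pm1 p * \<Lambda> * U + 3 * \<Lambda> * (A2 + 1)\<^sup>2 * U + 144 * (A2\<^sup>2 + 1) * C_4 p \<alpha> * U) * \<tau>\<^sup>2"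
    using psi cs by (simp add: X_def C_15_def \<Lambda>_def ucm A2_def \<tau>_def field_simps)
  have t1: "0 \<le> 6 * pm1 p * \<Lambda> * U" "0 < 3 * \<Lambda> * (A2 + 1)\<^sup>2 * U" "0 \<le> 144 * (A2\<^sup>2 + 1) * C_4 p \<alpha> * U"
    using m \<Lambda> U A' C40 by auto
  have X0: "0 < X"
    unfolding X by (rule mult_pos_pos[OF add_pos_nonneg[OF add_nonneg_pos[OF t1(1,2)] t1(3)]]) (use \<tau> in simp)
  have "\<alpha> \<le> \<phi> / (2 * X)" using s by (simp add: small_step_def X_def \<phi>_def)
  then have \<alpha>X: "\<alpha> * X \<le> \<phi> / 2" using X0 by (simp add: field_simps)
  have "\<Lambda> * U * pm1 p * \<alpha> * 1 \<le> \<Lambda> * U * pm1 p * \<alpha> * \<tau>\<^sup>2"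
    using \<Lambda> U m \<alpha> \<tau> by (intro mult_left_mono one_le_power) auto
  moreover have "\<alpha> * ((6 * pm1 p * \<Lambda> * U) * \<tau>\<^sup>2) \<le> \<alpha> * X"
    unfolding X using t1 \<alpha> by (intro mult_left_mono mult_right_mono) auto
  ultimately have "6 * (\<Lambda> * U * pm1 p * \<alpha>) \<le> \<phi> / 2" using \<alpha>X by (simp add: mult_ac)
  then show "\<Lambda> * U * pm1 p * \<alpha> \<le> phi2 p / 12" by (simp add: \<phi>_def)
  define Q where "Q = \<Lambda> * U * y"
  have Q0: "0 \<le> Q" using \<Lambda> U y by (simp add: Q_def)
  \<comment> \<open>From the \<open>C_4\<close> part of
    \<open>\<alpha> * C_15 \<le> \<phi> / 2\<close>: one \<open>\<alpha>\<close> stands in front,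
    the other inside \<open>C_4\<close>, and with the square of \<open>\<tau>\<close> they form the
    square of \<open>Q\<close>.\<close>
  have key: "Q\<^sup>2 * (A2\<^sup>2 + 1) * (288 * (20 * A2\<^sup>2 + 15 * (A1 + 1)\<^sup>2)) \<le> \<phi>\<^sup>2"
  proof -
    have "\<alpha> * ((144 * (A2\<^sup>2 + 1) * (\<Lambda> * (\<alpha> * (20 * \<Lambda> * U * A2\<^sup>2 / \<phi> + 15 * \<Lambda> * U * (A1 + 1)\<^sup>2 / \<phi>))) * U) * \<tau>\<^sup>2)
      \<le> \<alpha> * ((144 * (A2\<^sup>2 + 1) * C_4 p \<alpha> * U) * \<tau>\<^sup>2)"
      using \<alpha> U C4 by (intro mult_left_mono mult_right_mono) auto
    also have "\<dots> \<le> \<alpha> * X" unfolding X using t1 \<alpha> by (intro mult_left_mono mult_right_mono) auto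
    also have "\<dots> \<le> \<phi> / 2" by (rule \<alpha>X)
    also have "\<alpha> * ((144 * (A2\<^sup>2 + 1) * (\<Lambda> * (\<alpha> * (20 * \<Lambda> * U * A2\<^sup>2 / \<phi> + 15 * \<Lambda> * U * (A1 + 1)\<^sup>2 / \<phi>))) * U) * \<tau>\<^sup>2)
      = Q\<^sup>2 * (A2\<^sup>2 + 1) * (144 * (20 * A2\<^sup>2 + 15 * (A1 + 1)\<^sup>2)) / \<phi>"
      using phi' by (simp add: Q_def y(1) power2_eq_square field_simps)
    finally show ?thesis using phi' by (simp add: field_simps power2_eq_square)
  qed
  have A2sq: "(A2 + 1)\<^sup>2 \<le> 2 * (A2\<^sup>2 + 1)" using sq_sum_le2[of A2 1] by simp
  show "\<Lambda> * U * y * (pA1 p + 1) * (pA2 p + 1) \<le> phi2 p / 46"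
    unfolding \<phi>_def[symmetric] A1_def[symmetric] A2_def[symmetric] Q_def[symmetric]
  proof (rule power2_le_imp_le)
    \<comment> \<open>2116 is the square of 46, and 2 * 2116 = 4232 fits below 288 * 15 =
      4320.\<close>
    have "2116 * (Q * (A1 + 1) * (A2 + 1))\<^sup>2 = Q\<^sup>2 * (A2 + 1)\<^sup>2 * (2116 * (A1 + 1)\<^sup>2)"
      by (simp add: power_mult_distrib)
    also have "\<dots> \<le> Q\<^sup>2 * (2 * (A2\<^sup>2 + 1)) * (2116 * (A1 + 1)\<^sup>2)"
      by (intro mult_right_mono mult_left_mono A2sq) auto
    also have "\<dots> = Q\<^sup>2 * (A2\<^sup>2 + 1) * (4232 * (A1 + 1)\<^sup>2)" by simp
    also have "\<dots> \<le> Q\<^sup>2 * (A2\<^sup>2 + 1) * (288 * (20 * A2\<^sup>2 + 15 * (A1 + 1)\<^sup>2))"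
      by (intro mult_left_mono) (auto simp: add_increasing)
    also have "\<dots> \<le> \<phi>\<^sup>2" by (rule key)
    finally show "(Q * (A1 + 1) * (A2 + 1))\<^sup>2 \<le> (\<phi> / 46)\<^sup>2" by (simp add: power_divide)
  qed (use phi' in simp)
  show "\<Lambda> * U * y * (pA2 p + 1)\<^sup>2 \<le> phi2 p / 24"
    unfolding \<phi>_def[symmetric] A2_def[symmetric] Q_def[symmetric]
  proof (rule power2_le_imp_le)
    have "1 \<le> (A1 + 1)\<^sup>2" using A' by (intro one_le_power) auto
    then have a: "15 * (A2\<^sup>2 + 1) \<le> 20 * A2\<^sup>2 + 15 * (A1 + 1)\<^sup>2" using zero_le_power2[of A2]
      unfolding distrib_left mult_1_right by linarith
    \<comment> \<open>576 is the square of 24, and 4 * 576 = 2304 fits below 288 * 15.\<close>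
    have "576 * (Q * (A2 + 1)\<^sup>2)\<^sup>2 = 576 * (Q\<^sup>2 * ((A2 + 1)\<^sup>2 * (A2 + 1)\<^sup>2))"
      by (simp add: power2_eq_square)
    also have "\<dots> \<le> 576 * (Q\<^sup>2 * ((2 * (A2\<^sup>2 + 1)) * (2 * (A2\<^sup>2 + 1))))"
      by (intro mult_left_mono mult_mono A2sq) auto
    also have "\<dots> = Q\<^sup>2 * (A2\<^sup>2 + 1) * (2304 * (A2\<^sup>2 + 1))"
      by (simp only: mult_ac numeral_times_numeral arith_simps)
    also have "\<dots> \<le> Q\<^sup>2 * (A2\<^sup>2 + 1) * (288 * (15 * (A2\<^sup>2 + 1)))" by (intro mult_left_mono) auto
    also have "\<dots> \<le> Q\<^sup>2 * (A2\<^sup>2 + 1) * (288 * (20 * A2\<^sup>2 + 15 * (A1 + 1)\<^sup>2))" using a by (intro mult_left_mono) auto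
    also have "\<dots> \<le> \<phi>\<^sup>2" by (rule key)
    finally show "(Q * (A2 + 1)\<^sup>2)\<^sup>2 \<le> (\<phi> / 24)\<^sup>2" by (simp add: power_divide)
  qed (use phi' in simp)
  show "\<alpha> * real K * pA2 p * (pA1 p + 1) * (\<Lambda> * U) \<le> phi2 p / 69"
    unfolding \<phi>_def[symmetric] A1_def[symmetric] A2_def[symmetric]
  \<comment> \<open>For \<open>A2 = 0\<close> the left side is 0. Otherwise \<open>A2t p\<close> is
    positive and the quotient \<open>vconst\<close> has a positive denominator.\<close>
  proof (cases "A2 = 0")
    case False
    then have A2: "0 < A2" using A' by simp
    define C where "C = C_17 p \<alpha>"
    have C5: "15 * \<Lambda>\<^sup>2 * U * (A1 + 1)\<^sup>2 / \<phi> \<le> C_5 p \<alpha>"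
    proof -
      define R where "R = 3 / 2 * (A1 + 1) + A2 + pL p * U / (2 * (plcs p)\<^sup>2 * (zeta4 p)\<^sup>2 * ppsi p) + 3 * A1\<^sup>2 * \<alpha>\<^sup>2 / 2"
      have c5: "C_5 p \<alpha> = \<Lambda> * ((A1 + 1) * (3 * U / (2 * (zeta3 p)\<^sup>2)) + R)"
        by (simp add: C_5_def \<Lambda>_def ucm A1_def A2_def R_def algebra_simps)
      have "0 \<le> R" unfolding R_def using A' L U psi by (intro add_nonneg_nonneg) auto
      then have "\<Lambda> * ((A1 + 1) * (3 * U / (2 * (zeta3 p)\<^sup>2))) \<le> C_5 p \<alpha>"
        unfolding c5 using \<Lambda> by (intro mult_left_mono) simp_all
      then show ?thesis unfolding z3' by (simp add: power2_eq_square mult_ac)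
    qed
    have "0 \<le> C_6 p \<alpha>"
      unfolding C_6_def ucm A1_def[symmetric] using A' L U psi m \<alpha> by (intro mult_nonneg_nonneg add_nonneg_nonneg divide_nonneg_nonneg) auto
    moreover have "0 \<le> 3 * pA1 p * C_3 p" unfolding C_3_def using A m L psi by simp
    moreover have "0 \<le> 8 * (pA1 p)\<^sup>2 * C_4 p \<alpha>" using C40 by simp
    ultimately have C: "15 * \<Lambda>\<^sup>2 * U * (A1 + 1)\<^sup>2 / \<phi> \<le> C" using C5 unfolding C_def C_17_def by linarith
    have C0: "0 < 15 * \<Lambda>\<^sup>2 * U * (A1 + 1)\<^sup>2 / \<phi>" using \<Lambda> U A' phi' by simp
    have k1: "1 \<le> (puc2 p)\<^sup>2 / (plc2 p)\<^sup>2" using c2 by (simp add: power_mono)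
    have At: "2 * A2\<^sup>2 * 1 \<le> A2t p"
      unfolding A2t_def A2_def[symmetric] using mult_left_mono[OF k1, of "2 * A2\<^sup>2"] by simp
    have At0: "0 < A2t p" by (rule less_le_trans[OF _ At]) (use A2 in simp)
    have "\<alpha>\<^sup>2 * 1 \<le> \<alpha>\<^sup>2 * (log (prho p) \<alpha> + 1)" using st(2) by (intro mult_left_mono) auto
    also have "\<dots> \<le> vconst p \<alpha> / (2 * (real K)\<^sup>2)" using s by (simp add: small_step_def)
    finally have "\<alpha>\<^sup>2 * (2 * (real K)\<^sup>2) \<le> vconst p \<alpha>" using K by (simp add: field_simps)
    also have "\<dots> = \<phi> / (80 * A2t p * C * U)" by (simp add: vconst_def \<phi>_def C_def ucm)
    finally have "\<alpha>\<^sup>2 * (2 * (real K)\<^sup>2) * (80 * A2t p * C * U) \<le> \<phi>"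
      using At0 less_le_trans[OF C0 C] U by (simp add: pos_le_divide_eq)
    moreover have "\<alpha>\<^sup>2 * (2 * (real K)\<^sup>2) * (80 * (2 * A2\<^sup>2 * 1) * (15 * \<Lambda>\<^sup>2 * U * (A1 + 1)\<^sup>2 / \<phi>) * U)
      \<le> \<alpha>\<^sup>2 * (2 * (real K)\<^sup>2) * (80 * A2t p * C * U)"
      using At C C0 U At0 by (intro mult_left_mono mult_right_mono mult_mono) auto
    ultimately have "\<alpha>\<^sup>2 * (2 * (real K)\<^sup>2) * (80 * (2 * A2\<^sup>2 * 1) * (15 * \<Lambda>\<^sup>2 * U * (A1 + 1)\<^sup>2 / \<phi>) * U) \<le> \<phi>"
      by linarith
    \<comment> \<open>4800 = 2 * 80 * 2 * 15, and 69 is the largest integer whose square does not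
      exceed it.\<close>
    then have "4800 * (\<alpha> * real K * A2 * (A1 + 1) * (\<Lambda> * U))\<^sup>2 \<le> \<phi>\<^sup>2"
      using phi' by (simp add: field_simps power2_eq_square)
    moreover have "0 \<le> (\<alpha> * real K * A2 * (A1 + 1) * (\<Lambda> * U))\<^sup>2" by simp
    moreover have "(\<phi> / 69)\<^sup>2 = \<phi>\<^sup>2 / 4761" by (simp add: power_divide)
    ultimately have "(\<alpha> * real K * A2 * (A1 + 1) * (\<Lambda> * U))\<^sup>2 \<le> (\<phi> / 69)\<^sup>2" by linarith
    then show "\<alpha> * real K * A2 * (A1 + 1) * (\<Lambda> * U) \<le> \<phi> / 69"
      by (rule power2_le_imp_le) (use phi' in simp)
  qed (use phi' in simp)
qed

section \<open>The error bound\<close>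

context fegsam_process
begin

text \<open>Every \<open>Gbar i\<close> fixes 0 and contracts, hence so does the average. This makes
  \<open>th\<close> itself the error.\<close>

lemma Gbar_mean_fixpoint:
  assumes "agent_mean N (\<lambda>i. Gbar i \<theta>) = \<theta>" shows "\<theta> = 0"
proof -
  have "cn \<theta> \<le> agent_mean N (\<lambda>i. cn (Gbar i \<theta>))"
    using is_norm_agent_mean[OF cn, of N "\<lambda>i. Gbar i \<theta>"] assms by simp
  also have "\<dots> \<le> pgamma p * cn \<theta>" by (rule agent_mean_le[OF N Gbar_bound])
  finally have "(1 - pgamma p) * cn \<theta> \<le> 0" by (simp add: algebra_simps)
  then have "cn \<theta> \<le> 0" using gamma by (simp add: mult_le_0_iff)
  then show ?thesis using cn cn_ge0[of \<theta>] by (auto simp: is_norm_def)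
qed

text \<open>The sampling law is proportional to \<open>z ^ t\<close>, so the output error is exactly
  the weighted average bounded in \<open>weighted_drift_bound\<close>.\<close>

lemma expectation_output:
  assumes st: "sampled_time p M N S Y \<alpha> T R" and T: "1 \<le> T" and c: "0 < c_fsam p \<alpha>"
  defines "z \<equiv> 1 / c_fsam p \<alpha>"
  shows "(\<integral>\<omega>. (cn (th (R \<omega>) \<omega>))\<^sup>2 \<partial>M) = (\<Sum>t<T. z ^ t * Ea t) / (\<Sum>t<T. z ^ t)"
proof -
  let ?F = "generated_by M ({..<N} \<times> UNIV) (\<lambda>(i, t). Y i t) (\<lambda>(i, t). S i)"
  have R: "R \<in> measurable M (count_space UNIV)"
    and q: "\<And>t. t < T \<Longrightarrow> measure M {\<omega> \<in> space M. R \<omega> = t} = sample_weight (c_fsam p \<alpha>) T t"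
    and ind: "indep_set (sets (vimage_algebra (space M) R (count_space UNIV))) (sets ?F)"
    using st by (auto simp: sampled_time_def)
  have F: "subalgebra M ?F" by (rule subalgebra_generated_by) (auto intro: Y_measurable)
  have HF: "subalgebra ?F (H t)" for t
  proof -
    have "Y i r \<in> measurable ?F (S i)" if "i < N" for i r
      using generated_by_measurable[of "(i, r)" "{..<N} \<times> UNIV" "\<lambda>(i, r). Y i r" M "\<lambda>(i, r). S i"] that Y_space by auto
    then have "sets (H t) \<subseteq> sets ?F"
      unfolding noise_history_def by (intro sets_generated_by_le) auto
    then show ?thesis by (simp add: subalgebra_def)
  qed
  have f: "bounded_rv ?F (\<lambda>\<omega>. (cn (th t \<omega>))\<^sup>2)" for t
    by (intro bounded_rv_power bounded_rv_cn bounded_rv_mono[OF HF[of t] bounded_rv_th[OF order_refl]])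
  define W where "W = (\<Sum>t<T. z ^ t)"
  have z: "0 < z" using c by (simp add: z_def)
  have W: "0 < W" unfolding W_def using T z by (intro sum_pos) (auto simp: lessThan_empty_iff)
  have pw: "c_fsam p \<alpha> powi (- int t) = z ^ t" for t
    by (simp add: z_def power_int_minus power_one_over inverse_eq_divide)
  have sw: "sample_weight (c_fsam p \<alpha>) T t = z ^ t / W" for t
    by (simp add: sample_weight_def pw W_def)
  have "(\<Sum>t<T. sample_weight (c_fsam p \<alpha>) T t) = 1"
    using W by (simp add: sw sum_divide_distrib[symmetric] W_def)
  from expectation_at_independent_time[OF R F ind q this f]
  have "(\<integral>\<omega>. (cn (th (R \<omega>) \<omega>))\<^sup>2 \<partial>M) = (\<Sum>t<T. sample_weight (c_fsam p \<alpha>) T t * Ea t)"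
    by (simp add: Ea_def)
  also have "\<dots> = (\<Sum>t<T. z ^ t * Ea t) / W" by (simp add: sw sum_divide_distrib)
  finally show ?thesis by (simp add: W_def)
qed

end

text \<open>\<open>err1\<close>, ..., \<open>err5\<close> become the constants of the theorem, with \<open>r0\<close> the norm of the initial iterate.\<close>

definition noise_gain :: "fegsam_par \<Rightarrow> real \<Rightarrow> real" where
  "noise_gain p \<Lambda> = \<Lambda> * (pA1 p + 6)"

definition drift_gain :: "fegsam_par \<Rightarrow> real \<Rightarrow> real \<Rightarrow> real" where
  "drift_gain p \<Lambda> U = 2 * \<Lambda> * (pA1 p + 6) * (pA2 p)\<^sup>2 + 10 * U * \<Lambda>\<^sup>2 * (pA1 p + 1)\<^sup>2 / phi2 p"

definition err1 :: "fegsam_par \<Rightarrow> real \<Rightarrow> real \<Rightarrow> real \<Rightarrow> real" where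
  "err1 p r0 \<Lambda> U = 5 / 2 * U / phi2 p * (2 * (2 * (r0 + pB p))\<^sup>2
    + noise_gain p \<Lambda> * ((puc2 p)\<^sup>2 * ((pB p / plc2 p)\<^sup>2 + (pm4 p / plc2 p)\<^sup>2)))"

definition err2 :: "fegsam_par \<Rightarrow> real \<Rightarrow> real \<Rightarrow> real" where
  "err2 p \<Lambda> U = 5 / 2 * U / phi2 p * (noise_gain p \<Lambda> * ((puc2 p)\<^sup>2 * (pB p / plc2 p)\<^sup>2))"

definition err3 :: "fegsam_par \<Rightarrow> real \<Rightarrow> real \<Rightarrow> real" where
  "err3 p \<Lambda> U = 5 / 2 * U / phi2 p * (drift_gain p \<Lambda> U * (2 * (puc2 p)\<^sup>2 * (pB p / (plc2 p)\<^sup>2) * (2 * pm2 p / (1 - prho p))))"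

definition err4 :: "fegsam_par \<Rightarrow> real \<Rightarrow> real \<Rightarrow> real" where
  "err4 p \<Lambda> U = 5 / 2 * U / phi2 p * (drift_gain p \<Lambda> U * (2 * (puc2 p)\<^sup>2 * (pB p / (plc2 p)\<^sup>2) * pm3 p))"

definition err5 :: "fegsam_par \<Rightarrow> real \<Rightarrow> real \<Rightarrow> real" where
  "err5 p \<Lambda> U = 5 / 2 * U / phi2 p * (10 * U * \<Lambda>\<^sup>2 * (pm4 p)\<^sup>2 / phi2 p + noise_gain p \<Lambda> * ((puc2 p)\<^sup>2 * (pm4 p / plc2 p)\<^sup>2))"

context fegsam_lyapunov
begin

text \<open>As \<open>\<alpha> * \<tau> * pA2 p\<close> is at most 1 / 8, geometric growth over
  \<open>\<tau>\<close> steps costs at most a factor 2.\<close>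

lemma Ea_initial:
  assumes y: "\<alpha> * real \<tau> \<le> 1 / 24" "\<alpha> * real \<tau> * (pA2 p + 1) \<le> 1 / 8" and t: "t \<le> \<tau>"
  shows "Ea t \<le> (2 * (cn \<theta>0 + pB p))\<^sup>2"
proof -
  have yt: "\<alpha> * real t \<le> \<alpha> * real \<tau>" using t \<alpha> by (intro mult_left_mono) auto
  define x where "x = \<alpha> * pA2 p"
  have x0: "0 \<le> x" using \<alpha> constants_nonneg by (simp add: x_def)
  have tx: "real t * x \<le> 1 / 8" if "t \<le> \<tau>" for t
  proof -
    have "real t * x \<le> real \<tau> * x" using that x0 by (intro mult_right_mono) auto
    also have "\<dots> = \<alpha> * real \<tau> * pA2 p" by (simp add: x_def)
    also have "\<dots> \<le> \<alpha> * real \<tau> * (pA2 p + 1)" using \<alpha> by (intro mult_left_mono) auto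
    finally show ?thesis using y by linarith
  qed
  have x1: "x < 1" using tx[of 1] \<tau> by simp
  have "1 + x \<le> 1 / (1 - x)" using x0 x1 by (simp add: field_simps)
  then have "(1 + x) ^ t \<le> (1 / (1 - x)) ^ t" using x0 by (intro power_mono) auto
  also have "\<dots> \<le> 1 / (1 - 1 / 2)" using x0 x1 tx[OF t] by (intro inverse_power_le) auto
  finally have p: "(1 + \<alpha> * pA2 p) ^ t \<le> 2" by (simp add: x_def)
  have "\<alpha> * real t * pB p \<le> 1 * pB p" using yt y constants_nonneg by (intro mult_right_mono) auto
  then have "(1 + \<alpha> * pA2 p) ^ t * (cn \<theta>0 + \<alpha> * real t * pB p) \<le> 2 * (cn \<theta>0 + pB p)"
    using p constants_nonneg \<alpha> by (intro mult_mono) auto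
  moreover have "0 \<le> (1 + \<alpha> * pA2 p) ^ t * (cn \<theta>0 + \<alpha> * real t * pB p)"
    using constants_nonneg \<alpha> by simp
  ultimately show ?thesis using Ea_growth[of t] by (meson order_trans power_mono)
qed

lemma error_bound:
  fixes T :: nat
  defines "\<epsilon> \<equiv> (1 / real N) * (\<Sum>i<N. \<eta> i)"
  assumes phi: "\<phi> = phi2 p" "\<phi> < 1" and U1: "1 \<le> U" and T: "2 * \<tau> \<le> T"
    and s: "\<alpha> * real \<tau> \<le> 1 / 24" "\<alpha> * real \<tau> * (pA2 p + 1) \<le> 1 / 8" "\<alpha> * (real K - 1) \<le> 1 / 2"
    "\<Lambda> * U * (\<alpha> * real \<tau>) * (pA2 p + 1)\<^sup>2 \<le> \<phi> / 24"
    "\<Lambda> * U * (\<alpha> * real \<tau>) * (pA1 p + 1) * (pA2 p + 1) \<le> \<phi> / 46"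
    "\<Lambda> * U * pm1 p * \<alpha> \<le> \<phi> / 12"
    "\<alpha> * real K * pA2 p * (pA1 p + 1) * (\<Lambda> * U) \<le> \<phi> / 69" "1 \<le> \<Lambda> * U"
    and st: "sampled_time p M N S Y \<alpha> T R"
  shows "(\<integral>\<omega>. (cn (th (R \<omega>) \<omega>))\<^sup>2 \<partial>M)
    \<le> err1 p (cn \<theta>0) \<Lambda> U * (1 / \<alpha>) * c_fsam p \<alpha> ^ (T - 2 * \<tau> + 1)
      + err2 p \<Lambda> U * (\<alpha> * (real \<tau>)\<^sup>2 / real N)
      + err3 p \<Lambda> U * (real K - 1) * \<alpha>\<^sup>2 * real \<tau>
      + err4 p \<Lambda> U * (real K - 1)\<^sup>2 * \<epsilon> * \<alpha>\<^sup>2 * real \<tau>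
      + err5 p \<Lambda> U * \<alpha> ^ 3 * (real \<tau>)\<^sup>2"
proof -
  note L0 = Ly.\<Lambda>
  note cnn = constants_nonneg
  define E0 where "E0 = 2 * (puc2 p)\<^sup>2 * (\<alpha>\<^sup>2 * (pB p / (plc2 p)\<^sup>2) * (2 * pm2 p / (1 - prho p) * (real K - 1) + pm3 p * \<epsilon> * (real K - 1)\<^sup>2))"
  define b0 where "b0 = (puc2 p)\<^sup>2 * ((pB p / plc2 p)\<^sup>2 + (pm4 p / plc2 p)\<^sup>2)"
  define b1 where "b1 = (puc2 p)\<^sup>2 * ((pB p / plc2 p)\<^sup>2 / real N + (pm4 p * \<alpha>\<^sup>2 / plc2 p)\<^sup>2)"
  define a0 where "a0 = (2 * (cn \<theta>0 + pB p))\<^sup>2"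
  define c where "c = c_fsam p \<alpha>"
  define z where "z = 1 / (1 - \<alpha> * \<phi> / 2)"
  define W where "W = (\<Sum>t<T. z ^ t)"
  define pre where "pre = 5 / 2 * U / \<phi>"
  define ng dg where "ng = noise_gain p \<Lambda>" and "dg = drift_gain p \<Lambda> U"
  have \<epsilon>0: "0 \<le> \<epsilon>" unfolding \<epsilon>_def by (intro mult_nonneg_nonneg sum_nonneg eta) auto
  have K1: "0 \<le> real K - 1" using K by simp
  have c_eq: "c = 1 - \<alpha> * \<phi> / 2" by (simp add: c_def c_fsam_def phi)
  have "\<alpha> * \<phi> \<le> 1 * 1" using \<alpha> \<phi> phi by (intro mult_mono) auto
  moreover have "0 < \<alpha> * \<phi>" using \<alpha> \<phi> by simp
  ultimately have c01: "0 < c" "c \<le> 1" by (auto simp: c_eq)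
  have zc: "z = 1 / c" by (simp add: z_def c_eq)
  have z: "0 < z" using c01 by (simp add: zc)
  have T1: "1 \<le> T" "\<tau> \<le> T" using T \<tau> by auto
  have rt: "prho p ^ t \<le> 1" for t using rho by (simp add: power_le_one)
  have rt': "prho p ^ t \<le> \<alpha>\<^sup>2" if "\<tau> \<le> t" for t
    using power_decreasing[OF that, of "prho p"] rho rho_tau by linarith
  have Ebb: "Eb t \<le> (puc2 p)\<^sup>2 * ((pB p / plc2 p)\<^sup>2 / real N + (pm4 p * q / plc2 p)\<^sup>2)" if "prho p ^ t \<le> q" for t q
    using that lc2 m4 rho
    by (intro order_trans[OF Eb_bound] mult_left_mono add_left_mono power_mono divide_right_mono) auto
  have Eb0: "Eb t \<le> b0" for t
  proof -
    have "(pB p / plc2 p)\<^sup>2 / real N \<le> (pB p / plc2 p)\<^sup>2 / 1" using N by (intro divide_left_mono) auto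
    then show ?thesis unfolding b0_def
      by (intro order_trans[OF Ebb[OF rt]] mult_left_mono add_mono) auto
  qed
  have Eb1: "Eb t \<le> b1" if "\<tau> \<le> t" for t
    unfolding b1_def by (rule Ebb[OF rt'[OF that]])
  have "0 \<le> E0" unfolding E0_def using cnn m2 m3 rho K1 \<epsilon>0 by (intro mult_nonneg_nonneg add_nonneg_nonneg) auto
  moreover have "0 \<le> b0" "0 \<le> b1" "0 \<le> a0" by (auto simp: b0_def b1_def a0_def)
  ultimately have main: "(\<Sum>t<T. z ^ t * Ea t) \<le> 5 / 2 * U / \<phi> *
    ((2 * a0 + \<Lambda> * (pA1 p + 6) * b0) / \<alpha> + W * (10 * U * \<Lambda>\<^sup>2 * (pm4 p)\<^sup>2 * \<alpha> ^ 4 / \<phi> + \<Lambda> * (pA1 p + 6) * (\<alpha> * real \<tau>) * b1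
      + (2 * \<Lambda> * (pA1 p + 6) * (pA2 p)\<^sup>2 + 10 * U * \<Lambda>\<^sup>2 * (pA1 p + 1)\<^sup>2 / \<phi>) * E0))"
    unfolding z_def W_def
  proof (intro weighted_drift_bound[where D=Ed and b=Eb and v=Ev and e=Ee and ?m1.0="pm1 p" and K=K])
    show "0 \<le> Ev t" for t unfolding Ev_def by (rule Bochner_Integration.integral_nonneg) auto
    show "Ed t \<le> 16 * \<alpha>\<^sup>2 * (real K - 1) * (pA2 p)\<^sup>2 * (\<Sum>r\<in>{t - (K - 1)..<t}. Ea r + Ed r) + E0" for t
      using Ed_bound[of t] by (simp only: E0_def \<epsilon>_def)
    show "Ee t \<le> 3 * \<alpha>\<^sup>2 * real \<tau> * (\<Sum>r\<in>{t - \<tau>..<t}. (pA2 p + 1)\<^sup>2 * Ea r + (pA2 p)\<^sup>2 * Ed r + Eb r)" if "\<tau> \<le> t" for t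
      using Ee_bound[OF that] by (simp only: EF_def)
    show "Ea t \<le> a0" if "t \<le> \<tau>" for t unfolding a0_def by (rule Ea_initial[OF s(1,2) that])
  qed (use E_nonneg Ee_nonneg Ea_le_Ev Ev_le_Ea \<alpha> \<phi> phi U1 L0 cnn \<tau> T1 K m1 s Eb0 Eb1 drift[unfolded EF_def] in auto)
  have W: "0 < W" unfolding W_def using T1 z by (intro sum_pos) (auto simp: lessThan_empty_iff)
  \<comment> \<open>The last weight alone gives the power \<open>T - 1\<close> of \<open>c\<close>.
    Since \<open>\<tau> \<ge> 1\<close>, the claimed exponent is not larger, and
    \<open>c \<le> 1\<close>.\<close>
  have W1: "1 / W \<le> c ^ (T - 2 * \<tau> + 1)"
  proof -
    have "z ^ (T - 1) \<le> W" unfolding W_def using T1 z by (intro member_le_sum) auto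
    then have "1 / W \<le> 1 / z ^ (T - 1)" using z W by (intro divide_left_mono) auto
    also have "\<dots> = c ^ (T - 1)" by (simp add: zc power_one_over)
    also have "\<dots> \<le> c ^ (T - 2 * \<tau> + 1)" using c01 T \<tau> by (intro power_decreasing) auto
    finally show ?thesis .
  qed
  have ng0: "0 \<le> ng" using L0 cnn by (simp add: ng_def noise_gain_def)
  have dg0: "0 \<le> dg" using L0 cnn U1 \<phi> phi by (simp add: dg_def drift_gain_def)
  have pre0: "0 \<le> pre" using U1 \<phi> phi by (simp add: pre_def)
  let ?I = "2 * a0 + ng * b0" and ?J = "10 * U * \<Lambda>\<^sup>2 * (pm4 p)\<^sup>2 / \<phi>"
  have "(\<integral>\<omega>. (cn (th (R \<omega>) \<omega>))\<^sup>2 \<partial>M) = (\<Sum>t<T. z ^ t * Ea t) / W"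
    using expectation_output[OF st T1(1)] c01 by (simp add: zc c_def W_def)
  also have "\<dots> \<le> (pre * (?I / \<alpha> + W * (?J * \<alpha> ^ 4 + ng * (\<alpha> * real \<tau>) * b1 + dg * E0))) / W"
    using main W by (intro divide_right_mono) (simp_all add: pre_def ng_def dg_def noise_gain_def drift_gain_def phi)
  also have "\<dots> = pre * (?I / \<alpha> * (1 / W) + (?J * \<alpha> ^ 4 + ng * (\<alpha> * real \<tau>) * b1 + dg * E0))"
  proof -
    have "(u * (i + W * q)) / W = u * (i * (1 / W) + q)" for u i q using W by (simp add: distrib_left add_divide_distrib)
    then show ?thesis .
  qed
  also have "\<dots> \<le> pre * (?I / \<alpha> * c ^ (T - 2 * \<tau> + 1) + (?J * (\<alpha> ^ 3 * (real \<tau>)\<^sup>2)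
      + (ng * ((puc2 p)\<^sup>2 * (pB p / plc2 p)\<^sup>2) * (\<alpha> * (real \<tau>)\<^sup>2 / real N) + ng * ((puc2 p)\<^sup>2 * (pm4 p / plc2 p)\<^sup>2) * (\<alpha> ^ 3 * (real \<tau>)\<^sup>2))
      + (dg * (2 * (puc2 p)\<^sup>2 * (pB p / (plc2 p)\<^sup>2) * (2 * pm2 p / (1 - prho p))) * ((real K - 1) * \<alpha>\<^sup>2 * real \<tau>)
        + dg * (2 * (puc2 p)\<^sup>2 * (pB p / (plc2 p)\<^sup>2) * pm3 p) * ((real K - 1)\<^sup>2 * \<epsilon> * \<alpha>\<^sup>2 * real \<tau>))))"
  proof (intro mult_left_mono[OF _ pre0] add_mono)
    have \<tau>1: "1 \<le> real \<tau>" using \<tau> by simp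
    have tt: "real \<tau> \<le> (real \<tau>)\<^sup>2" "1 \<le> (real \<tau>)\<^sup>2"
      using mult_left_mono[OF \<tau>1, of "real \<tau>"] one_le_power[OF \<tau>1, of 2] by (auto simp: power2_eq_square)
    show "?I / \<alpha> * (1 / W) \<le> ?I / \<alpha> * c ^ (T - 2 * \<tau> + 1)"
      using W1 \<alpha> ng0 by (intro mult_left_mono divide_nonneg_nonneg add_nonneg_nonneg mult_nonneg_nonneg) (auto simp: a0_def b0_def)
    \<comment> \<open>The mixing errors have orders \<open>\<alpha> ^ 4\<close> and
      \<open>\<alpha> ^ 5 * \<tau>\<close>; both fit into the last term because
      \<open>\<alpha> \<le> 1 \<le> \<tau>\<close>.\<close>
    have "\<alpha> ^ 4 * 1 \<le> \<alpha> ^ 3 * (real \<tau>)\<^sup>2"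
      using \<alpha> tt by (intro mult_mono power_decreasing) auto
    then show "?J * \<alpha> ^ 4 \<le> ?J * (\<alpha> ^ 3 * (real \<tau>)\<^sup>2)"
      using U1 \<phi> by (intro mult_left_mono) auto
    have y1: "\<alpha> * real \<tau> / real N \<le> \<alpha> * (real \<tau>)\<^sup>2 / real N"
      using \<alpha> tt by (intro divide_right_mono mult_left_mono) auto
    have y2: "\<alpha> ^ 5 * real \<tau> \<le> \<alpha> ^ 3 * (real \<tau>)\<^sup>2"
      using \<alpha> tt by (intro mult_mono power_decreasing) auto
    have "ng * (\<alpha> * real \<tau>) * b1 = ng * ((puc2 p)\<^sup>2 * (pB p / plc2 p)\<^sup>2) * (\<alpha> * real \<tau> / real N)
      + ng * ((puc2 p)\<^sup>2 * (pm4 p / plc2 p)\<^sup>2) * (\<alpha> ^ 5 * real \<tau>)"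
      by (simp add: b1_def power_divide power_mult_distrib distrib_left eval_nat_numeral mult_ac)
    also have "\<dots> \<le> ng * ((puc2 p)\<^sup>2 * (pB p / plc2 p)\<^sup>2) * (\<alpha> * (real \<tau>)\<^sup>2 / real N)
      + ng * ((puc2 p)\<^sup>2 * (pm4 p / plc2 p)\<^sup>2) * (\<alpha> ^ 3 * (real \<tau>)\<^sup>2)"
      using ng0 by (intro add_mono mult_left_mono y1 y2 mult_nonneg_nonneg) auto
    finally show "ng * (\<alpha> * real \<tau>) * b1 \<le> ng * ((puc2 p)\<^sup>2 * (pB p / plc2 p)\<^sup>2) * (\<alpha> * (real \<tau>)\<^sup>2 / real N)
      + ng * ((puc2 p)\<^sup>2 * (pm4 p / plc2 p)\<^sup>2) * (\<alpha> ^ 3 * (real \<tau>)\<^sup>2)" .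
    have z1: "(real K - 1) * \<alpha>\<^sup>2 * 1 \<le> (real K - 1) * \<alpha>\<^sup>2 * real \<tau>" using K1 \<tau>1 by (intro mult_left_mono) auto
    have z2: "(real K - 1)\<^sup>2 * \<epsilon> * \<alpha>\<^sup>2 * 1 \<le> (real K - 1)\<^sup>2 * \<epsilon> * \<alpha>\<^sup>2 * real \<tau>"
      using \<epsilon>0 \<tau>1 by (intro mult_left_mono) auto
    have "dg * E0 = dg * (2 * (puc2 p)\<^sup>2 * (pB p / (plc2 p)\<^sup>2) * (2 * pm2 p / (1 - prho p))) * ((real K - 1) * \<alpha>\<^sup>2 * 1)
        + dg * (2 * (puc2 p)\<^sup>2 * (pB p / (plc2 p)\<^sup>2) * pm3 p) * ((real K - 1)\<^sup>2 * \<epsilon> * \<alpha>\<^sup>2 * 1)"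
      unfolding E0_def by (simp only: distrib_left mult_ac mult_1_right)
    also have "\<dots> \<le> dg * (2 * (puc2 p)\<^sup>2 * (pB p / (plc2 p)\<^sup>2) * (2 * pm2 p / (1 - prho p))) * ((real K - 1) * \<alpha>\<^sup>2 * real \<tau>)
        + dg * (2 * (puc2 p)\<^sup>2 * (pB p / (plc2 p)\<^sup>2) * pm3 p) * ((real K - 1)\<^sup>2 * \<epsilon> * \<alpha>\<^sup>2 * real \<tau>)"
      using dg0 cnn m2 m3 rho by (intro add_mono mult_left_mono z1 z2 mult_nonneg_nonneg) auto
    finally show "dg * E0 \<le> dg * (2 * (puc2 p)\<^sup>2 * (pB p / (plc2 p)\<^sup>2) * (2 * pm2 p / (1 - prho p))) * ((real K - 1) * \<alpha>\<^sup>2 * real \<tau>)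
        + dg * (2 * (puc2 p)\<^sup>2 * (pB p / (plc2 p)\<^sup>2) * pm3 p) * ((real K - 1)\<^sup>2 * \<epsilon> * \<alpha>\<^sup>2 * real \<tau>)" .
  qed
  also have "\<dots> = err1 p (cn \<theta>0) \<Lambda> U * (1 / \<alpha>) * c ^ (T - 2 * \<tau> + 1)
      + err2 p \<Lambda> U * (\<alpha> * (real \<tau>)\<^sup>2 / real N)
      + err3 p \<Lambda> U * (real K - 1) * \<alpha>\<^sup>2 * real \<tau>
      + err4 p \<Lambda> U * (real K - 1)\<^sup>2 * \<epsilon> * \<alpha>\<^sup>2 * real \<tau>
      + err5 p \<Lambda> U * \<alpha> ^ 3 * (real \<tau>)\<^sup>2"
    unfolding err1_def err2_def err3_def err4_def err5_def phi(1)[symmetric]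
    unfolding pre_def[symmetric] ng_def[symmetric] dg_def[symmetric] a0_def[symmetric] b0_def[symmetric]
    by (simp only: divide_inverse mult_1_left distrib_left distrib_right mult_ac add_ac)
  finally show ?thesis by (simp only: c_def)
qed

end

section \<open>The error bound for the sampled output\<close>

theorem theorem3p1:
  fixes p :: fegsam_par
    and cn sn :: "real ^ 'd \<Rightarrow> real"
    and \<theta>0 :: "real ^ 'd"
  assumes "is_norm cn" and "is_norm sn"
    and "smooth_wrt (pL p) sn (\<lambda>x. (sn x)\<^sup>2 / 2)"
    and "0 < plcs p" and "0 < pucs p"
    and "\<And>x. plcs p * sn x \<le> cn x" and "\<And>x. cn x \<le> pucs p * sn x"
    and "0 < plc2 p" and "0 < puc2 p"
    and "\<And>x. plc2 p * norm x \<le> cn x" and "\<And>x. cn x \<le> puc2 p * norm x"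
    and "0 \<le> pm1 p" and "0 \<le> pm2 p" and "0 \<le> pm3 p" and "0 \<le> pm4 p"
    and "0 \<le> prho p" and "prho p < 1"
    and "0 < pgamma p" and "pgamma p < 1"
    and "0 < ppsi p" and "0 < phi2 p" and "phi2 p < 1"
  shows "\<exists>\<C>\<^sub>1 \<C>\<^sub>2 \<C>\<^sub>3 \<C>\<^sub>4 \<C>\<^sub>5 :: real.
    \<forall>(N :: nat) (K :: nat) (T :: nat) (\<alpha> :: real)
      (M :: 'w measure) (S :: nat \<Rightarrow> 'y measure) (Y :: nat \<Rightarrow> nat \<Rightarrow> 'w \<Rightarrow> 'y)
      (G :: nat \<Rightarrow> real ^ 'd \<Rightarrow> 'y \<Rightarrow> real ^ 'd) (b :: nat \<Rightarrow> 'y \<Rightarrow> real ^ 'd)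
      (Gbar :: nat \<Rightarrow> real ^ 'd \<Rightarrow> real ^ 'd) (bbar :: nat \<Rightarrow> real ^ 'd)
      (\<theta>fix :: nat \<Rightarrow> real ^ 'd) (\<theta>star :: real ^ 'd) (That :: 'w \<Rightarrow> nat).
    let \<eta> = (\<lambda>i. cn (\<theta>fix i - \<theta>star));
        \<epsilon> = (1 / real N) * (\<Sum>i<N. \<eta> i);
        \<theta> = (\<lambda>i t \<omega>. fegsam N K \<alpha> G b \<theta>0 (\<lambda>j s. Y j s \<omega>) t i);
        \<tau> = tau p \<alpha>
    in 1 \<le> N \<longrightarrow> 1 \<le> K \<longrightarrow> 0 < \<alpha> \<longrightarrow> small_step p K \<alpha> \<longrightarrow>
       max (K + \<tau>) (2 * \<tau>) \<le> T \<longrightarrow>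
       prob_space M \<longrightarrow>
       markov_noise M N S Y \<longrightarrow>
       (\<forall>i<N. Gbar i (\<theta>fix i) + bbar i = \<theta>fix i) \<longrightarrow>
       agent_mean N (\<lambda>i. Gbar i \<theta>star) = \<theta>star \<longrightarrow>
       mixing p cn M N S Y G b Gbar bbar \<eta> \<longrightarrow>
       contraction p cn N Gbar \<longrightarrow>
       lipschitz_bounded p cn N S G b \<longrightarrow>
       independent_noise M N S Y \<theta> \<longrightarrow>
       sampled_time p M N S Y \<alpha> T That \<longrightarrow>
       (\<integral>\<omega>. (cn (agent_mean N (\<lambda>i. \<theta> i (That \<omega>) \<omega>) - \<theta>star))\<^sup>2 \<partial>M)
         \<le> \<C>\<^sub>1 * (1 / \<alpha>) * c_fsam p \<alpha> ^ (T - 2 * \<tau> + 1)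
           + \<C>\<^sub>2 * (\<alpha> * (real \<tau>)\<^sup>2 / real N)
           + \<C>\<^sub>3 * (real K - 1) * \<alpha>\<^sup>2 * real \<tau>
           + \<C>\<^sub>4 * (real K - 1)\<^sup>2 * \<epsilon> * \<alpha>\<^sup>2 * real \<tau>
           + \<C>\<^sub>5 * \<alpha> ^ 3 * (real \<tau>)\<^sup>2"
proof -
  note cn = assms(1) and sn = assms(2) and sm = assms(3)
  \<comment> \<open>The smoothness constant of the envelope once \<open>sn\<close> is replaced by
    \<open>cn\<close>, which costs the square of \<open>plcs p\<close>. Like \<open>U\<close>, it
    depends on \<open>p\<close> alone.\<close>
  define \<Lambda> where "\<Lambda> = pL p / (ppsi p * (plcs p)\<^sup>2)"
  define U where "U = 1 + ppsi p * (pucs p)\<^sup>2"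
  have L: "1 \<le> pL p" by (rule smooth_wrt_sq_ge1[OF sn sm])
  \<comment> \<open>One nonzero vector suffices to compare the lower with the upper equivalence
    constants.\<close>
  obtain v :: "real ^ 'd" where v: "v \<in> Basis" using nonempty_Basis by blast
  have "sn v \<noteq> 0" using v sn by (auto simp: is_norm_def)
  then have "0 < sn v" using is_norm_ge0[OF sn, of v] by linarith
  moreover have "plcs p * sn v \<le> pucs p * sn v" using assms(6)[of v] assms(7)[of v] by linarith
  ultimately have cs: "plcs p \<le> pucs p" by simp
  have "plc2 p * norm v \<le> puc2 p * norm v" using assms(10)[of v] assms(11)[of v] by linarith
  then have c2: "plc2 p \<le> puc2 p" using v by simp
  obtain m g where m: "is_norm m"
    and m_le: "\<And>x. (1 + ppsi p * (plcs p)\<^sup>2) * (m x)\<^sup>2 \<le> (cn x)\<^sup>2"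
    and le_m: "\<And>x. (cn x)\<^sup>2 \<le> U * (m x)\<^sup>2"
    and smooth: "\<And>x y. (m y)\<^sup>2 / 2 \<le> (m x)\<^sup>2 / 2 + g x \<bullet> (y - x) + pL p / (2 * ppsi p) * (sn (y - x))\<^sup>2"
    unfolding U_def
    by (rule envelope_norm[OF cn sn sm assms(4,5,6,7,8,10,20)]) blast
  have \<psi>l: "0 < ppsi p * (plcs p)\<^sup>2" using assms(4,20) by simp
  have U0: "0 < U" using assms(20) by (simp add: U_def add_pos_nonneg)
  have sq_m_le: "(m x)\<^sup>2 \<le> (cn x)\<^sup>2" for x
  proof -
    have "1 * (m x)\<^sup>2 \<le> (1 + ppsi p * (plcs p)\<^sup>2) * (m x)\<^sup>2" using \<psi>l by (intro mult_right_mono) auto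
    then show ?thesis using m_le[of x] by linarith
  qed
  have sn_m: "smooth_norm m cn g \<Lambda>"
  proof
    show "is_norm m" "is_norm cn" by (rule m, rule cn)
    show "0 < \<Lambda>" using L \<psi>l by (simp add: \<Lambda>_def)
    fix x y
    have "(plcs p * sn (y - x))\<^sup>2 \<le> (cn (y - x))\<^sup>2"
      using assms(4,6) is_norm_ge0[OF sn] by (intro power_mono) auto
    then have "pL p / (2 * ppsi p) * (sn (y - x))\<^sup>2 \<le> \<Lambda> / 2 * (cn (y - x))\<^sup>2"
      using L assms(4,20) by (simp add: \<Lambda>_def field_simps power_mult_distrib)
    then show "(m y)\<^sup>2 / 2 \<le> (m x)\<^sup>2 / 2 + g x \<bullet> (y - x) + \<Lambda> / 2 * (cn (y - x))\<^sup>2"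
      using smooth[of y x] by linarith
  qed
  show ?thesis
  \<comment> \<open>The witnesses are built from \<open>p\<close>, the norm of the start
    \<open>\<theta>0\<close> and the two constants above, all fixed before N, K, T and
    alpha.\<close>
  proof (rule exI[of _ "err1 p (cn \<theta>0) \<Lambda> U"], rule exI[of _ "err2 p \<Lambda> U"], rule exI[of _ "err3 p \<Lambda> U"],
      rule exI[of _ "err4 p \<Lambda> U"], rule exI[of _ "err5 p \<Lambda> U"], intro allI, unfold Let_def, intro impI)
    fix N K T :: nat and \<alpha> :: real and M :: "'w measure" and S :: "nat \<Rightarrow> 'y measure" and Y G b Gbar bbar
      and \<theta>fix :: "nat \<Rightarrow> real ^ 'd" and \<theta>star :: "real ^ 'd" and That
    assume h: "1 \<le> N" "1 \<le> K" "0 < \<alpha>" "small_step p K \<alpha>" "max (K + tau p \<alpha>) (2 * tau p \<alpha>) \<le> T"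
      "prob_space M" "markov_noise M N S Y"
      "\<forall>i<N. Gbar i (\<theta>fix i) + bbar i = \<theta>fix i" "agent_mean N (\<lambda>i. Gbar i \<theta>star) = \<theta>star"
      "mixing p cn M N S Y G b Gbar bbar (\<lambda>i. cn (\<theta>fix i - \<theta>star))" "contraction p cn N Gbar"
      "lipschitz_bounded p cn N S G b"
      "independent_noise M N S Y (\<lambda>i t \<omega>. fegsam N K \<alpha> G b \<theta>0 (\<lambda>j s. Y j s \<omega>) t i)"
      "sampled_time p M N S Y \<alpha> T That"
    have \<alpha>1: "\<alpha> \<le> 1"
    proof -
      have "\<alpha> \<le> 1 / C_1 p" using h(4) by (simp add: small_step_def)
      also have "1 \<le> sqrt ((pA2 p)\<^sup>2 + 1)" by simp
      then have "1 \<le> C_1 p" unfolding C_1_def by linarith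
      then have "1 / C_1 p \<le> 1" by simp
      finally show ?thesis .
    qed
    interpret prob_space M by (rule h(6))
    interpret fegsam_process M p cn \<theta>0 N K \<alpha> S Y G b Gbar bbar "\<lambda>i. cn (\<theta>fix i - \<theta>star)"
      by unfold_locales (use h \<alpha>1 assms is_norm_ge0[OF cn] in \<open>assumption | simp\<close>)+
    note st = small_step_tau[OF h(3) assms(16,17) h(4)]
    note sb = small_step_bounds[OF h(3) assms(16,17) h(4) L assms(4) cs assms(8) c2 assms(20,21,22,12,15)
        constants_nonneg(1,2) h(2), folded \<Lambda>_def U_def]
    \<comment> \<open>Passing from \<open>m\<close> to \<open>cn\<close> and back costs the factor
      \<open>sqrt (phi1 p)\<close>, which is where \<open>phi2\<close> comes from; duality and
      Euler's identity for \<open>g\<close> then turn the contraction into a negative inner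
      product.\<close>
    have contr: "g x \<bullet> (Gbar i x - x) \<le> - phi2 p * (m x)\<^sup>2" if i: "i < N" for i x
    proof -
      have "(1 + ppsi p * (plcs p)\<^sup>2) * (m (Gbar i x))\<^sup>2 \<le> (cn (Gbar i x))\<^sup>2" by (rule m_le)
      also have "\<dots> \<le> (pgamma p * cn x)\<^sup>2" by (intro power_mono Gbar_bound i) simp
      also have "\<dots> \<le> (pgamma p)\<^sup>2 * (U * (m x)\<^sup>2)" by (simp add: power_mult_distrib mult_left_mono le_m)
      finally have "(m (Gbar i x))\<^sup>2 \<le> (pgamma p)\<^sup>2 * phi1 p * (m x)\<^sup>2"
        using \<psi>l by (simp add: phi1_def U_def field_simps)
      also have "\<dots> = (pgamma p * sqrt (phi1 p) * m x)\<^sup>2"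
        using \<psi>l assms(20) by (simp add: power_mult_distrib phi1_def add_nonneg_nonneg)
      finally have "m (Gbar i x) \<le> pgamma p * sqrt (phi1 p) * m x"
        by (rule power2_le_imp_le)
           (use assms(18,20) \<psi>l is_norm_ge0[OF m] in \<open>simp add: phi1_def add_nonneg_nonneg\<close>)
      then have "m x * m (Gbar i x) \<le> m x * (pgamma p * sqrt (phi1 p) * m x)"
        using is_norm_ge0[OF m] by (intro mult_left_mono)
      then have "g x \<bullet> Gbar i x \<le> pgamma p * sqrt (phi1 p) * (m x)\<^sup>2"
        using smooth_norm.gradient_le[OF sn_m, of x "Gbar i x"] by (simp add: power2_eq_square mult_ac)
      then show ?thesis
        by (simp add: inner_diff_right smooth_norm.gradient_self[OF sn_m] phi2_def algebra_simps)
    qed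
    interpret fegsam_lyapunov M p cn \<theta>0 N K \<alpha> S Y G b Gbar bbar "\<lambda>i. cn (\<theta>fix i - \<theta>star)" m g \<Lambda> U "phi2 p" "tau p \<alpha>"
    proof (intro fegsam_lyapunov.intro fegsam_lyapunov_axioms.intro)
      show "smooth_norm m cn g \<Lambda>" by (rule sn_m)
    qed (use fegsam_process_axioms U0 le_m sq_m_le assms(21) contr st in auto)
    have "\<theta>star = 0" by (rule Gbar_mean_fixpoint[OF h(9)])
    then have "(\<integral>\<omega>. (cn (agent_mean N (\<lambda>i. fegsam N K \<alpha> G b \<theta>0 (\<lambda>j s. Y j s \<omega>) (That \<omega>) i) - \<theta>star))\<^sup>2 \<partial>M)
      = (\<integral>\<omega>. (cn (th (That \<omega>) \<omega>))\<^sup>2 \<partial>M)"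
      by (simp add: th_def X_def)
    also have "\<dots> \<le> err1 p (cn \<theta>0) \<Lambda> U * (1 / \<alpha>) * c_fsam p \<alpha> ^ (T - 2 * tau p \<alpha> + 1)
      + err2 p \<Lambda> U * (\<alpha> * (real (tau p \<alpha>))\<^sup>2 / real N)
      + err3 p \<Lambda> U * (real K - 1) * \<alpha>\<^sup>2 * real (tau p \<alpha>)
      + err4 p \<Lambda> U * (real K - 1)\<^sup>2 * ((1 / real N) * (\<Sum>i<N. cn (\<theta>fix i - \<theta>star))) * \<alpha>\<^sup>2 * real (tau p \<alpha>)
      + err5 p \<Lambda> U * \<alpha> ^ 3 * (real (tau p \<alpha>))\<^sup>2"
      by (rule error_bound) (use sb assms(22) h(5,14) in \<open>auto simp: mult.assoc\<close>)
    finally show "(\<integral>\<omega>. (cn (agent_mean N (\<lambda>i. fegsam N K \<alpha> G b \<theta>0 (\<lambda>j s. Y j s \<omega>) (That \<omega>) i) - \<theta>star))\<^sup>2 \<partial>M)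
      \<le> err1 p (cn \<theta>0) \<Lambda> U * (1 / \<alpha>) * c_fsam p \<alpha> ^ (T - 2 * tau p \<alpha> + 1)
      + err2 p \<Lambda> U * (\<alpha> * (real (tau p \<alpha>))\<^sup>2 / real N)
      + err3 p \<Lambda> U * (real K - 1) * \<alpha>\<^sup>2 * real (tau p \<alpha>)
      + err4 p \<Lambda> U * (real K - 1)\<^sup>2 * ((1 / real N) * (\<Sum>i<N. cn (\<theta>fix i - \<theta>star))) * \<alpha>\<^sup>2 * real (tau p \<alpha>)
      + err5 p \<Lambda> U * \<alpha> ^ 3 * (real (tau p \<alpha>))\<^sup>2" .
  qed
qed

end
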